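(* Let $\Omega\colon\mathbb{R}\to\mathbb{R}_+$ be a continual diagram and let $\epsilon>0$ and $z_0\in\mathbb{R}$ be fixed. Assume that $z_+^{\max}$ is the maximal solution of the equation \[\Omega(z_+^{\max}-\epsilon)-\Omega(z_0-\epsilon)=z_+^{\max}-z_0-2\epsilon.\] Then for every continual diagram $\omega$ with $d(\Omega,\omega)\le\epsilon$, \[\lim_{\tau\to0^+}K_\omega(z_0-\tau)\ \le\ 1-\int_{z_+^{\max}-\epsilon}^{\infty}\left[1-\frac{\epsilon}{z+2\epsilon-z_+^{\max}}\right]d\mu_\Omega(z)=\int_{-\infty}^{\infty}\left(\mathbbm{1}_{(-\infty,\,z_+^{\max}-\epsilon)}(z)+\mathbbm{1}_{[z_+^{\max}-\epsilon,\,\infty)}(z)\,\frac{\epsilon}{z+2\epsilon-z_+^{\max}}\right)d\mu_\Omega(z).\]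
   Context: A continual diagram is a function $\omega\colon\mathbb{R}\to\mathbb{R}_+$ such that $|\omega(z_1)-\omega(z_2)|\le|z_1-z_2|$ for all $z_1,z_2$, and $\omega(z)=|z|$ for all sufficiently large $|z|$. Transition measure: $\log[z\,\mathbf{G}_\omega(z)]=-\int_{-\infty}^\infty\frac{1}{z-w}\big(\frac{\omega(w)-|w|}{2}\big)'\,dw$ for $z\in\mathbb{C}\setminus\mathbb{R}$, and $\mu_\omega$ is the unique probability measure with $\mathbf{G}_\omega(z)=\int\frac{d\mu_\omega(x)}{z-x}$; $K_\omega(z)=\mu_\omega((-\infty,z])$. Metric $d$: for $x,y\ge0$ write $(x,y)\in\omega$ if $\omega(x-y)=x+y$; $\Pi^\omega_Y(x)=\{y\ge0:(x,y)\in\omega\}$, $\Pi^\omega_X(y)=\{x\ge0:(x,y)\in\omega\}$; $d_Y(\omega_1,\omega_2)=\sup_{x\ge0}d_H(\Pi^{\omega_1}_Y(x),\Pi^{\omega_2}_Y(x))$, $d_X(\omega_1,\omega_2)=\sup_{y\ge0}d_H(\Pi^{\omega_1}_X(y),\Pi^{\omega_2}_X(y))$ ($d_H$ = Hausdorff distance), $d=\max(d_X,d_Y)$. *)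

theory Defs
  imports "HOL-Probability.Probability"
begin

definition continual_diagram :: "(real \<Rightarrow> real) \<Rightarrow> bool" where
  "continual_diagram \<omega> \<longleftrightarrow>
     (\<forall>z. 0 \<le> \<omega> z) \<and>
     (\<forall>z1 z2. \<bar>\<omega> z1 - \<omega> z2\<bar> \<le> \<bar>z1 - z2\<bar>) \<and>
     (\<exists>R. \<forall>z. R \<le> \<bar>z\<bar> \<longrightarrow> \<omega> z = \<bar>z\<bar>)"

text \<open>Transition measure: a Borel probability measure on the reals whose Cauchy transform G
  satisfies  z G(z) = exp( - int 1/(z-w) ((omega(w)-|w|)/2)' dw )  for all non-real z
  (i.e. log[z G(z)] equals the right-hand side).  The derivative exists almost everywhere
  (omega is Lipschitz); the integral is w.r.t. Lebesgue measure.\<close>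
definition is_transition_measure :: "(real \<Rightarrow> real) \<Rightarrow> real measure \<Rightarrow> bool" where
  "is_transition_measure \<omega> \<mu> \<longleftrightarrow>
     prob_space \<mu> \<and> sets \<mu> = sets borel \<and>
     (\<forall>z::complex. Im z \<noteq> 0 \<longrightarrow>
        z * (\<integral>x. 1 / (z - complex_of_real x) \<partial>\<mu>) =
        exp (- (\<integral>w. (1 / (z - complex_of_real w)) *
                     complex_of_real (deriv (\<lambda>v. (\<omega> v - \<bar>v\<bar>) / 2) w) \<partial>lebesgue)))"

definition Kfun :: "real measure \<Rightarrow> real \<Rightarrow> real" where
  "Kfun \<mu> z = measure \<mu> {..z}"

definition PiY :: "(real \<Rightarrow> real) \<Rightarrow> real \<Rightarrow> real set" where
  "PiY \<omega> x = {y. 0 \<le> y \<and> \<omega> (x - y) = x + y}"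

definition PiX :: "(real \<Rightarrow> real) \<Rightarrow> real \<Rightarrow> real set" where
  "PiX \<omega> y = {x. 0 \<le> x \<and> \<omega> (x - y) = x + y}"

definition hausd :: "real set \<Rightarrow> real set \<Rightarrow> ereal" where
  "hausd A B = max (SUP a\<in>A. ereal (infdist a B)) (SUP b\<in>B. ereal (infdist b A))"

definition dY :: "(real \<Rightarrow> real) \<Rightarrow> (real \<Rightarrow> real) \<Rightarrow> ereal" where
  "dY \<omega>1 \<omega>2 = (SUP x\<in>{0..}. hausd (PiY \<omega>1 x) (PiY \<omega>2 x))"

definition dX :: "(real \<Rightarrow> real) \<Rightarrow> (real \<Rightarrow> real) \<Rightarrow> ereal" where
  "dX \<omega>1 \<omega>2 = (SUP y\<in>{0..}. hausd (PiX \<omega>1 y) (PiX \<omega>2 y))"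

definition ddist :: "(real \<Rightarrow> real) \<Rightarrow> (real \<Rightarrow> real) \<Rightarrow> ereal" where
  "ddist \<omega>1 \<omega>2 = max (dX \<omega>1 \<omega>2) (dY \<omega>1 \<omega>2)"

end

theory Submission
  imports Defs "HOL-Complex_Analysis.Complex_Analysis"
begin

text \<open>
  Write the Cauchy transform of a transition measure as \<open>1/z exp(- \<integral> (s - sgn)/2 / (z - w) dw)\<close>,
  where \<open>s\<close> is the slope of the diagram. Changing \<open>s\<close> on one side of a point \<open>p\<close> multiplies the measure on
  the other side by an explicit positive density, which is at least 1 if the diagram is raised left of
  \<open>p\<close> (looking from the right), or raised right of \<open>p\<close> (looking from the left). Hence raising the diagram
  right of \<open>p\<close> and lowering it left of \<open>p\<close>, with its value at \<open>p\<close> fixed, increases the mass left of \<open>p\<close>.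

  The condition \<open>d(\<Omega>, \<omega>) \<le> \<epsilon>\<close> gives \<open>\<Omega>(u - \<epsilon>) - \<epsilon> \<le> \<omega>(u) \<le> \<Omega>(u - \<epsilon>) + \<epsilon>\<close>. The extremal diagram follows the
  lower bound up to \<open>z0\<close>, then has slope 1 up to \<open>zmax\<close>, where it meets the upper bound, and follows the
  upper bound afterwards. It crosses \<open>\<omega>\<close> at some \<open>p\<close> between \<open>z0\<close> and \<open>zmax\<close>, so the transition measure of \<open>\<omega>\<close>
  has at most the mass of the extremal one left of \<open>p\<close>. Compared with the shift of \<open>\<Omega>\<close> by \<open>\<epsilon>\<close>, the extremal
  slope is larger by a density of total mass \<open>\<epsilon>\<close> on \<open>[z0, zmax]\<close>; the resulting factor right of \<open>zmax\<close> is
  smallest when this mass is packed against \<open>zmax\<close>, which gives the bound.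
\<close>

text \<open>The transition measure is known only through its transform off the real axis, so
  one-sided densities have to be recovered as boundary values, and these are under control only away
  from the points where two slopes differ. A diagram that differs from \<open>\<omega>\<close> on
  both sides of \<open>p\<close> is therefore not compared with it in one step: a hybrid, extremal
  left of \<open>p\<close> and equal to \<open>\<omega>\<close> right of \<open>p\<close>, is placed
  between them, so that each comparison alters one side and reads off the other. At \<open>p\<close>
  itself the densities give no information; a possible atom there is compared through the limit of
  \<eta> |G(p + i \<eta>)|. The extremal diagram and the hybrid come without a transition measure,
  so existence is proved for every admissible slope. Working with slopes also covers the shift of
  \<open>\<Omega>\<close> by \<epsilon>, which is not centred at the origin. At \<open>p\<close> the
  comparisons start from an ordering of diagrams, not of slopes. It becomes the sign of an exponent
  because 1/(t - w) is monotone in w on intervals that miss t, by the second mean value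
  theorem.\<close>

section \<open>Differentiability of Lipschitz functions almost everywhere\<close>

text \<open>Where the difference quotients stay away from \<open>s x\<close>, the offending intervals form a Vitali cover;
a disjoint subfamily almost covers the set, and Henstock's lemma bounds its total length.\<close>

lemma negligible_not_has_derivative_indefinite_integral:
  fixes s F :: "real \<Rightarrow> real"
  assumes int: "\<And>a b. a \<le> b \<Longrightarrow> (s has_integral (F b - F a)) {a..b}"
  shows "negligible {x. \<not> (F has_real_derivative s x) (at x)}"
proof -
  \<comment> \<open>The exceptional set is split into countably many pieces: the error of the
    difference quotient is at least 1/(n+1) at arbitrarily small scales, and x stays in a bounded
    interval, where Henstock's lemma applies.\<close>
  define Bad where "Bad n R = {x. \<bar>x\<bar> < real R \<and> (\<forall>d>0. \<exists>y. y \<noteq> x \<and> \<bar>y - x\<bar> < d \<and>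
      \<bar>y - x\<bar> / real (Suc n) \<le> \<bar>F y - F x - s x * (y - x)\<bar>)}" for n R :: nat
  have neg: "negligible (Bad n R)" for n R
    unfolding negligible_outer_le
  proof (intro allI impI)
    fix e :: real assume "e > 0"
    have "s integrable_on cbox (- real R) (real R)"
      using int[of "- real R" "real R"] by (auto simp: integrable_on_def)
    \<comment> \<open>Every interval of the cover will contribute at least its length divided by
      n+1, so this tolerance bounds the total length by e.\<close>
    then obtain \<gamma> where "gauge \<gamma>" and \<gamma>: "\<And>p. \<lbrakk>p tagged_partial_division_of cbox (- real R) (real R); \<gamma> fine p\<rbrakk>
        \<Longrightarrow> (\<Sum>(x,k)\<in>p. norm (measure lborel k *\<^sub>R s x - integral k s)) < e / real (Suc n)"
      using Henstock_lemma[of s "- real R" "real R" "e / real (Suc n)"] \<open>e > 0\<close> by auto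
    \<comment> \<open>Each interval has the bad point x both as an end and as its tag;
      \<open>c\<close> and \<open>r\<close> describe it as a closed ball for the covering
      theorem.\<close>
    define I where "I = (\<lambda>(x,y). {min x y..max x (y::real)})"
    define K where "K = {(x,y). x \<in> Bad n R \<and> y \<noteq> x \<and> \<bar>y\<bar> \<le> real R \<and> I (x,y) \<subseteq> \<gamma> x \<and>
        \<bar>y - x\<bar> / real (Suc n) \<le> \<bar>F y - F x - s x * (y - x)\<bar>}"
    define c where "c = (\<lambda>(x,y). (x + y) / (2::real))"
    define r where "r = (\<lambda>(x,y). \<bar>y - x\<bar> / (2::real))"
    have ball: "cball (c i) (r i) = I i" for i
      by (auto simp: c_def r_def I_def cball_eq_atLeastAtMost split: prod.splits)
        (auto simp: min_def max_def abs_if field_simps split: if_splits)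
    have cov: "\<exists>i. i \<in> K \<and> x \<in> cball (c i) (r i) \<and> r i < d" if x: "x \<in> Bad n R" and "d > 0" for x d
    proof -
      obtain d1 where d1: "d1 > 0" "ball x d1 \<subseteq> \<gamma> x"
        using \<open>gauge \<gamma>\<close> unfolding gauge_def by (meson open_contains_ball)
      have xR: "\<bar>x\<bar> < real R" using x by (auto simp: Bad_def)
      define m where "m = min (min d1 d) (real R - \<bar>x\<bar>)"
      have "m > 0" using d1 \<open>d > 0\<close> xR by (auto simp: m_def)
      then obtain y where y: "y \<noteq> x" "\<bar>y - x\<bar> < m"
        "\<bar>y - x\<bar> / real (Suc n) \<le> \<bar>F y - F x - s x * (y - x)\<bar>"
        using x unfolding Bad_def by blast
      have "I (x,y) \<subseteq> ball x d1"
        using y(2) by (auto simp: I_def m_def dist_real_def)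
      moreover have "\<bar>y\<bar> \<le> real R" using y(2) by (auto simp: m_def)
      ultimately have "(x,y) \<in> K" using x y d1 by (auto simp: K_def)
      moreover have "x \<in> cball (c (x,y)) (r (x,y))" unfolding ball by (auto simp: I_def)
      moreover have "r (x,y) < d" using y(2) by (auto simp: r_def m_def)
      ultimately show ?thesis by blast
    qed
    have rpos: "\<And>i. i \<in> K \<Longrightarrow> 0 < r i" by (auto simp: K_def r_def)
    obtain C where C: "countable C" "C \<subseteq> K"
        "pairwise (\<lambda>i j. disjnt (cball (c i) (r i)) (cball (c j) (r j))) C"
        "negligible (Bad n R - (\<Union>i\<in>C. cball (c i) (r i)))"
      using Vitali_covering_theorem_cballs[OF rpos cov] by blast
    have bound: "(\<Sum>i\<in>C'. measure lebesgue (I i)) \<le> e" if C': "C' \<subseteq> C" "finite C'" for C'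
    proof -
      define p where "p = (\<lambda>i. (fst i, I i)) ` C'"
      have inj: "inj_on (\<lambda>i. (fst i, I i)) C'"
        by (auto simp: inj_on_def I_def Icc_eq_Icc min_def max_def split: if_splits)
      have disj: "I i \<inter> I j = {}" if "i \<in> C'" "j \<in> C'" "i \<noteq> j" for i j
        using C(3) that C' unfolding pairwise_def disjnt_def ball by blast
      have "p tagged_partial_division_of cbox (- real R) (real R)"
        unfolding tagged_partial_division_of_def
      proof (intro conjI allI impI)
        show "finite p" using C' by (simp add: p_def)
      next
        fix x k assume "(x,k) \<in> p"
        then obtain y where xy: "(x,y) \<in> C'" "k = I (x,y)" by (auto simp: p_def)
        then have "(x,y) \<in> K" using C C' by auto
        then have xyR: "\<bar>x\<bar> < real R" "\<bar>y\<bar> \<le> real R" by (auto simp: K_def Bad_def)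
        show "x \<in> k" by (simp add: xy I_def)
        show "k \<subseteq> cbox (- real R) (real R)" using xyR by (auto simp: xy I_def)
        show "\<exists>a b. k = cbox a b" by (auto simp: xy I_def)
      next
        fix x1 k1 x2 k2 assume "(x1,k1) \<in> p \<and> (x2,k2) \<in> p \<and> (x1,k1) \<noteq> (x2,k2)"
        then obtain i j where ij: "i \<in> C'" "j \<in> C'" "k1 = I i" "k2 = I j" "i \<noteq> j"
          by (auto simp: p_def)
        then have "k1 \<inter> k2 = {}" using disj by auto
        then show "interior k1 \<inter> interior k2 = {}"
          using interior_subset[of k1] interior_subset[of k2] by blast
      qed
      moreover have "\<gamma> fine p"
      proof -
        have "I i \<subseteq> \<gamma> (fst i)" if "i \<in> C'" for i
          using that C(2) C'(1) by (force simp: K_def)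
        then show ?thesis by (auto simp: fine_def p_def)
      qed
      ultimately have "(\<Sum>(x,k)\<in>p. norm (measure lborel k *\<^sub>R s x - integral k s)) < e / real (Suc n)"
        by (rule \<gamma>)
      also have "(\<Sum>(x,k)\<in>p. norm (measure lborel k *\<^sub>R s x - integral k s)) =
          (\<Sum>i\<in>C'. norm (measure lborel (I i) *\<^sub>R s (fst i) - integral (I i) s))"
        unfolding p_def by (subst sum.reindex[OF inj]) (simp add: o_def)
      finally have 1: "(\<Sum>i\<in>C'. norm (measure lborel (I i) *\<^sub>R s (fst i) - integral (I i) s)) < e / real (Suc n)" .
      have "measure lebesgue (I i) / real (Suc n) \<le> norm (measure lborel (I i) *\<^sub>R s (fst i) - integral (I i) s)" if "i \<in> C'" for i
      proof -
        obtain x y where i: "i = (x,y)" by force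
        have "(x,y) \<in> K" using that i C C' by auto
        then have xy: "y \<noteq> x" "\<bar>y - x\<bar> / real (Suc n) \<le> \<bar>F y - F x - s x * (y - x)\<bar>" by (auto simp: K_def)
        have in1: "integral (I i) s = F (max x y) - F (min x y)"
          using int[of "min x y" "max x y"] by (simp add: i I_def integral_unique)
        have ct: "measure lborel (I i) = \<bar>y - x\<bar>" "measure lebesgue (I i) = \<bar>y - x\<bar>" by (auto simp: i I_def min_def max_def)
        have "norm (\<bar>y - x\<bar> *\<^sub>R s x - (F (max x y) - F (min x y))) = \<bar>F y - F x - s x * (y - x)\<bar>"
          using xy(1) by (cases "x < y") (auto simp: min_def max_def algebra_simps abs_if)
        then have "norm (measure lborel (I i) *\<^sub>R s (fst i) - integral (I i) s) = \<bar>F y - F x - s x * (y - x)\<bar>"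
          unfolding in1 ct by (simp add: i)
        then show ?thesis using xy(2) unfolding ct by simp
      qed
      then have "(\<Sum>i\<in>C'. measure lebesgue (I i) / real (Suc n)) \<le> e / real (Suc n)"
        using 1 by (meson less_eq_real_def order_trans sum_mono)
      then show ?thesis
        by (simp add: sum_divide_distrib[symmetric] divide_le_cancel del: of_nat_Suc)
    qed
    have lm: "I i \<in> lmeasurable" for i by (auto simp: I_def split: prod.splits)
    have U: "(\<Union>i\<in>C. I i) \<in> lmeasurable" "measure lebesgue (\<Union>i\<in>C. I i) \<le> e"
    proof -
      have *: "measure lebesgue (\<Union>i\<in>C'. I i) \<le> e" if C': "C' \<subseteq> C" "finite C'" for C'
        using measure_UNION_le[of C' I lebesgue] lm bound[OF C'] C'
        by (meson fmeasurableD order_trans)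
      show "(\<Union>i\<in>C. I i) \<in> lmeasurable"
        by (rule fmeasurable_UN_bound[OF C(1) lm *])
      show "measure lebesgue (\<Union>i\<in>C. I i) \<le> e"
        by (rule measure_UN_bound[OF C(1) lm *])
    qed
    let ?N = "Bad n R - (\<Union>i\<in>C. I i)"
    have N: "negligible ?N" using C(4) by (simp add: ball)
    show "\<exists>T. Bad n R \<subseteq> T \<and> T \<in> lmeasurable \<and> measure lebesgue T \<le> e"
    proof (intro exI conjI)
      show "Bad n R \<subseteq> (\<Union>i\<in>C. I i) \<union> ?N" by blast
      show "(\<Union>i\<in>C. I i) \<union> ?N \<in> lmeasurable"
        using U N negligible_imp_measurable by blast
      have "measure lebesgue ((\<Union>i\<in>C. I i) \<union> ?N) \<le> measure lebesgue (\<Union>i\<in>C. I i) + measure lebesgue ?N"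
        using U(1) N negligible_imp_sets by (intro measure_Un_le) auto
      then show "measure lebesgue ((\<Union>i\<in>C. I i) \<union> ?N) \<le> e"
        using U(2) negligible_imp_measure0[OF N] by simp
    qed
  qed
  have "{x. \<not> (F has_real_derivative s x) (at x)} \<subseteq> (\<Union>n. \<Union>R. Bad n R)"
  proof safe
    fix x assume nd: "\<not> (F has_real_derivative s x) (at x)"
    obtain R :: nat where R: "\<bar>x\<bar> < real R" using reals_Archimedean2 by blast
    show "x \<in> (\<Union>n. \<Union>R. Bad n R)"
    proof (rule ccontr)
      assume nb: "x \<notin> (\<Union>n. \<Union>R. Bad n R)"
      have "((\<lambda>y. (F y - F x) / (y - x)) \<longlongrightarrow> s x) (at x)"
      proof (rule LIM_I)
        fix e :: real assume "e > 0"
        then obtain n where n: "inverse (real (Suc n)) < e" using reals_Archimedean by blast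
        from nb R have "\<not> (\<forall>d>0. \<exists>y. y \<noteq> x \<and> \<bar>y - x\<bar> < d \<and>
           \<bar>y - x\<bar> / real (Suc n) \<le> \<bar>F y - F x - s x * (y - x)\<bar>)" unfolding Bad_def by blast
        then obtain d where d: "d > 0" "\<And>y. y \<noteq> x \<Longrightarrow> \<bar>y - x\<bar> < d \<Longrightarrow>
           \<bar>F y - F x - s x * (y - x)\<bar> < \<bar>y - x\<bar> / real (Suc n)" by (meson not_le)
        show "\<exists>d>0. \<forall>y. y \<noteq> x \<and> norm (y - x) < d \<longrightarrow> norm ((F y - F x) / (y - x) - s x) < e"
        proof (intro exI[of _ d] conjI allI impI d(1))
          fix y assume y: "y \<noteq> x \<and> norm (y - x) < d"
          have "(F y - F x) / (y - x) - s x = (F y - F x - s x * (y - x)) / (y - x)"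
            using y by (simp add: field_simps)
          then have "norm ((F y - F x) / (y - x) - s x) = \<bar>F y - F x - s x * (y - x)\<bar> / \<bar>y - x\<bar>"
            by simp
          also have "\<dots> < (\<bar>y - x\<bar> / real (Suc n)) / \<bar>y - x\<bar>"
            using d(2)[of y] y by (intro divide_strict_right_mono) auto
          also have "\<dots> = inverse (real (Suc n))" using y by (simp add: inverse_eq_divide del: of_nat_Suc)
          finally show "norm ((F y - F x) / (y - x) - s x) < e" using n by simp
        qed
      qed
      then show False using nd by (simp add: has_field_derivative_iff)
    qed
  qed
  moreover have "negligible (\<Union>n. \<Union>R. Bad n R)"
    by (intro negligible_countable_Union) (auto intro!: negligible_countable_Union neg)
  ultimately show ?thesis by (rule negligible_subset[rotated])
qed

text \<open>\<open>F\<close> and \<open>C x - F x\<close> are both nondecreasing and their Stieltjes measures add up to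
\<open>C\<close> times Lebesgue measure, so both are absolutely continuous.\<close>

lemma mono_lipschitz_has_integral_density:
  fixes F :: "real \<Rightarrow> real"
  assumes mono: "\<And>x y. x \<le> y \<Longrightarrow> F x \<le> F y"
    and lip: "\<And>x y. x \<le> y \<Longrightarrow> F y - F x \<le> C * (y - x)"
  shows "\<exists>s. s \<in> borel_measurable borel \<and> (\<forall>a b. a \<le> b \<longrightarrow> (s has_integral (F b - F a)) {a..b})"
proof -
  have C: "0 \<le> C" using lip[of 0 1] mono[of 0 1] by auto
  have cont: "continuous_on UNIV F"
  proof (rule lipschitz_on_continuous_on)
    show "C-lipschitz_on UNIV F"
    proof (rule lipschitz_onI[OF _ C])
      fix x y :: real
      show "dist (F x) (F y) \<le> C * dist x y"
        using lip[of x y] lip[of y x] mono[of x y] mono[of y x] by (cases "x \<le> y") (auto simp: dist_real_def)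
    qed
  qed
  then have rc: "continuous (at_right x) F" for x
    by (metis UNIV_I continuous_on_eq_continuous_within continuous_within_subset subset_UNIV)
  define G where "G x = C * x - F x" for x
  have Gmono: "x \<le> y \<Longrightarrow> G x \<le> G y" for x y using lip[of x y] by (auto simp: G_def algebra_simps)
  have Grc: "continuous (at_right x) G" for x unfolding G_def by (intro continuous_intros rc)
  let ?M = "interval_measure F" and ?N = "interval_measure G"
  have eM: "emeasure ?M {a<..b} = ennreal (F b - F a)" if "a \<le> b" for a b
    using emeasure_interval_measure_Ioc[OF that, of F] mono rc by auto
  have eN: "emeasure ?N {a<..b} = ennreal (G b - G a)" if "a \<le> b" for a b
    using emeasure_interval_measure_Ioc[OF that, of G] Gmono Grc by auto
  have sum: "emeasure ?M A + emeasure ?N A = ennreal C * emeasure lborel A" if A: "A \<in> sets borel" for A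
  proof -
    let ?P = "measure_of UNIV (sets borel) (\<lambda>A. emeasure ?M A + emeasure ?N A)"
    let ?Q = "density lborel (\<lambda>_. ennreal C)"
    have eP: "emeasure ?P A = emeasure ?M A + emeasure ?N A" if "A \<in> sets borel" for A
    proof (rule emeasure_measure_of[of ?P UNIV "sets borel"])
      show "countably_additive (sets ?P) (\<lambda>A. emeasure ?M A + emeasure ?N A)"
        unfolding countably_additive_def
        using sets.sigma_sets_eq[of "borel :: real measure"]
        by (auto simp: suminf_add[symmetric] suminf_emeasure)
    qed (use that in \<open>auto simp: positive_def sets.space_closed\<close>)
    have eQ: "emeasure ?Q A = ennreal C * emeasure lborel A" if "A \<in> sets borel" for A
      using that by (subst emeasure_density) (auto simp: nn_integral_cmult_indicator)
    have "?P = ?Q"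
    proof (rule measure_eqI_generator_eq_countable[where E="range (\<lambda>(a,b). {a<..b::real})" and \<Omega>=UNIV
          and A="range (\<lambda>n. {-real n<..real n})"])
      show "Int_stable (range (\<lambda>(a,b). {a<..b::real}))"
        by (auto simp: Int_stable_def image_iff)
      show "sets ?P = sigma_sets UNIV (range (\<lambda>(a,b). {a<..b::real}))" "sets ?Q = sigma_sets UNIV (range (\<lambda>(a,b). {a<..b::real}))"
        using sets.sigma_sets_eq[of "borel :: real measure"] by (simp_all add: borel_sigma_sets_Ioc)
      fix X assume "X \<in> range (\<lambda>(a,b). {a<..b::real})"
      then obtain a b where X: "X = {a<..b}" by auto
      show "emeasure ?P X = emeasure ?Q X"
      proof (cases "a \<le> b")
        case True
        then show ?thesis
          using mono[OF True] Gmono[OF True] C unfolding X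
          by (subst eP; simp?; subst eQ; simp add: eM eN G_def ennreal_plus[symmetric] ennreal_mult[symmetric] algebra_simps del: ennreal_plus)
      qed (simp add: X)
    next
      show "\<Union> (range (\<lambda>n. {- real n<..real n})) = UNIV"
      proof (intro set_eqI iffI UNIV_I)
        fix x :: real obtain n where "\<bar>x\<bar> < real n" using reals_Archimedean2 by blast
        then show "x \<in> \<Union> (range (\<lambda>n. {- real n<..real n}))" by (auto intro!: exI[of _ n])
      qed
      fix a assume "a \<in> range (\<lambda>n. {-real n<..real n})"
      then obtain n where "a = {-real n<..real n}" by auto
      then show "emeasure ?P a \<noteq> \<infinity>" by (simp add: eP eM eN)
    qed auto
    then show ?thesis using eP[OF A] eQ[OF A] by simp
  qed
  have "absolutely_continuous lborel ?M"
    unfolding absolutely_continuous_def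
  proof
    fix A :: "real set" assume "A \<in> null_sets lborel"
    then have "A \<in> sets borel" "emeasure lborel A = 0" by auto
    then show "A \<in> null_sets ?M" using sum[of A] by (auto simp: null_sets_def)
  qed
  then obtain d where d: "d \<in> borel_measurable lborel" "density lborel d = ?M"
    using sigma_finite_measure.Radon_Nikodym[OF sigma_finite_lborel, of ?M] by auto
  have "(enn2real \<circ> d has_integral (F b - F a)) {a..b}" if ab: "a \<le> b" for a b
  proof -
    have 1: "(\<integral>\<^sup>+x. d x * indicator {a<..b} x \<partial>lborel) = ennreal (F b - F a)"
      using emeasure_density[OF d(1), of "{a<..b}"] eM[OF ab] d(2) by simp
    \<comment> \<open>\<open>enn2real\<close> sends infinity to 0, so the density has to be finite
      almost everywhere for its integral to survive the conversion.\<close>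
    have "AE x in lborel. d x * indicator {a<..b} x \<noteq> \<infinity>"
      by (rule nn_integral_PInf_AE) (use d(1) 1 in auto)
    then have "(\<integral>\<^sup>+x. ennreal (enn2real (d x) * indicator {a<..b} x) \<partial>lborel) = (\<integral>\<^sup>+x. d x * indicator {a<..b} x \<partial>lborel)"
      by (intro nn_integral_cong_AE) (auto elim!: eventually_mono simp: indicator_def less_top)
    then have "((\<lambda>x. enn2real (d x) * indicator {a<..b} x) has_integral (F b - F a)) UNIV"
      using 1 d(1) mono[OF ab] by (intro nn_integral_has_integral) auto
    then have "(enn2real \<circ> d has_integral (F b - F a)) {a<..b}"
      by (subst has_integral_restrict_UNIV[symmetric]) (auto simp: indicator_def of_bool_def if_distrib o_def cong: if_cong)
    then show ?thesis
      by (rule iffD1[OF has_integral_spike_set_eq, rotated 2]) (auto intro: negligible_subset[of "{a}"])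
  qed
  moreover have "enn2real \<circ> d \<in> borel_measurable borel" using d(1) by auto
  ultimately show ?thesis by blast
qed

section \<open>Cauchy transforms of probability measures\<close>

text \<open>Cauchy's formula on the rectangle with base [-T, T] and height T. On the other three
  sides the integrand is of order 1/T^2 while their lengths are at most 2T, so only the base
  survives. For z below the axis the integrand has no pole in the rectangle.\<close>

lemma half_plane_integral_tendsto:
  fixes G :: "complex \<Rightarrow> complex"
  assumes holo: "G holomorphic_on {w. - \<eta> < Im w}" and \<eta>: "\<eta> > 0"
    and bd: "\<And>w. 0 \<le> Im w \<Longrightarrow> R \<le> norm w \<Longrightarrow> norm (G w) \<le> C / norm w"
    and z: "Im z \<noteq> 0"
  shows "((\<lambda>T. integral {-T..T} (\<lambda>t. G (of_real t) / (of_real t - z))) \<longlongrightarrow>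
           (if Im z > 0 then 2 * pi * \<i> * G z else 0)) at_top"
proof -
  define f where "f w = G w / (w - z)" for w
  define V where "V = (if Im z > 0 then 2 * pi * \<i> * G z else 0)"
  \<comment> \<open>Beyond T0 the decay bound holds on the three outer sides, |w - z| is at least
    T/2 there, and a point z of the upper half plane lies inside the rectangle.\<close>
  define T0 where "T0 = max (max 1 R) (2 * norm z + 1)"
  have C: "0 \<le> C"
  proof -
    have "norm (G (of_real (max 1 \<bar>R\<bar>))) \<le> C / norm (of_real (max 1 \<bar>R\<bar>) :: complex)"
      by (rule bd) auto
    then have "0 \<le> C / max 1 \<bar>R\<bar>" by (metis abs_ge_zero abs_of_nonneg max.coboundedI2 norm_ge_zero norm_of_real order_trans)
    moreover have "0 < max 1 \<bar>R\<bar>" by simp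
    ultimately show ?thesis by (metis zero_le_divide_iff not_less)
  qed
  have key: "norm (integral {-T..T} (\<lambda>t. f (of_real t)) - V) \<le> 12 * C / T" if T: "T \<ge> T0" for T
  proof -
    have T1: "T \<ge> 1" "T \<ge> R" "T > 2 * norm z" using T by (auto simp: T0_def)
    define a1 a2 a3 a4 where "a1 = complex_of_real (-T)" "a2 = complex_of_real T" "a3 = Complex T T" "a4 = Complex (-T) T"
    note defs = this
    have rp: "rectpath a1 a3 = linepath a1 a2 +++ linepath a2 a3 +++ linepath a3 a4 +++ linepath a4 a1"
      by (simp add: rectpath_def defs Let_def complex_of_real_def)
    have sub: "path_image (rectpath a1 a3) \<subseteq> {w. - \<eta> < Im w} - {z}"
    proof -
      have "z \<notin> path_image (rectpath a1 a3)"
      proof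
        assume "z \<in> path_image (rectpath a1 a3)"
        then have "Re z = -T \<or> Re z = T \<or> Im z = 0 \<or> Im z = T"
          using T1 by (subst (asm) path_image_rectpath) (auto simp: defs)
        then show False using z T1 abs_Re_le_cmod[of z] abs_Im_le_cmod[of z] by auto
      qed
      moreover have "path_image (rectpath a1 a3) \<subseteq> {w. - \<eta> < Im w}"
        using T1 \<eta> path_image_rectpath_subset_cbox[of a1 a3] by (auto simp: defs in_cbox_complex_iff)
      ultimately show ?thesis by blast
    qed
    have con: "continuous_on ({w. - \<eta> < Im w} - {z}) f"
      unfolding f_def using holo by (intro continuous_intros holomorphic_on_imp_continuous_on) (auto intro: holomorphic_on_subset)
    have segs: "closed_segment a1 a2 \<subseteq> {w. - \<eta> < Im w} - {z}" "closed_segment a2 a3 \<subseteq> {w. - \<eta> < Im w} - {z}"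
        "closed_segment a3 a4 \<subseteq> {w. - \<eta> < Im w} - {z}" "closed_segment a4 a1 \<subseteq> {w. - \<eta> < Im w} - {z}"
      using sub unfolding rp by (auto simp: path_image_join)
    note ci = contour_integrable_continuous_linepath[OF continuous_on_subset[OF con]]
    have tot: "contour_integral (rectpath a1 a3) f = V"
    proof (cases "Im z > 0")
      case True
      have "z \<in> box a1 a3" using True T1 abs_Re_le_cmod[of z] abs_Im_le_cmod[of z]
        by (auto simp: in_box_complex_iff defs)
      then have w: "winding_number (rectpath a1 a3) z = 1" by (rule winding_number_rectpath)
      have "((\<lambda>w. G w / (w - z)) has_contour_integral (2*pi * \<i> * winding_number (rectpath a1 a3) z * G z)) (rectpath a1 a3)"
        using True \<eta> sub by (intro Cauchy_integral_formula_convex_simple[OF convex_halfspace_Im_gt holo])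
           (auto simp: interior_open[OF open_halfspace_Im_gt])
      then show ?thesis unfolding f_def w V_def using True by (auto intro!: contour_integral_unique)
    next
      case False
      then have "Im z < 0" using z by simp
      \<comment> \<open>The half plane is lowered only as far as z allows, so that the pole stays
        outside it.\<close>
      let ?m = "min \<eta> (- Im z)"
      have "f holomorphic_on {w. - ?m < Im w}" unfolding f_def
        by (intro holomorphic_intros holomorphic_on_subset[OF holo]) auto
      then have "(f has_contour_integral 0) (rectpath a1 a3)"
      proof (rule Cauchy_theorem_convex_simple[OF _ convex_halfspace_Im_gt])
        show "path_image (rectpath a1 a3) \<subseteq> {w. - ?m < Im w}"
        proof
          fix w assume "w \<in> path_image (rectpath a1 a3)"
          then have "w \<in> cbox a1 a3" using T1 path_image_rectpath_subset_cbox[of a1 a3] by (auto simp: defs)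
          then have "0 \<le> Im w" by (auto simp: defs in_cbox_complex_iff)
          then show "w \<in> {w. - ?m < Im w}" using \<eta> \<open>Im z < 0\<close> by simp
        qed
      qed auto
      then show ?thesis using False by (simp add: V_def contour_integral_unique)
    qed
    have bound: "norm (f w) \<le> 2 * C / T^2" if "0 \<le> Im w" "T \<le> norm w" for w
    proof -
      have 1: "norm (G w) \<le> C / T"
        using bd[of w] that T1 C by (meson divide_left_mono dual_order.trans less_le_trans mult_pos_pos zero_less_one)
      have "norm w - norm z \<le> norm (w - z)" by (rule norm_triangle_ineq2)
      then have 2: "T / 2 \<le> norm (w - z)" using that T1 by auto
      have "norm (f w) = norm (G w) / norm (w - z)" by (simp add: f_def norm_divide)
      also have "\<dots> \<le> (C / T) / (T / 2)" using 1 2 T1 C by (intro frac_le) auto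
      finally show ?thesis by (simp add: power2_eq_square mult.commute)
    qed
    have side: "norm (contour_integral (linepath p q) f) \<le> 4 * C / T"
      if pq: "closed_segment p q \<subseteq> {w. - \<eta> < Im w} - {z}" "\<And>w. w \<in> closed_segment p q \<Longrightarrow> 0 \<le> Im w \<and> T \<le> norm w"
        "norm (q - p) \<le> 2 * T" for p q
    proof -
      have "norm (contour_integral (linepath p q) f) \<le> 2 * C / T^2 * norm (q - p)"
        using C pq(2) by (intro contour_integral_bound_linepath ci pq bound) auto
      also have "\<dots> \<le> 2 * C / T^2 * (2 * T)" using pq C by (intro mult_left_mono) auto
      finally show ?thesis using T1 by (simp add: power2_eq_square)
    qed
    have ge: "T \<le> norm w" if "\<bar>Re w\<bar> = T \<or> \<bar>Im w\<bar> = T" for w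
      using that abs_Re_le_cmod[of w] abs_Im_le_cmod[of w] by auto
    have s2: "norm (contour_integral (linepath a2 a3) f) \<le> 4 * C / T"
    proof (rule side[OF segs(2)])
      fix w assume w: "w \<in> closed_segment a2 a3"
      have "closed_segment a2 a3 \<subseteq> cbox (Complex T 0) (Complex T T)"
        using T1 by (intro closed_segment_subset convex_box) (auto simp: defs in_cbox_complex_iff)
      then show "0 \<le> Im w \<and> T \<le> norm w" using w T1 by (auto simp: in_cbox_complex_iff intro!: ge)
    next
      have "a3 - a2 = \<i> * of_real T" by (auto simp: defs complex_eq_iff)
      then show "norm (a3 - a2) \<le> 2 * T" using T1 by (simp add: norm_mult)
    qed
    have s3: "norm (contour_integral (linepath a3 a4) f) \<le> 4 * C / T"
    proof (rule side[OF segs(3)])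
      fix w assume w: "w \<in> closed_segment a3 a4"
      have "closed_segment a3 a4 \<subseteq> cbox (Complex (-T) T) (Complex T T)"
        using T1 by (intro closed_segment_subset convex_box) (auto simp: defs in_cbox_complex_iff)
      then show "0 \<le> Im w \<and> T \<le> norm w" using w T1 by (auto simp: in_cbox_complex_iff intro!: ge)
    next
      have "a4 - a3 = of_real (-2*T)" by (auto simp: defs complex_eq_iff)
      then show "norm (a4 - a3) \<le> 2 * T" using T1 by (simp only: norm_of_real)
    qed
    have s4: "norm (contour_integral (linepath a4 a1) f) \<le> 4 * C / T"
    proof (rule side[OF segs(4)])
      fix w assume w: "w \<in> closed_segment a4 a1"
      have "closed_segment a4 a1 \<subseteq> cbox (Complex (-T) 0) (Complex (-T) T)"
        using T1 by (intro closed_segment_subset convex_box) (auto simp: defs in_cbox_complex_iff)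
      then show "0 \<le> Im w \<and> T \<le> norm w" using w T1 by (auto simp: in_cbox_complex_iff intro!: ge)
    next
      have "a1 - a4 = - (\<i> * of_real T)" by (auto simp: defs complex_eq_iff)
      then show "norm (a1 - a4) \<le> 2 * T" using T1 by (simp add: norm_mult)
    qed
    have "contour_integral (linepath a1 a2) f = integral {-T..T} (\<lambda>t. f (of_real t))"
      using T1 by (subst contour_integral_linepath_Reals_eq) (auto simp: defs)
    moreover have "contour_integral (rectpath a1 a3) f = contour_integral (linepath a1 a2) f +
        (contour_integral (linepath a2 a3) f + (contour_integral (linepath a3 a4) f + contour_integral (linepath a4 a1) f))"
      unfolding rp using ci[OF segs(1)] ci[OF segs(2)] ci[OF segs(3)] ci[OF segs(4)] by simp
    ultimately have "integral {-T..T} (\<lambda>t. f (of_real t)) - V =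
       - (contour_integral (linepath a2 a3) f + (contour_integral (linepath a3 a4) f + contour_integral (linepath a4 a1) f))"
      using tot by (simp add: algebra_simps)
    then have "norm (integral {-T..T} (\<lambda>t. f (of_real t)) - V) \<le> 4 * C / T + (4 * C / T + 4 * C / T)"
      using s2 s3 s4 by (smt (verit) norm_minus_cancel norm_triangle_ineq)
    then show ?thesis by simp
  qed
  have "((\<lambda>T. 12 * C / T) \<longlongrightarrow> 0) at_top" by (intro tendsto_divide_0[OF tendsto_const] filterlim_at_top_imp_at_infinity filterlim_ident)
  then have "((\<lambda>T. integral {-T..T} (\<lambda>t. f (of_real t)) - V) \<longlongrightarrow> 0) at_top"
    by (rule Lim_null_comparison[rotated]) (rule eventually_at_top_linorderI[of T0], rule key)
  then show ?thesis unfolding f_def V_def by (rule LIM_zero_cancel)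
qed

text \<open>Subtracting the complex conjugate of the Cauchy integral at \<open>cnj z\<close>, which tends to 0,
leaves only the imaginary part of the boundary values.\<close>

lemma half_plane_poisson_tendsto:
  fixes G :: "complex \<Rightarrow> complex"
  assumes holo: "G holomorphic_on {w. - \<eta> < Im w}" and \<eta>: "\<eta> > 0"
    and bd: "\<And>w. 0 \<le> Im w \<Longrightarrow> R \<le> norm w \<Longrightarrow> norm (G w) \<le> C / norm w"
    and z: "Im z > 0"
  shows "((\<lambda>T. integral {-T..T} (\<lambda>t. of_real (- Im (G (of_real t)) / pi) / (z - of_real t))) \<longlongrightarrow> G z) at_top"
proof -
  let ?f = "\<lambda>t. G (of_real t) / (of_real t - z)" and ?g = "\<lambda>t. G (of_real t) / (of_real t - cnj z)"
  have contG: "continuous_on S (\<lambda>t::real. G (of_real t))" for S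
    using \<eta> by (intro continuous_on_compose2[OF holomorphic_on_imp_continuous_on[OF holo]] continuous_intros) auto
  have nz: "of_real t - z \<noteq> 0" "of_real t - cnj z \<noteq> 0" for t :: real
    using z by (auto simp: complex_eq_iff)
  have aux: "2 * \<i> * m / (of_real t - z) / (2 * pi * \<i>) = (- m / of_real pi) / (z - of_real t)"
    if "of_real t - z \<noteq> 0" for t :: real and z m
  proof -
    have "z - of_real t \<noteq> 0" using that by auto
    then show ?thesis using that by (simp add: divide_simps) (simp add: algebra_simps)
  qed
  have i: "?f integrable_on {-T..T}" "?g integrable_on {-T..T}" for T :: real
    using nz by (auto intro!: integrable_continuous_interval continuous_intros contG)
  have f: "((\<lambda>T. integral {-T..T} ?f) \<longlongrightarrow> 2 * pi * \<i> * G z) at_top"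
    using half_plane_integral_tendsto[OF holo \<eta> bd, where z=z] z by simp
  have g: "((\<lambda>T. integral {-T..T} ?g) \<longlongrightarrow> 0) at_top"
    using half_plane_integral_tendsto[OF holo \<eta> bd, where z="cnj z"] z by simp
  have "((\<lambda>T. (integral {-T..T} ?f - cnj (integral {-T..T} ?g)) / (2 * pi * \<i>)) \<longlongrightarrow> (2 * pi * \<i> * G z - cnj 0) / (2 * pi * \<i>)) at_top"
    by (intro tendsto_intros f tendsto_cnj g) auto
  moreover have "(integral {-T..T} ?f - cnj (integral {-T..T} ?g)) / (2 * pi * \<i>) =
      integral {-T..T} (\<lambda>t. of_real (- Im (G (of_real t)) / pi) / (z - of_real t))" for T :: real
  proof -
    have "cnj (integral {-T..T} ?g) = integral {-T..T} (\<lambda>t. cnj (?g t))"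
      by (rule integral_cnj)
    then have "(integral {-T..T} ?f - cnj (integral {-T..T} ?g)) / (2 * pi * \<i>) =
        integral {-T..T} (\<lambda>t. (?f t - cnj (?g t)) / (2 * pi * \<i>))"
      using i integrable_on_cnj_iff[of ?g] by (simp add: Henstock_Kurzweil_Integration.integral_diff)
    also have "\<dots> = integral {-T..T} (\<lambda>t. of_real (- Im (G (of_real t)) / pi) / (z - of_real t))"
    proof (rule integral_cong)
      fix t :: real
      have "?f t - cnj (?g t) = (G (of_real t) - cnj (G (of_real t))) / (of_real t - z)"
        by (simp add: diff_divide_distrib)
      also have "G (of_real t) - cnj (G (of_real t)) = 2 * \<i> * of_real (Im (G (of_real t)))"
        by (simp add: complex_eq_iff)
      finally show "(?f t - cnj (?g t)) / (2 * pi * \<i>) = of_real (- Im (G (of_real t)) / pi) / (z - of_real t)"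
        using aux[of t z "of_real (Im (G (of_real t)))"] nz(1)[of t] by simp
    qed
    finally show ?thesis .
  qed
  ultimately show ?thesis by simp
qed

text \<open>Turns the limit of truncated integrals into a Lebesgue integral. On the axis G itself
  decays only like 1/|t|, which is not integrable, hence the separate condition \<open>tail\<close>
  on its imaginary part. The behaviour along the imaginary axis in \<open>lim\<close> fixes the
  total mass.\<close>

lemma poisson_representation:
  fixes G :: "complex \<Rightarrow> complex"
  assumes holo: "G holomorphic_on {w. - \<eta> < Im w}" and \<eta>: "\<eta> > 0"
    and bd: "\<And>w. 0 \<le> Im w \<Longrightarrow> R \<le> norm w \<Longrightarrow> norm (G w) \<le> C / norm w"
    and tail: "\<And>t. R \<le> \<bar>t\<bar> \<Longrightarrow> \<bar>Im (G (of_real t))\<bar> \<le> C / t^2"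
    and lim: "((\<lambda>y. \<i> * of_real y * G (\<i> * of_real y)) \<longlongrightarrow> 1) at_top"
    and R: "R \<ge> 1"
  defines "f \<equiv> \<lambda>t. - Im (G (of_real t)) / pi"
  shows "integrable lborel f" "integral\<^sup>L lborel f = 1"
    "\<And>z. Im z > 0 \<Longrightarrow> (\<integral>t. of_real (f t) / (z - of_real t) \<partial>lborel) = G z"
proof -
  have contG: "continuous_on S (\<lambda>t::real. G (of_real t))" for S
    using \<eta> by (intro continuous_on_compose2[OF holomorphic_on_imp_continuous_on[OF holo]] continuous_intros) auto
  have contf: "continuous_on S f" for S unfolding f_def by (intro continuous_intros contG) auto
  have [measurable]: "f \<in> borel_measurable borel" by (rule borel_measurable_continuous_onI[OF contf])
  have C: "0 \<le> C" using tail[of R] R by (smt (verit) divide_less_0_iff zero_less_power)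
  obtain B where B: "\<And>t. t \<in> {-R..R} \<Longrightarrow> \<bar>f t\<bar> \<le> B"
  proof -
    have "compact (f ` {-R..R})" by (intro compact_continuous_image contf) auto
    then obtain B where "\<forall>x\<in>f ` {-R..R}. norm x \<le> B" by (meson bounded_iff compact_imp_bounded)
    then have "\<And>t. t \<in> {-R..R} \<Longrightarrow> \<bar>f t\<bar> \<le> B" by (metis image_eqI real_norm_def)
    then show ?thesis by (rule that)
  qed
  have Bpos: "0 \<le> B" using B[of 0] R by auto
  have "set_integrable lborel (einterval (-\<infinity>) \<infinity>) (\<lambda>x::real. inverse (1 + x^2))"
    by (rule integrable_inverse_1_plus_square)
  \<comment> \<open>The constant handles two ranges: B bounds f on [-R, R], where 1 + t^2 is at most
    1 + R^2, and C/t^2 bounds it outside, where 1 + t^2 is at most 2 t^2.\<close>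
  then have "integrable lborel (\<lambda>t. (B * (1 + R^2) + 2 * C) * (inverse (1 + t^2)))"
    unfolding set_integrable_def by simp
  then show intf: "integrable lborel f"
  proof (rule Bochner_Integration.integrable_bound)
    show "AE t in lborel. norm (f t) \<le> norm ((B * (1 + R^2) + 2 * C) * (inverse (1 + t^2)))"
    proof (rule AE_I2)
      fix t :: real
      have pos: "0 < 1 + t^2" by (simp add: add_pos_nonneg)
      have "\<bar>f t\<bar> * (1 + t^2) \<le> B * (1 + R^2) + 2 * C"
      proof (cases "\<bar>t\<bar> \<le> R")
        case True
        then have "t^2 \<le> R^2" using R by (simp add: abs_le_square_iff[symmetric])
        then have "\<bar>f t\<bar> * (1 + t^2) \<le> B * (1 + R^2)"
          using B[of t] True Bpos pos by (intro mult_mono) (auto simp: abs_le_iff)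
        then show ?thesis using C by simp
      next
        case False
        then have t1: "1 \<le> t^2" using R by (simp add: abs_le_square_iff[of 1, simplified, symmetric])
        have "\<bar>f t\<bar> = \<bar>Im (G (of_real t))\<bar> / pi" by (simp add: f_def)
        also have "\<dots> \<le> \<bar>Im (G (of_real t))\<bar> / 1" using pi_ge_two by (intro divide_left_mono) auto
        also have "\<dots> \<le> C / t^2" using tail[of t] False by simp
        finally have "\<bar>f t\<bar> * t^2 \<le> C" using t1 pos_le_divide_eq[of "t^2" "\<bar>f t\<bar>" C] by linarith
        moreover have "\<bar>f t\<bar> * (1 + t^2) \<le> \<bar>f t\<bar> * (2 * t^2)"
          using t1 by (intro mult_left_mono) auto
        moreover have "0 \<le> B * (1 + R^2)" using Bpos by simp
        ultimately show ?thesis by (simp add: algebra_simps)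
      qed
      then have "\<bar>f t\<bar> \<le> (B * (1 + R^2) + 2 * C) * inverse (1 + t^2)"
        using pos by (simp add: field_simps)
      then show "norm (f t) \<le> norm ((B * (1 + R^2) + 2 * C) * (inverse (1 + t^2)))"
        by (metis abs_ge_self order_trans real_norm_def)
    qed
  qed auto
  show rep: "(\<integral>t. of_real (f t) / (z - of_real t) \<partial>lborel) = G z" if z: "Im z > 0" for z
  proof -
    let ?h = "\<lambda>t. of_real (f t) / (z - of_real t)"
    have nz: "z - of_real t \<noteq> 0" for t :: real using z by (auto simp: complex_eq_iff)
    have [measurable]: "?h \<in> borel_measurable borel"
      by (rule borel_measurable_continuous_onI) (use nz in \<open>auto intro!: continuous_intros contf\<close>)
    have ge: "Im z \<le> norm (z - of_real t)" for t :: real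
      using abs_Im_le_cmod[of "z - of_real t"] by auto
    have inth: "integrable lborel ?h"
    proof (rule Bochner_Integration.integrable_bound)
      show "integrable lborel (\<lambda>t. f t / Im z)" using intf by simp
      show "AE t in lborel. norm (?h t) \<le> norm (f t / Im z)"
        using ge z by (intro AE_I2) (simp add: norm_divide, intro frac_le, auto)
    qed auto
    have "(\<lambda>n. \<integral>t. indicator {-real n..real n} t *\<^sub>R ?h t \<partial>lborel) \<longlonglongrightarrow> (\<integral>t. ?h t \<partial>lborel)"
    proof (rule integral_dominated_convergence[where w="\<lambda>t. norm (?h t)"])
      show "AE x in lborel. (\<lambda>n. indicat_real {- real n..real n} x *\<^sub>R ?h x) \<longlonglongrightarrow> ?h x"
      proof (intro AE_I2 tendsto_eventually)
        fix x :: real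
        obtain N where "\<bar>x\<bar> \<le> real N" using real_arch_simple by blast
        then show "\<forall>\<^sub>F n in sequentially. indicat_real {- real n..real n} x *\<^sub>R ?h x = ?h x"
          by (intro eventually_sequentiallyI[of N]) (auto simp: indicator_def)
      qed
    qed (use inth in \<open>auto simp: indicator_def\<close>)
    moreover have "(\<integral>t. indicator {-real n..real n} t *\<^sub>R ?h t \<partial>lborel) = integral {-real n..real n} ?h" for n
    proof -
      have "set_integrable lborel {-real n..real n} ?h"
        using nz by (intro borel_integrable_atLeastAtMost') (auto intro!: continuous_intros contf)
      from set_borel_integral_eq_integral(2)[OF this] show ?thesis
        unfolding set_lebesgue_integral_def by simp
    qed
    moreover have "(\<lambda>n. integral {-real n..real n} ?h) \<longlonglongrightarrow> G z"
      unfolding f_def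
      by (rule filterlim_compose[OF half_plane_poisson_tendsto[OF holo \<eta> bd z] filterlim_real_sequentially])
    ultimately show ?thesis using LIMSEQ_unique by simp
  qed
  show "integral\<^sup>L lborel f = 1"
  proof -
    have nz: "\<i> * of_real y - of_real t \<noteq> 0" if "y > 0" for y t :: real using that by (auto simp: complex_eq_iff)
    have c0: "(\<integral>t. \<i> * of_real (real (Suc n)) * (of_real (f t) / (\<i> * of_real (real (Suc n)) - of_real t)) \<partial>lborel) = \<i> * of_real (real (Suc n)) * G (\<i> * of_real (real (Suc n)))" for n
      by (subst integral_mult_right_zero, subst rep) auto
    have "(\<lambda>n. \<integral>t. \<i> * of_real (real (Suc n)) * (of_real (f t) / (\<i> * of_real (real (Suc n)) - of_real t)) \<partial>lborel) \<longlonglongrightarrow> (\<integral>t. complex_of_real (f t) \<partial>lborel)"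
    proof (rule integral_dominated_convergence[where w="\<lambda>t. \<bar>f t\<bar>"])
      show "integrable lborel (\<lambda>t. \<bar>f t\<bar>)" using intf by simp
      show "AE t in lborel. (\<lambda>n. \<i> * of_real (real (Suc n)) * (of_real (f t) / (\<i> * of_real (real (Suc n)) - of_real t))) \<longlonglongrightarrow> complex_of_real (f t)"
      proof (rule AE_I2)
        fix t :: real
        have eq: "\<i> * of_real (real (Suc n)) * (of_real (f t) / (\<i> * of_real (real (Suc n)) - of_real t)) =
            of_real (f t) / (1 + \<i> * of_real (t / real (Suc n)))" for n
        proof -
          let ?a = "\<i> * complex_of_real (real (Suc n))"
          have "?a - of_real t = ?a * (1 + \<i> * of_real (t / real (Suc n)))"
            by (simp add: field_simps del: of_nat_Suc)
          moreover have "?a \<noteq> 0" by (simp del: of_nat_Suc)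
          ultimately show ?thesis by (simp del: of_nat_Suc)
        qed
        have "(\<lambda>n. of_real (f t) / (1 + \<i> * of_real (t / real (Suc n)))) \<longlonglongrightarrow> of_real (f t) / (1 + \<i> * of_real 0)"
          by (intro tendsto_intros lim_const_over_n[THEN LIMSEQ_Suc]) auto
        then show "(\<lambda>n. \<i> * of_real (real (Suc n)) * (of_real (f t) / (\<i> * of_real (real (Suc n)) - of_real t))) \<longlonglongrightarrow> complex_of_real (f t)"
          unfolding eq by simp
      qed
      show "AE t in lborel. norm (\<i> * of_real (real (Suc n)) * (of_real (f t) / (\<i> * of_real (real (Suc n)) - of_real t))) \<le> \<bar>f t\<bar>" for n
      proof (rule AE_I2)
        fix t :: real
        have "real (Suc n) \<le> norm (\<i> * of_real (real (Suc n)) - of_real t)"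
          using abs_Im_le_cmod[of "\<i> * of_real (real (Suc n)) - of_real t"] by simp
        then show "norm (\<i> * of_real (real (Suc n)) * (of_real (f t) / (\<i> * of_real (real (Suc n)) - of_real t))) \<le> \<bar>f t\<bar>"
          using nz[of "real (Suc n)" t] unfolding norm_mult norm_divide
          by (simp add: divide_simps mult.commute mult_left_mono del: of_nat_Suc)
      qed
      show "(\<lambda>t. \<i> * of_real (real (Suc n)) * (of_real (f t) / (\<i> * of_real (real (Suc n)) - of_real t))) \<in> borel_measurable lborel" for n
        using borel_measurable_continuous_onI[of "\<lambda>t. \<i> * of_real (real (Suc n)) * (of_real (f t) / (\<i> * of_real (real (Suc n)) - of_real t))"]
          nz[of "real (Suc n)"] by (auto intro!: continuous_intros contf)
    qed auto
    then have c1: "(\<lambda>n. \<i> * of_real (real (Suc n)) * G (\<i> * of_real (real (Suc n)))) \<longlonglongrightarrow> (\<integral>t. complex_of_real (f t) \<partial>lborel)"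
      unfolding c0 .
    moreover have "(\<lambda>n. \<i> * of_real (real (Suc n)) * G (\<i> * of_real (real (Suc n)))) \<longlonglongrightarrow> 1"
      using filterlim_compose[OF lim filterlim_compose[OF filterlim_real_sequentially filterlim_Suc]] .
    ultimately have "(\<integral>t. complex_of_real (f t) \<partial>lborel) = 1" by (rule LIMSEQ_unique)
    then show ?thesis by (metis integral_complex_of_real of_real_eq_1_iff)
  qed
qed

text \<open>The function g may have no boundary values on the real axis. Lifted by i \<eta> it is
  holomorphic across the axis, so the Poisson representation applies, and the sign condition makes
  -Im g(t + i \<eta>)/\<pi> a probability density.\<close>

lemma shifted_cauchy_transform_measure:
  fixes g :: "complex \<Rightarrow> complex"
  assumes holo: "g holomorphic_on {z. 0 < Im z}"
    and neg: "\<And>z. 0 < Im z \<Longrightarrow> Im (g z) \<le> 0"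
    and asy: "\<And>z. 0 < Im z \<Longrightarrow> R \<le> norm z \<Longrightarrow> norm (g z - 1 / z) \<le> C / norm z ^ 2"
    and R: "1 \<le> R" and \<eta>: "0 < \<eta>" "\<eta> \<le> 1"
  obtains M where "real_distribution M"
    "\<And>z. 0 < Im z \<Longrightarrow> (\<integral>x. 1 / (z - of_real x) \<partial>M) = g (z + \<i> * of_real \<eta>)"
proof -
  define G where "G w = g (w + \<i> * of_real \<eta>)" for w
  define f where "f t = - Im (G (of_real t)) / pi" for t :: real
  have holoG: "G holomorphic_on {w. - \<eta> < Im w}"
    unfolding G_def by (intro holomorphic_on_compose_gen[OF _ holo, unfolded o_def] holomorphic_intros) auto
  have C: "0 \<le> C"
  proof -
    have "0 \<le> C / norm (\<i> * of_real R) ^ 2"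
      by (rule order_trans[OF norm_ge_zero asy]) (use R in \<open>auto simp: norm_mult\<close>)
    then show ?thesis using R by (simp add: norm_mult zero_le_divide_iff)
  qed
  have nle: "norm w \<le> norm (w + \<i> * of_real \<eta>)" if "0 \<le> Im w" for w
  proof -
    have "(Im w)^2 \<le> (Im w + \<eta>)^2" using that \<eta> by (intro power_mono) auto
    then show ?thesis by (simp add: cmod_def)
  qed
  have asyG: "norm (G w - 1 / (w + \<i> * of_real \<eta>)) \<le> C / norm w ^ 2" if "0 \<le> Im w" "R \<le> norm w" for w
  proof -
    have n: "norm w \<le> norm (w + \<i> * of_real \<eta>)" using nle that by simp
    have "norm (G w - 1 / (w + \<i> * of_real \<eta>)) \<le> C / norm (w + \<i> * of_real \<eta>) ^ 2"
      unfolding G_def using that n \<eta> by (intro asy) auto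
    also have "\<dots> \<le> C / norm w ^ 2"
      using n that R C by (intro divide_left_mono power_mono mult_pos_pos zero_less_power) auto
    finally show ?thesis .
  qed
  have bd: "norm (G w) \<le> (1 + C) / norm w" if w: "0 \<le> Im w" "R \<le> norm w" for w
  proof -
    have n: "norm w \<le> norm (w + \<i> * of_real \<eta>)" using nle that by simp
    have "norm (G w) \<le> norm (1 / (w + \<i> * of_real \<eta>)) + C / norm w ^ 2"
      using asyG[OF w] norm_triangle_sub[of "G w" "1 / (w + \<i> * of_real \<eta>)"] by linarith
    also have "norm (1 / (w + \<i> * of_real \<eta>)) \<le> 1 / norm w"
      using n w R unfolding norm_divide norm_one by (intro divide_left_mono mult_pos_pos) auto
    also have "C / norm w ^ 2 \<le> C / norm w"
    proof -
      have "norm w * 1 \<le> norm w * norm w" using w R by (intro mult_left_mono) auto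
      moreover have "0 < norm w" using w R by linarith
      ultimately show ?thesis using C by (intro divide_left_mono) (auto simp: power2_eq_square)
    qed
    finally show ?thesis by (simp add: add_divide_distrib)
  qed
  \<comment> \<open>The leading term 1/(t + i \<eta>) has imaginary part -\<eta>/(t^2 + \<eta>^2),
    so it is quadratically small although its modulus is only of order 1/|t|.\<close>
  have tail: "\<bar>Im (G (of_real t))\<bar> \<le> (1 + C) / t^2" if t: "R \<le> \<bar>t\<bar>" for t
  proof -
    have "\<bar>Im (G (of_real t)) - Im (1 / (of_real t + \<i> * of_real \<eta>))\<bar> \<le> C / t^2"
      using asyG[of "of_real t"] t abs_Im_le_cmod[of "G (of_real t) - 1 / (of_real t + \<i> * of_real \<eta>)"] by simp
    moreover have "\<bar>Im (1 / (of_real t + \<i> * of_real \<eta>))\<bar> \<le> 1 / t^2"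
    proof -
      have "\<bar>Im (1 / (of_real t + \<i> * of_real \<eta>))\<bar> = \<eta> / (t^2 + \<eta>^2)"
        using \<eta> by (simp add: Im_divide)
      also have "\<dots> \<le> 1 / t^2" using \<eta> t R by (intro frac_le) (auto simp: zero_less_power2)
      finally show ?thesis .
    qed
    ultimately show ?thesis by (simp add: add_divide_distrib)
  qed
  have lim: "((\<lambda>y. \<i> * of_real y * G (\<i> * of_real y)) \<longlongrightarrow> 1) at_top"
  proof -
    have "((\<lambda>y. \<i> * of_real y * G (\<i> * of_real y) - 1) \<longlongrightarrow> 0) at_top"
    proof (rule Lim_null_comparison)
      show "\<forall>\<^sub>F y in at_top. norm (\<i> * of_real y * G (\<i> * of_real y) - 1) \<le> (1 + C) / y"
      proof (rule eventually_at_top_linorderI[of R])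
        fix y assume y: "R \<le> y"
        then have y0: "0 < y" using R by auto
        have ne: "\<i> * of_real y + \<i> * of_real \<eta> \<noteq> 0" using y0 \<eta> by (auto simp: complex_eq_iff)
        have "\<i> * of_real y * G (\<i> * of_real y) - 1 = \<i> * of_real y * (G (\<i> * of_real y) - 1 / (\<i> * of_real y + \<i> * of_real \<eta>))
           - \<i> * of_real \<eta> / (\<i> * of_real y + \<i> * of_real \<eta>)"
        proof -
          have "\<i> * of_real y / (\<i> * of_real y + \<i> * of_real \<eta>) + \<i> * of_real \<eta> / (\<i> * of_real y + \<i> * of_real \<eta>) = 1"
            by (simp only: add_divide_distrib[symmetric] divide_self_if ne if_False)
          then have "\<i> * of_real \<eta> / (\<i> * of_real y + \<i> * of_real \<eta>) = 1 - \<i> * of_real y / (\<i> * of_real y + \<i> * of_real \<eta>)"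
            by (metis add_diff_cancel_left')
          then show ?thesis by (simp add: right_diff_distrib)
        qed
        also have "norm \<dots> \<le> norm (\<i> * of_real y * (G (\<i> * of_real y) - 1 / (\<i> * of_real y + \<i> * of_real \<eta>))) + norm (\<i> * of_real \<eta> / (\<i> * of_real y + \<i> * of_real \<eta>))"
          by (rule norm_triangle_ineq4)
        also have "norm (\<i> * of_real y * (G (\<i> * of_real y) - 1 / (\<i> * of_real y + \<i> * of_real \<eta>))) \<le> y * (C / y^2)"
        proof -
          have "norm (G (\<i> * of_real y) - 1 / (\<i> * of_real y + \<i> * of_real \<eta>)) \<le> C / y^2"
            using asyG[of "\<i> * of_real y"] y y0 by (simp add: norm_mult)
          then show ?thesis
            using y0 unfolding norm_mult norm_ii norm_of_real by (simp only: mult_1 abs_of_pos mult_left_mono less_imp_le)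
        qed
        also have "y * (C / y^2) = C / y" using y0 by (simp add: power2_eq_square)
        also have "norm (\<i> * of_real \<eta> / (\<i> * of_real y + \<i> * of_real \<eta>)) = \<eta> / (y + \<eta>)"
        proof -
          have "\<i> * of_real \<eta> / (\<i> * of_real y + \<i> * of_real \<eta>) = complex_of_real (\<eta> / (y + \<eta>))"
            using ne by (simp add: distrib_left[symmetric])
          then show ?thesis using y0 \<eta> by (simp only: norm_of_real abs_of_pos divide_pos_pos add_pos_pos)
        qed
        also have "\<eta> / (y + \<eta>) \<le> 1 / y" using y0 \<eta> by (intro frac_le) auto
        finally show "norm (\<i> * of_real y * G (\<i> * of_real y) - 1) \<le> (1 + C) / y" by (simp add: add_divide_distrib)
      qed
      show "((\<lambda>y. (1 + C) / y) \<longlongrightarrow> 0) at_top"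
        by (intro tendsto_divide_0[OF tendsto_const] filterlim_at_top_imp_at_infinity filterlim_ident)
    qed
    then show ?thesis by (rule LIM_zero_cancel)
  qed
  note poisson = poisson_representation[where R=R and C="1 + C", OF holoG \<eta>(1) _ _ lim R, folded f_def]
  have rep: "integrable lborel f" "integral\<^sup>L lborel f = 1"
    "\<And>z. 0 < Im z \<Longrightarrow> (\<integral>t. of_real (f t) / (z - of_real t) \<partial>lborel) = G z"
    using poisson bd tail by blast+
  have f0: "0 \<le> f t" for t unfolding f_def G_def using neg[of "of_real t + \<i> * of_real \<eta>"] \<eta> by (simp add: divide_nonpos_pos)
  have [measurable]: "f \<in> borel_measurable borel" using rep(1) by auto
  define M where "M = density lborel (\<lambda>t. ennreal (f t))"
  have "prob_space M"
  proof (rule prob_spaceI)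
    have "emeasure M (space M) = (\<integral>\<^sup>+t. ennreal (f t) \<partial>lborel)"
      by (simp add: M_def emeasure_density)
    also have "\<dots> = 1" using nn_integral_eq_integral[OF rep(1)] f0 rep(2) by simp
    finally show "emeasure M (space M) = 1" .
  qed
  then have "real_distribution M"
    by (simp add: real_distribution_def real_distribution_axioms_def M_def)
  moreover have "(\<integral>x. 1 / (z - of_real x) \<partial>M) = g (z + \<i> * of_real \<eta>)" if z: "0 < Im z" for z
  proof -
    have "(\<integral>x. 1 / (z - of_real x) \<partial>M) = (\<integral>x. f x *\<^sub>R (1 / (z - of_real x)) \<partial>lborel)"
      unfolding M_def using f0 by (intro integral_density) auto
    also have "\<dots> = (\<integral>x. of_real (f x) / (z - of_real x) \<partial>lborel)"
      by (simp add: scaleR_conv_of_real)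
    also have "\<dots> = G z" by (rule rep(3)[OF z])
    finally show ?thesis by (simp add: G_def)
  qed
  ultimately show ?thesis using that by blast
qed

lemma integrable_cauchy_kernel:
  assumes M: "real_distribution M" and z: "0 < Im z"
  shows "integrable M (\<lambda>x. 1 / (z - of_real x))"
proof -
  interpret real_distribution M by fact
  show ?thesis
  proof (rule integrable_const_bound[where B="1 / Im z"])
    have "Im z \<le> norm (z - of_real x)" for x :: real using abs_Im_le_cmod[of "z - of_real x"] by simp
    then show "AE x in M. norm (1 / (z - of_real x)) \<le> 1 / Im z"
      using z by (intro AE_I2) (simp add: norm_divide, intro frac_le, auto)
  qed simp
qed

text \<open>The measures of the lifted functions are tight, since the asymptotics of g hold
  uniformly in the lift. A weak limit along a subsequence has transform g because the kernel 1/(z -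
  x) is bounded and continuous in x.\<close>

theorem cauchy_transform_measure_exists:
  fixes g :: "complex \<Rightarrow> complex"
  assumes holo: "g holomorphic_on {z. 0 < Im z}"
    and neg: "\<And>z. 0 < Im z \<Longrightarrow> Im (g z) \<le> 0"
    and asy: "\<And>z. 0 < Im z \<Longrightarrow> R \<le> norm z \<Longrightarrow> norm (g z - 1 / z) \<le> C / norm z ^ 2"
    and R: "1 \<le> R"
  obtains M where "real_distribution M" "\<And>z. 0 < Im z \<Longrightarrow> (\<integral>x. 1 / (z - of_real x) \<partial>M) = g z"
proof -
  have "\<forall>n. \<exists>M. real_distribution M \<and> (\<forall>z. 0 < Im z \<longrightarrow> (\<integral>x. 1 / (z - of_real x) \<partial>M) = g (z + \<i> * of_real (1 / real (Suc n))))"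
  proof
    fix n show "\<exists>M. real_distribution M \<and> (\<forall>z. 0 < Im z \<longrightarrow> (\<integral>x. 1 / (z - of_real x) \<partial>M) = g (z + \<i> * of_real (1 / real (Suc n))))"
      by (rule shifted_cauchy_transform_measure[OF holo neg asy R, of "1 / real (Suc n)"]) auto
  qed
  then obtain \<mu> where \<mu>: "\<And>n. real_distribution (\<mu> n)"
    and G: "\<And>n z. 0 < Im z \<Longrightarrow> (\<integral>x. 1 / (z - of_real x) \<partial>\<mu> n) = g (z + \<i> * of_real (1 / real (Suc n)))"
    by metis
  have C: "0 \<le> C"
  proof -
    have "0 \<le> C / norm (\<i> * of_real R) ^ 2"
      by (rule order_trans[OF norm_ge_zero asy]) (use R in \<open>auto simp: norm_mult\<close>)
    then show ?thesis using R by (simp add: norm_mult zero_le_divide_iff)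
  qed
  \<comment> \<open>The real part of i y G(i y) is the integral of y^2/(y^2 + x^2), a kernel that is
    at most 1 inside [-y, y] and at most 1/2 outside. That this integral is close to 1 forces almost
    all mass inside.\<close>
  have tl: "measure (\<mu> n) {-y<..y} \<ge> 1 - 2 * (1 + C) / y" if y: "R \<le> y" for n y
  proof -
    interpret real_distribution "\<mu> n" by (rule \<mu>)
    define \<eta> where "\<eta> = 1 / real (Suc n)"
    have \<eta>: "0 < \<eta>" "\<eta> \<le> 1" by (auto simp: \<eta>_def)
    have y0: "0 < y" using y R by auto
    have ker: "Re (\<i> * of_real y * (1 / (\<i> * of_real y - of_real x))) = y^2 / (y^2 + x^2)" for x :: real
      by (simp add: Re_divide power2_eq_square add.commute)
    have int: "integrable (\<mu> n) (\<lambda>x. \<i> * of_real y * (1 / (\<i> * of_real y - of_real x)))"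
      by (intro integrable_mult_right integrable_cauchy_kernel[OF \<mu>]) (use y0 in simp)
    have "(\<integral>x. y^2 / (y^2 + x^2) \<partial>\<mu> n) = Re (\<i> * of_real y * g (\<i> * of_real y + \<i> * of_real \<eta>))"
    proof -
      have "(\<integral>x. \<i> * of_real y * (1 / (\<i> * of_real y - of_real x)) \<partial>\<mu> n) = \<i> * of_real y * g (\<i> * of_real y + \<i> * of_real \<eta>)"
        by (subst integral_mult_right_zero, subst G) (use y0 in \<open>auto simp: \<eta>_def\<close>)
      then show ?thesis using integral_Re[OF int] unfolding ker by metis
    qed
    also have "\<dots> \<ge> 1 - (1 + C) / y"
    proof -
      let ?w = "\<i> * complex_of_real (y + \<eta>)"
      have w: "norm ?w = y + \<eta>" using y0 \<eta> by (simp add: norm_mult del: of_real_add)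
      have "norm (g ?w - 1 / ?w) \<le> C / norm ?w ^ 2"
        using y0 y \<eta> by (intro asy) (auto simp only: w Im_i_times Re_complex_of_real)
      also have "\<dots> \<le> C / y^2" unfolding w using y0 C \<eta> by (intro divide_left_mono power_mono) (auto intro!: mult_pos_pos zero_less_power add_pos_pos)
      finally have "norm (\<i> * of_real y * (g ?w - 1 / ?w)) \<le> y * (C / y^2)"
        using y0 unfolding norm_mult norm_ii norm_of_real by (simp only: mult_1 abs_of_pos mult_left_mono less_imp_le)
      also have "\<dots> = C / y" using y0 by (simp add: power2_eq_square)
      finally have 1: "\<bar>Re (\<i> * of_real y * (g ?w - 1 / ?w))\<bar> \<le> C / y"
        using abs_Re_le_cmod order_trans by blast
      have "y + \<eta> > 0" using y0 \<eta> by simp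
      then have "\<i> * of_real y * (1 / ?w) = of_real (y / (y + \<eta>))" by (simp del: of_real_add)
      then have 2: "Re (\<i> * of_real y * (1 / ?w)) = y / (y + \<eta>)" by (metis Re_complex_of_real)
      have "y / (y + \<eta>) = 1 - \<eta> / (y + \<eta>)" using \<open>y + \<eta> > 0\<close> by (metis add_diff_cancel_right' diff_divide_distrib divide_self less_irrefl)
      moreover have "\<eta> / (y + \<eta>) \<le> 1 / y" using y0 \<eta> by (intro frac_le) auto
      ultimately have 3: "y / (y + \<eta>) \<ge> 1 - 1 / y" by linarith
      have eq: "\<i> * of_real y * g ?w = \<i> * of_real y * (g ?w - 1 / ?w) + \<i> * of_real y * (1 / ?w)" by (simp add: algebra_simps)
      have "Re (\<i> * of_real y * g ?w) = Re (\<i> * of_real y * (g ?w - 1 / ?w)) + y / (y + \<eta>)"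
        by (subst eq) (simp only: plus_complex.sel 2)
      then have "Re (\<i> * of_real y * g ?w) \<ge> 1 - (1 + C) / y" using 1 3 by (simp add: add_divide_distrib)
      then show ?thesis by (simp add: distrib_left)
    qed
    finally have lower: "1 - (1 + C) / y \<le> (\<integral>x. y^2 / (y^2 + x^2) \<partial>\<mu> n)" .
    have "(\<integral>x. y^2 / (y^2 + x^2) \<partial>\<mu> n) \<le> (\<integral>x. 1/2 + indicat_real {-y<..y} x / 2 \<partial>\<mu> n)"
    proof (rule integral_mono)
      show "integrable (\<mu> n) (\<lambda>x. y^2 / (y^2 + x^2))"
        using integrable_Re[OF int] unfolding ker .
      show "integrable (\<mu> n) (\<lambda>x. 1/2 + indicat_real {-y<..y} x / 2)" by (auto intro!: integrable_real_indicator simp: emeasure_eq_measure)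
      fix x
      have pos: "0 < y^2 + x^2" using y0 by (simp add: add_pos_nonneg)
      show "y^2 / (y^2 + x^2) \<le> 1/2 + indicator {-y<..y} x / 2"
      proof (cases "x \<in> {-y<..y}")
        case True then show ?thesis using pos by (simp add: divide_le_eq)
      next
        case False
        then have "\<bar>y\<bar> \<le> \<bar>x\<bar>" using y0 by auto
        then have "y^2 \<le> x^2" by (simp only: abs_le_square_iff)
        then show ?thesis using pos False by (simp add: divide_le_eq)
      qed
    qed
    also have "\<dots> = 1/2 + measure (\<mu> n) {-y<..y} / 2"
      by (subst Bochner_Integration.integral_add) (auto simp: prob_space[unfolded space_eq_univ] intro!: integrable_real_indicator simp: emeasure_eq_measure)
    finally have "1 - (1 + C) / y \<le> 1/2 + measure (\<mu> n) {-y<..y} / 2" using lower by linarith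
    moreover have "2 * (1 + C) / y = 2 * ((1 + C) / y)" by simp
    ultimately show ?thesis by linarith
  qed
  have "tight \<mu>"
    unfolding tight_def
  proof (intro conjI allI impI \<mu>)
    fix \<epsilon> :: real assume e: "\<epsilon> > 0"
    define y where "y = max R (2 * (1 + C) / \<epsilon> + 1)"
    have y: "R \<le> y" "2 * (1 + C) / \<epsilon> < y" "0 < y" using R by (auto simp: y_def)
    have "2 * (1 + C) / y < \<epsilon>" using y e by (simp add: field_simps)
    then have "measure (\<mu> n) {-y<..y} > 1 - \<epsilon>" for n using tl[OF y(1), of n] by linarith
    then show "\<exists>a b. a < b \<and> (\<forall>n. 1 - \<epsilon> < measure (\<mu> n) {a<..b})" using y(3) by (intro exI[of _ "-y"] exI[of _ y]) auto
  qed
  then obtain r M where r: "strict_mono (r :: nat \<Rightarrow> nat)" and M: "real_distribution M" and conv: "weak_conv_m (\<mu> \<circ> id \<circ> r) M"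
    using tight_imp_convergent_subsubsequence[of \<mu> id] strict_mono_id by (auto simp: id_def)
  have "(\<integral>x. 1 / (z - of_real x) \<partial>M) = g z" if z: "0 < Im z" for z
  proof -
    have ne: "z - of_real x \<noteq> 0" for x :: real using z by (auto simp: complex_eq_iff)
    have ge: "Im z \<le> norm (z - of_real x)" for x :: real using abs_Im_le_cmod[of "z - of_real x"] by simp
    have "(\<lambda>n. \<integral>x. 1 / (z - of_real x) \<partial>(\<mu> \<circ> id \<circ> r) n) \<longlonglongrightarrow> (\<integral>x. 1 / (z - of_real x) \<partial>M)"
    proof (rule weak_conv_imp_integral_bdd_continuous_conv[OF _ M conv, where B="1 / Im z"])
      show "real_distribution ((\<mu> \<circ> id \<circ> r) n)" for n using \<mu> by simp
      show "isCont (\<lambda>x. 1 / (z - complex_of_real x)) x" for x using ne by (intro continuous_intros) auto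
      show "norm (1 / (z - complex_of_real x)) \<le> 1 / Im z" for x
        using ge z by (simp add: norm_divide, intro frac_le, auto)
    qed
    then have 1: "(\<lambda>n. g (z + \<i> * of_real (1 / real (Suc (r n))))) \<longlonglongrightarrow> (\<integral>x. 1 / (z - of_real x) \<partial>M)"
      unfolding o_def id_def G[OF z] .
    have "continuous_on {z. 0 < Im z} g" by (rule holomorphic_on_imp_continuous_on[OF holo])
    then have cont: "isCont g z"
      using z continuous_on_eq_continuous_at[OF open_halfspace_Im_gt[of 0]] by blast
    have "(\<lambda>n. 1 / real (Suc n)) \<longlonglongrightarrow> 0" by (rule LIMSEQ_Suc[OF lim_const_over_n])
    from LIMSEQ_subseq_LIMSEQ[OF this r] have "(\<lambda>n. 1 / real (Suc (r n))) \<longlonglongrightarrow> 0" by (simp only: o_def)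
    then have "(\<lambda>n. z + \<i> * of_real (1 / real (Suc (r n)))) \<longlonglongrightarrow> z + \<i> * of_real 0"
      by (intro tendsto_add tendsto_const tendsto_mult tendsto_of_real)
    then have "(\<lambda>n. z + \<i> * of_real (1 / real (Suc (r n)))) \<longlonglongrightarrow> z" by (simp only: of_real_0 mult_zero_right add_0_right)
    then have "(\<lambda>n. g (z + \<i> * of_real (1 / real (Suc (r n))))) \<longlonglongrightarrow> g z"
      by (rule isCont_tendsto_compose[OF cont])
    then show ?thesis using 1 LIMSEQ_unique by blast
  qed
  then show ?thesis using that M by blast
qed

section \<open>The measure of a slope function\<close>

lemma has_integral_inverse_sub_of_real:
  assumes "0 < Im z" "a \<le> b"
  shows "((\<lambda>w. 1 / (z - of_real w)) has_integral (Ln (z - of_real a) - Ln (z - of_real b))) {a..b}"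
proof -
  have "((\<lambda>w. 1 / (z - of_real w)) has_integral (- Ln (z - of_real b) - (- Ln (z - of_real a)))) {a..b}"
  proof (rule fundamental_theorem_of_calculus[OF \<open>a \<le> b\<close>])
    fix x assume "x \<in> {a..b}"
    have "((\<lambda>w. - Ln (z - w)) has_field_derivative 1 / (z - of_real x)) (at (of_real x))"
      using assms by (auto intro!: derivative_eq_intros simp: complex_nonpos_Reals_iff complex_eq_iff divide_inverse)
    then show "((\<lambda>x. - Ln (z - complex_of_real x)) has_vector_derivative 1 / (z - of_real x)) (at x within {a..b})"
      by (rule has_vector_derivative_real_field)
  qed
  then show ?thesis by simp
qed

text \<open>The class of half-differences of two slopes: the bound and the bounded support make the
  Cauchy integrals below converge absolutely away from the support.\<close>

definition bounded_slope :: "(real \<Rightarrow> real) \<Rightarrow> bool" where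
  "bounded_slope r \<longleftrightarrow> r \<in> borel_measurable borel \<and> (\<forall>w. \<bar>r w\<bar> \<le> 1) \<and> (\<exists>m. \<forall>w. m \<le> \<bar>w\<bar> \<longrightarrow> r w = 0)"

definition cauchy_int :: "(real \<Rightarrow> real) \<Rightarrow> complex \<Rightarrow> complex" where
  "cauchy_int r z = (\<integral>w. of_real (r w) / (z - of_real w) \<partial>lborel)"

lemma bounded_slope_integrable:
  assumes "bounded_slope r"
  shows "integrable lborel r"
proof -
  obtain m where r: "r \<in> borel_measurable borel" "\<And>w. \<bar>r w\<bar> \<le> 1" "\<And>w. m \<le> \<bar>w\<bar> \<Longrightarrow> r w = 0"
    using assms by (auto simp: bounded_slope_def)
  have "integrable lborel (indicat_real {-m..m})" by (simp add: integrable_indicator_iff emeasure_lborel_Icc_eq)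
  then show ?thesis
  proof (rule Bochner_Integration.integrable_bound)
    show "AE x in lborel. norm (r x) \<le> norm (indicat_real {- m..m} x)"
    proof (rule AE_I2)
      fix x show "norm (r x) \<le> norm (indicat_real {- m..m} x)"
        using r(2)[of x] r(3)[of x] by (cases "m \<le> \<bar>x\<bar>") (auto simp: indicator_def)
    qed
  qed (use r in simp)
qed

text \<open>The distance is required only where \<open>r\<close> is nonzero, so that z may also be a
  real point off the support. The boundary values are evaluated at such points.\<close>

lemma cauchy_int_integrable:
  fixes z :: complex
  assumes r: "bounded_slope r" and d: "0 < \<delta>" "\<And>w. r w \<noteq> 0 \<Longrightarrow> \<delta> \<le> norm (z - of_real w)"
  shows "integrable lborel (\<lambda>w. of_real (r w) / (z - of_real w))"
proof (rule Bochner_Integration.integrable_bound)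
  show "integrable lborel (\<lambda>w. r w / \<delta>)" using bounded_slope_integrable[OF r] by simp
  show "AE w in lborel. norm (complex_of_real (r w) / (z - of_real w)) \<le> norm (r w / \<delta>)"
  proof (rule AE_I2)
    fix w show "norm (complex_of_real (r w) / (z - of_real w)) \<le> norm (r w / \<delta>)"
      using d by (cases "r w = 0") (auto simp: norm_divide intro!: frac_le)
  qed
  show "(\<lambda>w. complex_of_real (r w) / (z - of_real w)) \<in> borel_measurable lborel"
    using r by (auto simp: bounded_slope_def)
qed

lemma norm_sub_of_real_ge_Im: "\<bar>Im z\<bar> \<le> norm (z - of_real w)"
  using abs_Im_le_cmod[of "z - of_real w"] by simp

lemmas cauchy_int_integrable_Im = cauchy_int_integrable[OF _ _ norm_sub_of_real_ge_Im]

lemma cauchy_int_bound: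
  assumes r: "bounded_slope r" and d: "0 < \<delta>" "\<And>w. r w \<noteq> 0 \<Longrightarrow> \<delta> \<le> norm (z - of_real w)"
  shows "norm (cauchy_int r z) \<le> (\<integral>w. \<bar>r w\<bar> \<partial>lborel) / \<delta>"
proof -
  have "norm (cauchy_int r z) \<le> (\<integral>w. norm (of_real (r w) / (z - of_real w)) \<partial>lborel)"
    unfolding cauchy_int_def by (rule integral_norm_bound)
  also have "\<dots> \<le> (\<integral>w. \<bar>r w\<bar> / \<delta> \<partial>lborel)"
  proof (rule integral_mono)
    show "integrable lborel (\<lambda>w. norm (of_real (r w) / (z - of_real w)))"
      using cauchy_int_integrable[OF r d] by (rule integrable_norm)
    show "integrable lborel (\<lambda>w. \<bar>r w\<bar> / \<delta>)" using bounded_slope_integrable[OF r] by simp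
    fix w show "norm (of_real (r w) / (z - of_real w)) \<le> \<bar>r w\<bar> / \<delta>"
      using d by (cases "r w = 0") (auto simp: norm_divide intro!: frac_le)
  qed
  finally show ?thesis by simp
qed

text \<open>Applied to \<open>Complex t \<eta>\<close> and \<open>of_real t\<close>, this says that
  the boundary value is approached at a rate linear in \<eta>.\<close>

lemma cauchy_int_lipschitz:
  assumes r: "bounded_slope r" and d: "0 < \<delta>" "\<And>w. r w \<noteq> 0 \<Longrightarrow> \<delta> \<le> norm (z - of_real w)"
    "\<And>w. r w \<noteq> 0 \<Longrightarrow> \<delta> \<le> norm (z' - of_real w)"
  shows "norm (cauchy_int r z - cauchy_int r z') \<le> norm (z - z') * ((\<integral>w. \<bar>r w\<bar> \<partial>lborel) / \<delta>^2)"
proof -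
  note i = cauchy_int_integrable[OF r d(1,2)] cauchy_int_integrable[OF r d(1,3)]
  have "cauchy_int r z - cauchy_int r z' = (\<integral>w. of_real (r w) / (z - of_real w) - of_real (r w) / (z' - of_real w) \<partial>lborel)"
    unfolding cauchy_int_def using i by simp
  also have "norm \<dots> \<le> (\<integral>w. norm (of_real (r w) / (z - of_real w) - of_real (r w) / (z' - of_real w)) \<partial>lborel)"
    by (rule integral_norm_bound)
  also have "\<dots> \<le> (\<integral>w. \<bar>r w\<bar> * (norm (z - z') / \<delta>^2) \<partial>lborel)"
  proof (rule integral_mono)
    show "integrable lborel (\<lambda>w. norm (of_real (r w) / (z - of_real w) - of_real (r w) / (z' - of_real w)))"
      using i by (intro integrable_norm Bochner_Integration.integrable_diff)
    show "integrable lborel (\<lambda>w. \<bar>r w\<bar> * (norm (z - z') / \<delta>^2))" using bounded_slope_integrable[OF r] by simp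
    fix w show "norm (of_real (r w) / (z - of_real w) - of_real (r w) / (z' - of_real w)) \<le> \<bar>r w\<bar> * (norm (z - z') / \<delta>^2)"
    proof (cases "r w = 0")
      case False
      have n: "\<delta> \<le> norm (z - of_real w)" "\<delta> \<le> norm (z' - of_real w)" using d False by auto
      then have "z - of_real w \<noteq> 0" "z' - of_real w \<noteq> 0" using d(1) by auto
      then have "of_real (r w) / (z - of_real w) - of_real (r w) / (z' - of_real w) =
          of_real (r w) * ((z' - z) / ((z - of_real w) * (z' - of_real w)))"
        by (simp add: divide_simps) (simp add: algebra_simps)
      also have "norm \<dots> = \<bar>r w\<bar> * (norm (z - z') / (norm (z - of_real w) * norm (z' - of_real w)))"
        by (simp add: norm_mult norm_divide norm_minus_commute)
      also have "\<dots> \<le> \<bar>r w\<bar> * (norm (z - z') / \<delta>^2)"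
        using n d(1) by (intro mult_left_mono frac_le) (auto simp: power2_eq_square intro!: mult_mono)
      finally show ?thesis .
    qed simp
  qed
  finally show ?thesis by (simp add: mult.commute)
qed

lemma difference_quotient_inverse:
  fixes a b c :: complex
  assumes "a \<noteq> 0" "b \<noteq> 0" "a - b \<noteq> 0"
  shows "(c / a - c / b) / (a - b) - (- c / b^2) = c * ((a - b) / (a * b^2))"
proof -
  have "c / a - c / b = (- c / (a * b)) * (a - b)"
    using assms by (simp add: divide_simps) (simp add: algebra_simps)
  then have "(c / a - c / b) / (a - b) = - c / (a * b)" using assms(3) by simp
  moreover have "- c / (a * b) - (- c / b^2) = c * ((a - b) / (a * b^2))"
    using assms(1,2) by (simp add: divide_simps power2_eq_square) (simp add: algebra_simps)
  ultimately show ?thesis by simp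
qed

text \<open>Differentiation under the integral. For |h| < Im z / 2 both kernels stay bounded, with
  distances at least Im z / 2 and Im z, and the error of the difference quotient is at most |h|
  times an integrable function. This is where the constant 2 / (Im z)^3 comes from.\<close>

lemma cauchy_int_holomorphic:
  assumes r: "bounded_slope r"
  shows "cauchy_int r holomorphic_on {z. 0 < Im z}"
proof (rule holomorphic_onI)
  fix z :: complex assume "z \<in> {z. 0 < Im z}"
  then have z: "0 < Im z" by simp
  let ?D = "\<integral>w. - of_real (r w) / (z - of_real w)^2 \<partial>lborel"
  define K where "K = (\<integral>w. \<bar>r w\<bar> \<partial>lborel) * (2 / (Im z)^3)"
  have intD: "integrable lborel (\<lambda>w. - of_real (r w) / (z - of_real w)^2)"
  proof (rule Bochner_Integration.integrable_bound)
    show "integrable lborel (\<lambda>w. r w / (Im z)^2)" using bounded_slope_integrable[OF r] by simp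
    show "AE w in lborel. norm (- complex_of_real (r w) / (z - of_real w)^2) \<le> norm (r w / (Im z)^2)"
    proof (rule AE_I2)
      fix w
      have "(Im z)^2 \<le> norm (z - of_real w)^2" using norm_sub_of_real_ge_Im[of z w] z by (intro power_mono) auto
      then show "norm (- complex_of_real (r w) / (z - of_real w)^2) \<le> norm (r w / (Im z)^2)"
        using z by (auto simp: norm_divide norm_power intro!: frac_le)
    qed
    show "(\<lambda>w. - complex_of_real (r w) / (z - of_real w)^2) \<in> borel_measurable lborel"
      using r by (auto simp: bounded_slope_def)
  qed
  have key: "norm ((cauchy_int r (z + h) - cauchy_int r z) / h - ?D) \<le> norm h * K" if h: "h \<noteq> 0" "norm h < Im z / 2" for h
  proof -
    have Imh: "Im z / 2 \<le> Im (z + h)" using h abs_Im_le_cmod[of h] by (simp add: abs_le_iff)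
    then have Imh0: "0 < Im (z + h)" using z by linarith
    have i: "integrable lborel (\<lambda>w. of_real (r w) / (z + h - of_real w))" "integrable lborel (\<lambda>w. of_real (r w) / (z - of_real w))"
      using cauchy_int_integrable_Im[OF r, of "z + h"] cauchy_int_integrable_Im[OF r, of z] Imh0 z by auto
    define q where "q w = (of_real (r w) / (z + h - of_real w) - of_real (r w) / (z - of_real w)) / h - (- of_real (r w) / (z - of_real w)^2)" for w
    have i1: "integrable lborel (\<lambda>w. (of_real (r w) / (z + h - of_real w) - of_real (r w) / (z - of_real w)) / h)"
      by (intro integrable_divide_zero Bochner_Integration.integrable_diff i)
    have iq: "integrable lborel q"
      unfolding q_def by (intro Bochner_Integration.integrable_diff i1 intD)
    have eq: "(cauchy_int r (z + h) - cauchy_int r z) / h - ?D = (\<integral>w. q w \<partial>lborel)"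
      unfolding cauchy_int_def q_def
      by (simp only: Bochner_Integration.integral_diff[OF i1 intD] integral_divide_zero Bochner_Integration.integral_diff[OF i])
    have bd: "norm (q w) \<le> \<bar>r w\<bar> * (norm h * (2 / (Im z)^3))" for w
    proof -
      define a b where "a = z + h - of_real w" and "b = z - of_real w"
      have n: "Im z / 2 \<le> norm a" "Im z \<le> norm b"
        using norm_sub_of_real_ge_Im[of "z+h" w] norm_sub_of_real_ge_Im[of z w] Imh Imh0 z unfolding a_def b_def by linarith+
      then have ne: "a \<noteq> 0" "b \<noteq> 0" using z by auto
      have ab: "a - b = h" by (simp add: a_def b_def)
      have "q w = (of_real (r w) / a - of_real (r w) / b) / h - (- of_real (r w) / b^2)"
        by (simp add: q_def a_def b_def)
      also have "\<dots> = of_real (r w) * (h / (a * b^2))"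
        using difference_quotient_inverse[OF ne, of "of_real (r w)"] h(1) unfolding ab by blast
      finally have "norm (q w) = \<bar>r w\<bar> * (norm h / (norm a * norm b^2))" by (simp add: norm_mult norm_divide norm_power)
      also have "\<dots> \<le> \<bar>r w\<bar> * (norm h / (Im z / 2 * (Im z)^2))"
        using n z by (intro mult_left_mono frac_le mult_mono power_mono) auto
      also have "\<dots> = \<bar>r w\<bar> * (norm h * (2 / (Im z)^3))" by (simp add: power3_eq_cube power2_eq_square)
      finally show ?thesis .
    qed
    have "norm (\<integral>w. q w \<partial>lborel) \<le> (\<integral>w. norm (q w) \<partial>lborel)" by (rule integral_norm_bound)
    also have "\<dots> \<le> (\<integral>w. \<bar>r w\<bar> * (norm h * (2 / (Im z)^3)) \<partial>lborel)"
      using iq bounded_slope_integrable[OF r] bd by (intro integral_mono) auto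
    also have "\<dots> = norm h * K" by (simp add: K_def)
    finally show ?thesis unfolding eq .
  qed
  have "((\<lambda>h. (cauchy_int r (z + h) - cauchy_int r z) / h - ?D) \<longlongrightarrow> 0) (at 0)"
  proof (rule Lim_null_comparison)
    show "\<forall>\<^sub>F h in at 0. norm ((cauchy_int r (z + h) - cauchy_int r z) / h - ?D) \<le> norm h * K"
      unfolding eventually_at using z key by (intro exI[of _ "Im z / 2"]) auto
    show "((\<lambda>h. norm h * K) \<longlongrightarrow> 0) (at (0::complex))" by (auto intro!: tendsto_eq_intros)
  qed
  then have "(cauchy_int r has_field_derivative ?D) (at z)"
    unfolding DERIV_def by (rule LIM_zero_cancel)
  then show "cauchy_int r field_differentiable at z within {z. 0 < Im z}"
    using field_differentiable_at_within field_differentiable_def by blast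
qed

lemma bounded_slope_indicator: "bounded_slope (indicator {a..b})"
  unfolding bounded_slope_def
  by (auto simp: indicator_def intro!: exI[of _ "max \<bar>a\<bar> \<bar>b\<bar> + 1"])

lemma bounded_slope_uminus: "bounded_slope r \<Longrightarrow> bounded_slope (\<lambda>w. - r w)"
  by (auto simp: bounded_slope_def)

lemma cauchy_int_indicator:
  assumes z: "0 < Im z" and ab: "a \<le> b"
  shows "cauchy_int (indicator {a..b}) z = Ln (z - of_real a) - Ln (z - of_real b)"
proof -
  have ne: "z - of_real w \<noteq> 0" for w :: real using z by (auto simp: complex_eq_iff)
  have "set_integrable lborel {a..b} (\<lambda>w. 1 / (z - complex_of_real w))"
    using ne by (intro borel_integrable_atLeastAtMost') (auto intro!: continuous_intros)
  from set_borel_integral_eq_integral(2)[OF this]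
  have "(\<integral>w. indicator {a..b} w *\<^sub>R (1 / (z - complex_of_real w)) \<partial>lborel) = Ln (z - of_real a) - Ln (z - of_real b)"
    using has_integral_inverse_sub_of_real[OF z ab] unfolding set_lebesgue_integral_def
    by (simp add: integral_unique)
  then show ?thesis unfolding cauchy_int_def by (simp add: scaleR_conv_of_real)
qed

lemma Im_cauchy_int:
  assumes r: "bounded_slope r" and z: "0 < Im z"
  shows "Im (cauchy_int r z) = (\<integral>w. r w * Im (1 / (z - of_real w)) \<partial>lborel)"
    and "integrable lborel (\<lambda>w. r w * Im (1 / (z - of_real w)))"
proof -
  have eq: "Im (of_real (r w) / (z - of_real w)) = r w * Im (1 / (z - of_real w))" for w
    by (simp add: Im_divide)
  have i: "integrable lborel (\<lambda>w. of_real (r w) / (z - of_real w))"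
    using cauchy_int_integrable_Im[OF r] z by simp
  show "Im (cauchy_int r z) = (\<integral>w. r w * Im (1 / (z - of_real w)) \<partial>lborel)"
    using integral_Im[OF i] unfolding cauchy_int_def eq by simp
  show "integrable lborel (\<lambda>w. r w * Im (1 / (z - of_real w)))"
    using integrable_Im[OF i] unfolding eq .
qed

text \<open>In the upper half plane 1/(z - w) has nonpositive imaginary part for every real
  w.\<close>

lemma Im_cauchy_int_antimono:
  assumes r: "bounded_slope r1" "bounded_slope r2" and z: "0 < Im z" and le: "\<And>w. r1 w \<le> r2 w"
  shows "Im (cauchy_int r2 z) \<le> Im (cauchy_int r1 z)"
  unfolding Im_cauchy_int(1)[OF r(1) z] Im_cauchy_int(1)[OF r(2) z]
proof (rule integral_mono[OF Im_cauchy_int(2)[OF r(2) z] Im_cauchy_int(2)[OF r(1) z]])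
  fix w
  have "Im (1 / (z - of_real w)) \<le> 0" using z by (simp add: Im_divide divide_nonpos_nonneg)
  then show "r2 w * Im (1 / (z - of_real w)) \<le> r1 w * Im (1 / (z - of_real w))"
    using le by (intro mult_right_mono_neg)
qed

text \<open>An admissible \<open>s\<close> plays the role of the derivative of a diagram;
its integral is not required to be centred at the origin.\<close>

definition admissible :: "(real \<Rightarrow> real) \<Rightarrow> bool" where
  "admissible s \<longleftrightarrow> s \<in> borel_measurable borel \<and> (\<forall>w. \<bar>s w\<bar> \<le> 1) \<and> (\<exists>m. \<forall>w. m \<le> \<bar>w\<bar> \<longrightarrow> s w = sgn w)"

definition slope_transform :: "(real \<Rightarrow> real) \<Rightarrow> complex \<Rightarrow> complex" where
  "slope_transform s z = 1 / z * exp (- cauchy_int (\<lambda>w. (s w - sgn w) / 2) z)"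

lemma borel_measurable_sgn_real [measurable]: "(sgn :: real \<Rightarrow> real) \<in> borel_measurable borel"
proof -
  have "(sgn :: real \<Rightarrow> real) = (\<lambda>x. if 0 < x then 1 else if x < 0 then -1 else 0)"
    by (auto simp: sgn_real_def)
  moreover have "\<dots> \<in> borel_measurable borel" by measurable
  ultimately show ?thesis by simp
qed

lemma admissible_obtain:
  assumes "admissible s"
  obtains m where "0 < m" "\<And>w. m \<le> \<bar>w\<bar> \<Longrightarrow> s w = sgn w"
proof -
  obtain m where "\<forall>w. m \<le> \<bar>w\<bar> \<longrightarrow> s w = sgn w" using assms by (auto simp: admissible_def)
  then show ?thesis by (intro that[of "max m 1"]) auto
qed

lemma bounded_slope_half_diff:
  assumes "admissible s" "admissible s'"
  shows "bounded_slope (\<lambda>w. (s w - s' w) / 2)"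
proof -
  obtain m m' where m: "\<And>w. m \<le> \<bar>w\<bar> \<Longrightarrow> s w = sgn w" "\<And>w. m' \<le> \<bar>w\<bar> \<Longrightarrow> s' w = sgn w"
    using admissible_obtain[OF assms(1)] admissible_obtain[OF assms(2)] by metis
  have [measurable]: "s \<in> borel_measurable borel" "s' \<in> borel_measurable borel"
    using assms by (auto simp: admissible_def)
  have "\<bar>s w\<bar> \<le> 1" "\<bar>s' w\<bar> \<le> 1" for w using assms by (auto simp: admissible_def)
  then have "\<bar>(s w - s' w) / 2\<bar> \<le> 1" for w by (simp add: abs_le_iff algebra_simps) (smt (verit))
  then show ?thesis unfolding bounded_slope_def using m
    by (auto intro!: exI[of _ "max m m'"])
qed

lemma admissible_sgn: "admissible sgn"
  by (auto simp: admissible_def sgn_real_def)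

lemmas bounded_slope_sgn = bounded_slope_half_diff[OF _ admissible_sgn]

text \<open>The function (s - sgn)/2 lies between minus the indicator of [0, m] and the indicator of
  [-m, 0], whose Cauchy integrals are differences of logarithms. So the imaginary part of Ln z plus
  the Cauchy integral lies between the arguments of z + m and z - m, hence in [0, \<pi>], and the
  transform is the exponential of minus that sum.\<close>

lemma Im_slope_transform_nonpos:
  assumes s: "admissible s" and z: "0 < Im z"
  shows "Im (slope_transform s z) \<le> 0"
proof -
  define r where "r w = (s w - sgn w) / 2" for w
  obtain m where m: "0 < m" "\<And>w. m \<le> \<bar>w\<bar> \<Longrightarrow> s w = sgn w" using admissible_obtain[OF s] by blast
  have s1: "\<bar>s w\<bar> \<le> 1" for w using s by (auto simp: admissible_def)
  have r: "bounded_slope r" unfolding r_def by (rule bounded_slope_sgn[OF s])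
  have z0: "z \<noteq> 0" using z by auto
  have le1: "r w \<le> indicator {-m..0} w" for w
    using s1[of w] m(2)[of w] by (cases "m \<le> \<bar>w\<bar>") (auto simp: r_def indicator_def sgn_real_def split: if_splits)
  have le2: "- indicator {0..m} w \<le> r w" for w
    using s1[of w] m(2)[of w] by (cases "m \<le> \<bar>w\<bar>") (auto simp: r_def indicator_def sgn_real_def split: if_splits)
  have 1: "Im (Ln (z + of_real m)) - Im (Ln z) \<le> Im (cauchy_int r z)"
    using Im_cauchy_int_antimono[OF r bounded_slope_indicator z le1] cauchy_int_indicator[OF z, of "-m" 0] m by simp
  have "cauchy_int (\<lambda>w. - indicator {0..m} w) z = - cauchy_int (indicator {0..m}) z"
    by (simp add: cauchy_int_def)
  then have 2: "Im (cauchy_int r z) \<le> Im (Ln (z - of_real m)) - Im (Ln z)"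
    using Im_cauchy_int_antimono[OF bounded_slope_uminus[OF bounded_slope_indicator] r z le2] cauchy_int_indicator[OF z, of 0 m] m by simp
  have "0 < Im (Ln (z + of_real m))" using z Im_Ln_pos_lt_imp[of "z + of_real m"] by simp
  moreover have "Im (Ln (z - of_real m)) \<le> pi" using z by (intro Im_Ln_le_pi) (auto simp: complex_eq_iff)
  ultimately have "0 \<le> Im (Ln z + cauchy_int r z)" "Im (Ln z + cauchy_int r z) \<le> pi" using 1 2 by auto
  then have s0: "0 \<le> sin (Im (Ln z + cauchy_int r z))" by (rule sin_ge_zero)
  have "slope_transform s z = exp (- (Ln z + cauchy_int r z))"
  proof -
    have "exp (- (Ln z + cauchy_int r z)) = exp (- Ln z) * exp (- cauchy_int r z)"
      by (simp only: minus_add_distrib exp_add)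
    also have "exp (- Ln z) = 1 / z" by (simp only: exp_minus exp_Ln[OF z0] inverse_eq_divide)
    finally show ?thesis unfolding slope_transform_def r_def[abs_def] ..
  qed
  then have "Im (slope_transform s z) = - (exp (- Re (Ln z + cauchy_int r z)) * sin (Im (Ln z + cauchy_int r z)))"
    by (simp only: Im_exp uminus_complex.sel sin_minus mult_minus_right)
  then show ?thesis using s0 by simp
qed

lemma norm_exp_minus_one_le:
  fixes z :: complex
  assumes "norm z \<le> 1 / 2"
  shows "norm (exp z - 1) \<le> 2 * norm z"
  using norm_exp_bounds(2)[OF assms] norm_ge_zero[of z] by linarith

lemma slope_transform_asymptotic:
  assumes s: "admissible s"
  obtains R C where "1 \<le> R" "\<And>z. R \<le> norm z \<Longrightarrow> norm (slope_transform s z - 1 / z) \<le> C / norm z ^ 2"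
proof -
  define r where "r w = (s w - sgn w) / 2" for w
  obtain m where m: "0 < m" "\<And>w. m \<le> \<bar>w\<bar> \<Longrightarrow> s w = sgn w" using admissible_obtain[OF s] by blast
  have r: "bounded_slope r" unfolding r_def by (rule bounded_slope_sgn[OF s])
  define A where "A = (\<integral>w. \<bar>r w\<bar> \<partial>lborel)"
  have A: "0 \<le> A" by (simp add: A_def)
  \<comment> \<open>The bound 2 m keeps the support at distance at least |z|/2 from z; the bound 4 A
    makes the exponent at most 1/2, the range of \<open>norm_exp_minus_one_le\<close>.\<close>
  define R where "R = max (max 1 (2 * m)) (4 * A)"
  have R: "1 \<le> R" "2 * m \<le> R" "4 * A \<le> R" by (auto simp: R_def)
  have "norm (slope_transform s z - 1 / z) \<le> 4 * A / norm z ^ 2" if z: "R \<le> norm z" for z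
  proof -
    have nz: "0 < norm z" using z R by linarith
    have "norm (cauchy_int r z) \<le> A / (norm z / 2)"
      unfolding A_def
    proof (rule cauchy_int_bound[OF r])
      show "0 < norm z / 2" using nz by simp
      fix w assume "r w \<noteq> 0"
      then have "\<bar>w\<bar> < m" using m(2)[of w] by (force simp: r_def)
      moreover have "norm z - \<bar>w\<bar> \<le> norm (z - of_real w)" using norm_triangle_ineq2[of z "of_real w"] by simp
      ultimately show "norm z / 2 \<le> norm (z - of_real w)" using z R by linarith
    qed
    then have 1: "norm (- cauchy_int r z) \<le> 2 * A / norm z" by (simp add: mult.commute)
    also have "\<dots> \<le> 1 / 2" using z R nz by (simp add: divide_le_eq)
    finally have "norm (exp (- cauchy_int r z) - 1) \<le> 2 * norm (- cauchy_int r z)" by (rule norm_exp_minus_one_le)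
    also have "\<dots> \<le> 2 * (2 * A / norm z)" using 1 by (intro mult_left_mono) auto
    finally have 2: "norm (exp (- cauchy_int r z) - 1) \<le> 4 * A / norm z" by simp
    have "slope_transform s z - 1 / z = 1 / z * (exp (- cauchy_int r z) - 1)"
      by (simp add: slope_transform_def r_def[abs_def] right_diff_distrib diff_divide_distrib)
    then have "norm (slope_transform s z - 1 / z) = 1 / norm z * norm (exp (- cauchy_int r z) - 1)"
      by (simp only: norm_mult norm_divide norm_one)
    also have "\<dots> \<le> 1 / norm z * (4 * A / norm z)" using 2 by (intro mult_left_mono) auto
    finally show ?thesis by (simp add: power2_eq_square)
  qed
  then show ?thesis using that R by blast
qed

text \<open>Provides measures for the extremal diagram and for the hybrid, since transition measures
  are given only for \<open>\<Omega>\<close> and \<open>\<omega>\<close>.\<close>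

theorem slope_measure_exists:
  assumes s: "admissible s"
  obtains M where "real_distribution M" "\<And>z. 0 < Im z \<Longrightarrow> (\<integral>x. 1 / (z - of_real x) \<partial>M) = slope_transform s z"
proof -
  obtain R C where "1 \<le> R" "\<And>z. R \<le> norm z \<Longrightarrow> norm (slope_transform s z - 1 / z) \<le> C / norm z ^ 2"
    using slope_transform_asymptotic[OF s] by blast
  moreover have "slope_transform s holomorphic_on {z. 0 < Im z}"
    unfolding slope_transform_def[abs_def]
    by (intro holomorphic_intros cauchy_int_holomorphic bounded_slope_sgn s) auto
  ultimately show ?thesis
    using cauchy_transform_measure_exists[of "slope_transform s" R C] Im_slope_transform_nonpos[OF s] that by blast
qed

section \<open>Translation of slopes\<close>

lemma admissible_shift:
  assumes "admissible s"
  shows "admissible (\<lambda>w. s (w - c))"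
proof -
  obtain m where m: "0 < m" "\<And>w. m \<le> \<bar>w\<bar> \<Longrightarrow> s w = sgn w" using admissible_obtain[OF assms] by blast
  have [measurable]: "s \<in> borel_measurable borel" using assms by (auto simp: admissible_def)
  have "s (w - c) = sgn w" if "m + 2 * \<bar>c\<bar> \<le> \<bar>w\<bar>" for w
    using that m(1) m(2)[of "w - c"] by (auto simp: sgn_real_def abs_if split: if_splits)
  moreover have "(\<lambda>w. s (w - c)) \<in> borel_measurable borel" by measurable
  ultimately show ?thesis using assms unfolding admissible_def by blast
qed

text \<open>Shifting s leaves sgn in place, and half of sgn(w - c) - sgn w is minus the indicator of
  [0, c] apart from the two end points. The Cauchy integral of that indicator is Ln z - Ln (z - c),
  which replaces the factor 1/z by 1/(z - c).\<close>

lemma slope_transform_shift: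
  assumes s: "admissible s" and z: "0 < Im z" and c: "0 \<le> c"
  shows "slope_transform (\<lambda>w. s (w - c)) z = slope_transform s (z - of_real c)"
proof -
  have [measurable]: "s \<in> borel_measurable borel" using s by (auto simp: admissible_def)
  define r where "r w = (s w - sgn w) / 2" for w
  have r: "bounded_slope r" unfolding r_def by (rule bounded_slope_sgn[OF s])
  have r': "bounded_slope (\<lambda>w. r (w - c))"
    unfolding r_def by (rule bounded_slope_half_diff[OF admissible_shift[OF s] admissible_shift[OF admissible_sgn]])
  have i1: "integrable lborel (\<lambda>w. of_real (r (w - c)) / (z - of_real w))"
    using cauchy_int_integrable_Im[OF r'] z by simp
  have i2: "integrable lborel (\<lambda>w. of_real (indicator {0..c} w) / (z - of_real w))"
    using cauchy_int_integrable_Im[OF bounded_slope_indicator] z by simp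
  have "cauchy_int (\<lambda>w. (s (w - c) - sgn w) / 2) z =
     (\<integral>w. of_real (r (w - c)) / (z - of_real w) - of_real (indicator {0..c} w) / (z - of_real w) \<partial>lborel)"
    unfolding cauchy_int_def
  proof (rule integral_cong_AE)
    show "AE w in lborel. of_real ((s (w - c) - sgn w) / 2) / (z - of_real w) =
        of_real (r (w - c)) / (z - of_real w) - of_real (indicator {0..c} w) / (z - of_real w)"
    proof -
      have "AE w in lborel. w \<noteq> 0 \<and> w \<noteq> c" using AE_lborel_singleton[of 0] AE_lborel_singleton[of c] by auto
      then show ?thesis
      proof eventually_elim
        case (elim w)
        then have "(s (w - c) - sgn w) / 2 = r (w - c) - indicator {0..c} w"
          using c by (auto simp: r_def indicator_def sgn_real_def field_simps)
        then show ?case by (simp only: of_real_diff diff_divide_distrib)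
      qed
    qed
  qed (simp_all add: r_def)
  also have "\<dots> = (\<integral>w. of_real (r (w - c)) / (z - of_real w) \<partial>lborel) - cauchy_int (indicator {0..c}) z"
    using i1 i2 by (simp add: cauchy_int_def)
  also have "(\<integral>w. of_real (r (w - c)) / (z - of_real w) \<partial>lborel) = cauchy_int r (z - of_real c)"
    unfolding cauchy_int_def
    by (subst lborel_integral_real_affine[where c=1 and t=c]) (auto simp: algebra_simps)
  finally have eq: "cauchy_int (\<lambda>w. (s (w - c) - sgn w) / 2) z = cauchy_int r (z - of_real c) - (Ln z - Ln (z - of_real c))"
    using cauchy_int_indicator[OF z, of 0 c] c by simp
  have ne: "z \<noteq> 0" "z - of_real c \<noteq> 0" using z by (auto simp: complex_eq_iff)
  have "- (cauchy_int r (z - of_real c) - (Ln z - Ln (z - of_real c))) = - cauchy_int r (z - of_real c) + (Ln z - Ln (z - of_real c))"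
    by simp
  then have "exp (- (cauchy_int r (z - of_real c) - (Ln z - Ln (z - of_real c)))) = exp (- cauchy_int r (z - of_real c)) * (z / (z - of_real c))"
    using ne by (simp only: exp_add exp_diff exp_Ln not_False_eq_True simp_thms)
  then show ?thesis
    unfolding slope_transform_def eq using ne by (simp add: r_def[abs_def])
qed

section \<open>Comparison of measures through their Cauchy transforms\<close>

definition cauchy_density :: "real \<Rightarrow> real" where
  "cauchy_density u = inverse (1 + u^2) / pi"

lemma cauchy_density_nonneg: "0 \<le> cauchy_density u"
  by (simp add: cauchy_density_def)

lemma cauchy_density_measurable [measurable]: "cauchy_density \<in> borel_measurable borel"
  unfolding cauchy_density_def[abs_def] by measurable

lemma cauchy_density_integrable: "integrable lborel cauchy_density"
proof -
  have "set_integrable lborel (einterval (-\<infinity>) \<infinity>) (\<lambda>x::real. inverse (1 + x^2))"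
    by (rule integrable_inverse_1_plus_square)
  then show ?thesis unfolding set_integrable_def cauchy_density_def[abs_def] by simp
qed

lemma cauchy_density_integral: "integral\<^sup>L lborel cauchy_density = 1"
proof -
  have "(\<integral>x. inverse (1 + x^2) \<partial>lborel) = pi"
    using LBINT_inverse_1_plus_square
    by (simp add: interval_lebesgue_integral_def set_lebesgue_integral_def)
  then show ?thesis unfolding cauchy_density_def[abs_def] by simp
qed

definition poisson_smooth :: "real measure \<Rightarrow> real \<Rightarrow> real \<Rightarrow> real" where
  "poisson_smooth M \<eta> t = (\<integral>x. cauchy_density ((t - x) / \<eta>) / \<eta> \<partial>M)"

lemma poisson_kernel_eq:
  assumes "0 < \<eta>"
  shows "cauchy_density ((t - x) / \<eta>) / \<eta> = - Im (1 / (Complex t \<eta> - of_real x)) / pi"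
proof -
  have "(t - x)^2 + \<eta>^2 > 0" using assms by (simp add: add_nonneg_pos)
  moreover have "1 + ((t - x) / \<eta>)^2 = ((t - x)^2 + \<eta>^2) / \<eta>^2" using assms by (simp add: field_simps)
  ultimately show ?thesis using assms
    by (simp add: cauchy_density_def Im_divide power2_eq_square)
qed

lemma poisson_smooth_eq_Im:
  assumes M: "real_distribution M" and \<eta>: "0 < \<eta>"
  shows "poisson_smooth M \<eta> t = - Im (\<integral>x. 1 / (Complex t \<eta> - of_real x) \<partial>M) / pi"
proof -
  have i: "integrable M (\<lambda>x. 1 / (Complex t \<eta> - of_real x))"
    using integrable_cauchy_kernel[OF M, of "Complex t \<eta>"] \<eta> by simp
  show ?thesis
    unfolding poisson_smooth_def poisson_kernel_eq[OF \<eta>] integral_Im[OF i, symmetric] by simp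
qed

lemma poisson_smooth_nonneg: "0 < \<eta> \<Longrightarrow> 0 \<le> poisson_smooth M \<eta> t"
  unfolding poisson_smooth_def by (intro integral_nonneg_AE AE_I2) (simp add: cauchy_density_nonneg)

lemma poisson_kernel_integral:
  fixes g :: "real \<Rightarrow> real"
  assumes \<eta>: "0 < \<eta>" and g: "g \<in> borel_measurable borel" "\<And>t. \<bar>g t\<bar> \<le> B"
  shows "integrable lborel (\<lambda>t. g t * (cauchy_density ((t - x) / \<eta>) / \<eta>))"
    "(\<integral>t. g t * (cauchy_density ((t - x) / \<eta>) / \<eta>) \<partial>lborel) = (\<integral>u. g (x + \<eta> * u) * cauchy_density u \<partial>lborel)"
    "integrable lborel (\<lambda>u. g (x + \<eta> * u) * cauchy_density u)"
proof -
  note [measurable] = g(1)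
  show i: "integrable lborel (\<lambda>u. g (x + \<eta> * u) * cauchy_density u)"
  proof (rule Bochner_Integration.integrable_bound)
    show "integrable lborel (\<lambda>u. B * cauchy_density u)" using cauchy_density_integrable by simp
    show "AE u in lborel. norm (g (x + \<eta> * u) * cauchy_density u) \<le> norm (B * cauchy_density u)"
      using g(2) cauchy_density_nonneg
      by (intro AE_I2) (auto simp: abs_mult intro!: mult_right_mono order_trans[OF g(2)])
  qed measurable
  let ?f = "\<lambda>t. g t * (cauchy_density ((t - x) / \<eta>) / \<eta>)"
  have eq: "?f (x + \<eta> * u) = g (x + \<eta> * u) * cauchy_density u / \<eta>" for u using \<eta> by simp
  have "integrable lborel (\<lambda>u. ?f (x + \<eta> * u))" unfolding eq using i by simp
  then show "integrable lborel ?f" using lborel_integrable_real_affine_iff[of \<eta> ?f x] \<eta> by simp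
  have "(\<integral>t. ?f t \<partial>lborel) = \<bar>\<eta>\<bar> *\<^sub>R (\<integral>u. ?f (x + \<eta> * u) \<partial>lborel)"
    by (rule lborel_integral_real_affine) (use \<eta> in auto)
  then show "(\<integral>t. ?f t \<partial>lborel) = (\<integral>u. g (x + \<eta> * u) * cauchy_density u \<partial>lborel)"
    unfolding eq using \<eta> by simp
qed

lemma poisson_smooth_fubini:
  fixes g :: "real \<Rightarrow> real"
  assumes M: "real_distribution M" and \<eta>: "0 < \<eta>" and g: "g \<in> borel_measurable borel" "\<And>t. \<bar>g t\<bar> \<le> B"
  shows "integrable lborel (\<lambda>t. g t * poisson_smooth M \<eta> t)"
    "(\<integral>t. g t * poisson_smooth M \<eta> t \<partial>lborel) = (\<integral>x. (\<integral>u. g (x + \<eta> * u) * cauchy_density u \<partial>lborel) \<partial>M)"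
proof -
  interpret real_distribution M by fact
  interpret pair_sigma_finite M lborel ..
  note [measurable] = g(1)
  have meas[measurable]: "(\<lambda>(x,t). g t * (cauchy_density ((t - x) / \<eta>) / \<eta>)) \<in> borel_measurable (M \<Otimes>\<^sub>M lborel)"
    by measurable
  have i: "integrable (M \<Otimes>\<^sub>M lborel) (\<lambda>(x,t). g t * (cauchy_density ((t - x) / \<eta>) / \<eta>))"
  proof (rule Fubini_integrable[OF meas])
    have eq: "(\<integral>t. norm (case (x, t) of (x, t) \<Rightarrow> g t * (cauchy_density ((t - x) / \<eta>) / \<eta>)) \<partial>lborel) =
        (\<integral>t. \<bar>g t\<bar> * (cauchy_density ((t - x) / \<eta>) / \<eta>) \<partial>lborel)" for x
      using \<eta> by (simp add: abs_mult cauchy_density_nonneg)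
    have le: "(\<integral>t. \<bar>g t\<bar> * (cauchy_density ((t - x) / \<eta>) / \<eta>) \<partial>lborel) \<le> B" for x
    proof -
      have "(\<integral>t. \<bar>g t\<bar> * (cauchy_density ((t - x) / \<eta>) / \<eta>) \<partial>lborel) = (\<integral>u. \<bar>g (x + \<eta> * u)\<bar> * cauchy_density u \<partial>lborel)"
        by (rule poisson_kernel_integral(2)[OF \<eta>, of _ B]) (use g in auto)
      also have "\<dots> \<le> (\<integral>u. B * cauchy_density u \<partial>lborel)"
        by (intro integral_mono poisson_kernel_integral(3)[OF \<eta>, of _ B] integrable_mult_right cauchy_density_integrable mult_right_mono)
           (use g cauchy_density_nonneg in auto)
      finally show ?thesis by (simp add: cauchy_density_integral)
    qed
    have nn: "0 \<le> (\<integral>t. \<bar>g t\<bar> * (cauchy_density ((t - x) / \<eta>) / \<eta>) \<partial>lborel)" for x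
      using \<eta> by (intro integral_nonneg_AE AE_I2) (simp add: cauchy_density_nonneg)
    show "integrable M (\<lambda>x. \<integral>t. norm (case (x, t) of (x, t) \<Rightarrow> g t * (cauchy_density ((t - x) / \<eta>) / \<eta>)) \<partial>lborel)"
      unfolding eq
    proof (rule integrable_const_bound[where B=B])
      show "AE x in M. norm (\<integral>t. \<bar>g t\<bar> * (cauchy_density ((t - x) / \<eta>) / \<eta>) \<partial>lborel) \<le> B"
        by (rule AE_I2) (simp only: real_norm_def abs_of_nonneg[OF nn] le)
    qed measurable
    show "AE x in M. integrable lborel (\<lambda>t. case (x, t) of (x, t) \<Rightarrow> g t * (cauchy_density ((t - x) / \<eta>) / \<eta>))"
      using poisson_kernel_integral(1)[OF \<eta> g] by simp
  qed
  have sm: "g t * poisson_smooth M \<eta> t = (\<integral>x. g t * (cauchy_density ((t - x) / \<eta>) / \<eta>) \<partial>M)" for t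
    by (simp add: poisson_smooth_def)
  show "integrable lborel (\<lambda>t. g t * poisson_smooth M \<eta> t)"
    unfolding sm using integrable_snd[OF i] by simp
  show "(\<integral>t. g t * poisson_smooth M \<eta> t \<partial>lborel) = (\<integral>x. (\<integral>u. g (x + \<eta> * u) * cauchy_density u \<partial>lborel) \<partial>M)"
    unfolding sm Fubini_integral[OF i] poisson_kernel_integral(2)[OF \<eta> g] ..
qed

text \<open>Stieltjes inversion in weak form. Fubini moves the smoothing from the measure to
  \<open>g\<close>; the averages of \<open>g\<close> at scale \<eta> are bounded by B and converge
  to \<open>g\<close> pointwise, so dominated convergence applies first over u and then over the
  measure.\<close>

lemma poisson_smooth_tendsto:
  fixes g :: "real \<Rightarrow> real"
  assumes M: "real_distribution M" and \<eta>: "\<And>n. 0 < \<eta> n" "\<eta> \<longlonglongrightarrow> 0"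
    and g: "continuous_on UNIV g" "\<And>t. \<bar>g t\<bar> \<le> B"
  shows "(\<lambda>n. \<integral>t. g t * poisson_smooth M (\<eta> n) t \<partial>lborel) \<longlonglongrightarrow> (\<integral>x. g x \<partial>M)"
proof -
  interpret real_distribution M by fact
  have [measurable]: "g \<in> borel_measurable borel" by (rule borel_measurable_continuous_onI[OF g(1)])
  have B: "0 \<le> B" using g(2)[of 0] by linarith
  have inner: "(\<lambda>n. \<integral>u. g (x + \<eta> n * u) * cauchy_density u \<partial>lborel) \<longlonglongrightarrow> g x" for x
  proof -
    have "(\<lambda>n. \<integral>u. g (x + \<eta> n * u) * cauchy_density u \<partial>lborel) \<longlonglongrightarrow> (\<integral>u. g x * cauchy_density u \<partial>lborel)"
    proof (rule integral_dominated_convergence[where w="\<lambda>u. B * cauchy_density u"])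
      show "integrable lborel (\<lambda>u. B * cauchy_density u)" using cauchy_density_integrable by simp
      show "AE u in lborel. (\<lambda>n. g (x + \<eta> n * u) * cauchy_density u) \<longlonglongrightarrow> g x * cauchy_density u"
      proof (rule AE_I2)
        fix u
        have "(\<lambda>n. x + \<eta> n * u) \<longlonglongrightarrow> x + 0 * u" by (intro tendsto_intros \<eta>)
        then have "(\<lambda>n. x + \<eta> n * u) \<longlonglongrightarrow> x" by simp
        moreover have "isCont g x" using g(1) by (simp add: continuous_on_eq_continuous_at)
        ultimately have "(\<lambda>n. g (x + \<eta> n * u)) \<longlonglongrightarrow> g x" by (intro isCont_tendsto_compose[of x g])
        then show "(\<lambda>n. g (x + \<eta> n * u) * cauchy_density u) \<longlonglongrightarrow> g x * cauchy_density u" by (intro tendsto_intros)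
      qed
      show "AE u in lborel. norm (g (x + \<eta> n * u) * cauchy_density u) \<le> B * cauchy_density u" for n
        using g(2) cauchy_density_nonneg by (intro AE_I2) (auto simp: abs_mult intro!: mult_right_mono)
    qed measurable
    then show ?thesis by (simp add: cauchy_density_integral)
  qed
  have "(\<lambda>n. \<integral>x. (\<integral>u. g (x + \<eta> n * u) * cauchy_density u \<partial>lborel) \<partial>M) \<longlonglongrightarrow> (\<integral>x. g x \<partial>M)"
  proof (rule integral_dominated_convergence[where w="\<lambda>_. B"])
    show "AE x in M. norm (\<integral>u. g (x + \<eta> n * u) * cauchy_density u \<partial>lborel) \<le> B" for n
    proof (rule AE_I2)
      fix x
      have "norm (\<integral>u. g (x + \<eta> n * u) * cauchy_density u \<partial>lborel) \<le> (\<integral>u. norm (g (x + \<eta> n * u) * cauchy_density u) \<partial>lborel)"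
        by (rule integral_norm_bound)
      also have "\<dots> \<le> (\<integral>u. B * cauchy_density u \<partial>lborel)"
      proof (rule integral_mono)
        show "integrable lborel (\<lambda>u. norm (g (x + \<eta> n * u) * cauchy_density u))"
          by (intro integrable_norm poisson_kernel_integral(3)[where g=g and B=B] \<eta> g(2)) measurable
        show "integrable lborel (\<lambda>u. B * cauchy_density u)" using cauchy_density_integrable by simp
      qed (use g(2) cauchy_density_nonneg in \<open>auto simp: abs_mult intro!: mult_right_mono\<close>)
      finally show "norm (\<integral>u. g (x + \<eta> n * u) * cauchy_density u \<partial>lborel) \<le> B" by (simp add: cauchy_density_integral)
    qed
  qed (use inner in auto)
  then show ?thesis
    using poisson_smooth_fubini(2)[where g=g and B=B, OF M \<eta>(1) _ g(2)] by simp
qed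

text \<open>By the arithmetic-geometric mean inequality, so that errors of order \<open>\<eta>\<close> times the transform
vanish in the limit after integration over \<open>t\<close>.\<close>

lemma cauchy_transform_norm_bound:
  assumes M: "real_distribution M" and \<eta>: "0 < \<eta>"
  shows "\<eta> * norm (\<integral>x. 1 / (Complex t \<eta> - of_real x) \<partial>M) \<le> sqrt \<eta> / 2 * (1 + pi * poisson_smooth M \<eta> t)"
proof -
  interpret real_distribution M by fact
  have i: "integrable M (\<lambda>x. 1 / (Complex t \<eta> - of_real x))"
    using integrable_cauchy_kernel[OF M, of "Complex t \<eta>"] \<eta> by simp
  have iP: "integrable M (\<lambda>x. cauchy_density ((t - x) / \<eta>) / \<eta>)"
    unfolding poisson_kernel_eq[OF \<eta>] using integrable_Im[OF i] by simp
  have "norm (\<integral>x. 1 / (Complex t \<eta> - of_real x) \<partial>M) \<le> (\<integral>x. norm (1 / (Complex t \<eta> - of_real x)) \<partial>M)"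
    by (rule integral_norm_bound)
  then have "\<eta> * norm (\<integral>x. 1 / (Complex t \<eta> - of_real x) \<partial>M) \<le> (\<integral>x. \<eta> * norm (1 / (Complex t \<eta> - of_real x)) \<partial>M)"
    using \<eta> by simp
  also have "\<dots> \<le> (\<integral>x. sqrt \<eta> / 2 * (1 + pi * (cauchy_density ((t - x) / \<eta>) / \<eta>)) \<partial>M)"
  proof (rule integral_mono)
    show "integrable M (\<lambda>x. \<eta> * norm (1 / (Complex t \<eta> - of_real x)))" using i by (intro integrable_mult_right integrable_norm)
    show "integrable M (\<lambda>x. sqrt \<eta> / 2 * (1 + pi * (cauchy_density ((t - x) / \<eta>) / \<eta>)))"
      using iP by (intro integrable_mult_right Bochner_Integration.integrable_add) auto
    fix x
    define D where "D = (t - x)^2 + \<eta>^2"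
    have D: "0 < D" using \<eta> by (simp add: D_def add_nonneg_pos)
    have n: "norm (1 / (Complex t \<eta> - of_real x)) = 1 / sqrt D"
    proof -
      have "norm (Complex t \<eta> - of_real x) = sqrt D" by (simp add: cmod_def D_def)
      then show ?thesis by (simp only: norm_divide norm_one)
    qed
    have P: "pi * (cauchy_density ((t - x) / \<eta>) / \<eta>) = \<eta> / D"
      unfolding poisson_kernel_eq[OF \<eta>] by (simp add: Im_divide D_def power2_eq_square)
    have "2 * (1 * sqrt (\<eta> / D)) \<le> 1 + \<eta> / D"
      using sum_squares_bound[of 1 "sqrt (\<eta> / D)"] \<eta> D by simp
    then have "sqrt \<eta> * (2 * sqrt (\<eta> / D)) \<le> sqrt \<eta> * (1 + \<eta> / D)" using \<eta> by (intro mult_left_mono) auto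
    moreover have "sqrt \<eta> * (2 * sqrt (\<eta> / D)) = 2 * (\<eta> * (1 / sqrt D))"
      using \<eta> by (simp add: real_sqrt_divide)
    ultimately have "2 * (\<eta> * (1 / sqrt D)) \<le> sqrt \<eta> * (1 + \<eta> / D)" by metis
    moreover have "X \<le> Y / 2" if "2 * X \<le> Y" for X Y :: real using that by simp
    ultimately have "\<eta> * (1 / sqrt D) \<le> sqrt \<eta> * (1 + \<eta> / D) / 2" by blast
    then show "\<eta> * norm (1 / (Complex t \<eta> - of_real x)) \<le> sqrt \<eta> / 2 * (1 + pi * (cauchy_density ((t - x) / \<eta>) / \<eta>))"
      unfolding n P times_divide_eq_left .
  qed
  also have "\<dots> = sqrt \<eta> / 2 * (1 + pi * poisson_smooth M \<eta> t)"
  proof -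
    have "(\<integral>x. 1 + pi * (cauchy_density ((t - x) / \<eta>) / \<eta>) \<partial>M) = (\<integral>x. 1 \<partial>M) + (\<integral>x. pi * (cauchy_density ((t - x) / \<eta>) / \<eta>) \<partial>M)"
      by (rule Bochner_Integration.integral_add[OF integrable_const integrable_mult_right[OF iP]])
    also have "(\<integral>x. 1 \<partial>M) = (1::real)" using prob_space[unfolded space_eq_univ] by simp
    also have "(\<integral>x. pi * (cauchy_density ((t - x) / \<eta>) / \<eta>) \<partial>M) = pi * poisson_smooth M \<eta> t"
      unfolding poisson_smooth_def by (rule integral_mult_right_zero)
    finally show ?thesis by (simp only: integral_mult_right_zero)
  qed
  finally show ?thesis .
qed

text \<open>Where \<open>g\<close> is nonzero the multiplier \<open>h\<close> has the real boundary
  value \<open>h0\<close>, so there \<open>A\<close> has density \<open>h0\<close> relative to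
  \<open>N\<close>; \<phi> is a bounded minorant of this density. At height \<eta> the imaginary
  part of the product is \<open>h0\<close> times that of the transform of \<open>N\<close>, up to C
  \<eta> times the norm of the transform; by \<open>cauchy_transform_norm_bound\<close> this error
  is of order sqrt \<eta> after integration.\<close>

lemma stieltjes_compare:
  fixes g \<phi> h0 :: "real \<Rightarrow> real" and h :: "complex \<Rightarrow> complex"
  assumes A: "real_distribution A" and N: "real_distribution N"
    and eq: "\<And>z. 0 < Im z \<Longrightarrow> (\<integral>x. 1 / (z - of_real x) \<partial>A) = (\<integral>x. 1 / (z - of_real x) \<partial>N) * h z"
    and g: "continuous_on UNIV g" "\<And>t. 0 \<le> g t" "\<And>t. g t \<le> 1" "integrable lborel g"
    and \<phi>: "continuous_on UNIV \<phi>" "\<And>t. 0 \<le> \<phi> t" "\<And>t. \<phi> t \<le> 1"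
    and \<eta>0: "0 < \<eta>0"
    and h: "\<And>t \<eta>. g t \<noteq> 0 \<Longrightarrow> 0 < \<eta> \<Longrightarrow> \<eta> < \<eta>0 \<Longrightarrow> norm (h (Complex t \<eta>) - of_real (h0 t)) \<le> C * \<eta>"
    and h0: "\<And>t. g t \<noteq> 0 \<Longrightarrow> \<phi> t \<le> h0 t"
    and C: "0 \<le> C"
  shows "(\<integral>x. g x * \<phi> x \<partial>N) \<le> (\<integral>x. g x \<partial>A)"
proof -
  note [measurable] = borel_measurable_continuous_onI[OF g(1)] borel_measurable_continuous_onI[OF \<phi>(1)]
  have g1: "\<bar>g t\<bar> \<le> 1" for t using g(2,3)[of t] by simp
  have g\<phi>1: "\<bar>g t * \<phi> t\<bar> \<le> 1" for t using g(2,3)[of t] \<phi>(2,3)[of t] by (simp add: abs_mult mult_le_one)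
  \<comment> \<open>The denominators start at 2 so that every height is strictly below
    \<eta>0.\<close>
  define \<eta> where "\<eta> n = \<eta>0 / real (Suc (Suc n))" for n
  have \<eta>: "0 < \<eta> n" "\<eta> n < \<eta>0" for n using \<eta>0 by (auto simp: \<eta>_def divide_less_eq mult_less_cancel_left1)
  have \<eta>lim: "\<eta> \<longlonglongrightarrow> 0"
    unfolding \<eta>_def by (rule LIMSEQ_Suc[OF LIMSEQ_Suc[OF lim_const_over_n]])
  have pw: "g t * \<phi> t * poisson_smooth N (\<eta> n) t - C * sqrt (\<eta> n) / 2 * (g t + g t * poisson_smooth N (\<eta> n) t)
      \<le> g t * poisson_smooth A (\<eta> n) t" for n t
  proof (cases "g t = 0")
    case False
    let ?e = "\<eta> n" and ?z = "Complex t (\<eta> n)"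
    let ?G = "\<integral>x. 1 / (?z - of_real x) \<partial>N"
    let ?q = "poisson_smooth N (\<eta> n) t"
    have q0: "0 \<le> ?q" by (rule poisson_smooth_nonneg[OF \<eta>(1)])
    have qN: "- Im ?G = pi * ?q" using poisson_smooth_eq_Im[OF N \<eta>(1)] by simp
    have "pi * poisson_smooth A ?e t = - Im (?G * h ?z)"
      using poisson_smooth_eq_Im[OF A \<eta>(1)] eq[of ?z] \<eta>(1)[of n] by simp
    also have "?G * h ?z = of_real (h0 t) * ?G + ?G * (h ?z - of_real (h0 t))" by (simp add: algebra_simps)
    also have "- Im (of_real (h0 t) * ?G + ?G * (h ?z - of_real (h0 t))) = h0 t * (- Im ?G) - Im (?G * (h ?z - of_real (h0 t)))"
      by (simp del: mult_minus_right)
    finally have 1: "pi * poisson_smooth A ?e t = h0 t * (pi * ?q) - Im (?G * (h ?z - of_real (h0 t)))" unfolding qN .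
    have "Im (?G * (h ?z - of_real (h0 t))) \<le> norm ?G * norm (h ?z - of_real (h0 t))"
      using abs_Im_le_cmod[of "?G * (h ?z - of_real (h0 t))"] by (simp only: norm_mult)
    also have "\<dots> \<le> norm ?G * (C * ?e)" using h[OF False \<eta>] by (intro mult_left_mono) auto
    also have "\<dots> = C * (?e * norm ?G)" by simp
    also have "\<dots> \<le> C * (sqrt ?e / 2 * (1 + pi * ?q))"
      using cauchy_transform_norm_bound[OF N \<eta>(1)] C by (intro mult_left_mono)
    \<comment> \<open>Enlarging 1 to \<pi> gives all terms the common factor \<pi>, which is
      cancelled below.\<close>
    also have "\<dots> \<le> C * (sqrt ?e / 2 * (pi + pi * ?q))"
      using C \<eta>(1)[of n] pi_ge_two by (intro mult_left_mono) auto
    finally have 2: "Im (?G * (h ?z - of_real (h0 t))) \<le> pi * (C * sqrt ?e / 2 * (1 + ?q))" by (simp add: algebra_simps)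
    have "\<phi> t * (pi * ?q) \<le> h0 t * (pi * ?q)" using h0[OF False] q0 by (intro mult_right_mono) auto
    then have "pi * (\<phi> t * ?q - C * sqrt ?e / 2 * (1 + ?q)) \<le> pi * poisson_smooth A ?e t"
    proof -
      have "pi * (\<phi> t * ?q - C * sqrt ?e / 2 * (1 + ?q)) = \<phi> t * (pi * ?q) - pi * (C * sqrt ?e / 2 * (1 + ?q))"
        by (simp add: algebra_simps)
      then show ?thesis using 1 2 \<open>\<phi> t * (pi * ?q) \<le> h0 t * (pi * ?q)\<close> by linarith
    qed
    then have "\<phi> t * ?q - C * sqrt ?e / 2 * (1 + ?q) \<le> poisson_smooth A ?e t" by simp
    then have "g t * (\<phi> t * ?q - C * sqrt ?e / 2 * (1 + ?q)) \<le> g t * poisson_smooth A ?e t"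
      using g(2) by (intro mult_left_mono) auto
    then show ?thesis by (simp add: algebra_simps add_divide_distrib)
  qed simp
  have iA: "integrable lborel (\<lambda>t. g t * poisson_smooth A (\<eta> n) t)" for n
    by (rule poisson_smooth_fubini(1)[OF A \<eta>(1) _ g1]) simp
  have iN: "integrable lborel (\<lambda>t. g t * poisson_smooth N (\<eta> n) t)" for n
    by (rule poisson_smooth_fubini(1)[OF N \<eta>(1) _ g1]) simp
  have iN': "integrable lborel (\<lambda>t. g t * \<phi> t * poisson_smooth N (\<eta> n) t)" for n
    by (rule poisson_smooth_fubini(1)[OF N \<eta>(1) _ g\<phi>1]) simp
  have le: "(\<integral>t. g t * \<phi> t * poisson_smooth N (\<eta> n) t \<partial>lborel) - C * sqrt (\<eta> n) / 2 * ((\<integral>t. g t \<partial>lborel) + (\<integral>t. g t * poisson_smooth N (\<eta> n) t \<partial>lborel))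
     \<le> (\<integral>t. g t * poisson_smooth A (\<eta> n) t \<partial>lborel)" for n
  proof -
    have i2: "integrable lborel (\<lambda>t. C * sqrt (\<eta> n) / 2 * (g t + g t * poisson_smooth N (\<eta> n) t))"
      by (intro integrable_mult_right Bochner_Integration.integrable_add g(4) iN)
    have "(\<integral>t. g t * \<phi> t * poisson_smooth N (\<eta> n) t - C * sqrt (\<eta> n) / 2 * (g t + g t * poisson_smooth N (\<eta> n) t) \<partial>lborel) \<le> (\<integral>t. g t * poisson_smooth A (\<eta> n) t \<partial>lborel)"
      by (rule integral_mono[OF Bochner_Integration.integrable_diff[OF iN' i2] iA pw])
    then show ?thesis
      unfolding Bochner_Integration.integral_diff[OF iN' i2] integral_mult_right_zero Bochner_Integration.integral_add[OF g(4) iN] .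
  qed
  have cg\<phi>: "continuous_on UNIV (\<lambda>t. g t * \<phi> t)" by (intro continuous_intros g \<phi>)
  have "(\<lambda>n. (\<integral>t. g t * \<phi> t * poisson_smooth N (\<eta> n) t \<partial>lborel) - C * sqrt (\<eta> n) / 2 * ((\<integral>t. g t \<partial>lborel) + (\<integral>t. g t * poisson_smooth N (\<eta> n) t \<partial>lborel)))
    \<longlonglongrightarrow> (\<integral>x. g x * \<phi> x \<partial>N) - C * sqrt 0 / 2 * ((\<integral>t. g t \<partial>lborel) + (\<integral>x. g x \<partial>N))"
    by (intro tendsto_intros \<eta>lim poisson_smooth_tendsto[OF N \<eta>(1) \<eta>lim g(1) g1] poisson_smooth_tendsto[OF N \<eta>(1) \<eta>lim cg\<phi> g\<phi>1]) simp
  then have "(\<lambda>n. (\<integral>t. g t * \<phi> t * poisson_smooth N (\<eta> n) t \<partial>lborel) - C * sqrt (\<eta> n) / 2 * ((\<integral>t. g t \<partial>lborel) + (\<integral>t. g t * poisson_smooth N (\<eta> n) t \<partial>lborel)))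
    \<longlonglongrightarrow> (\<integral>x. g x * \<phi> x \<partial>N)" by simp
  from LIMSEQ_le[OF this poisson_smooth_tendsto[OF A \<eta>(1) \<eta>lim g(1) g1]] le show ?thesis by blast
qed

text \<open>Passes from test functions to the open set where d is positive. The constants in the
  boundary estimate may deteriorate as d tends to 0, so they are allowed to depend on \<delta>; the
  n-th cut-off only sees \<delta> = 1/n.\<close>

lemma stieltjes_compare_open:
  fixes \<phi> h0 d :: "real \<Rightarrow> real" and h :: "complex \<Rightarrow> complex"
  assumes A: "real_distribution A" and N: "real_distribution N"
    and eq: "\<And>z. 0 < Im z \<Longrightarrow> (\<integral>x. 1 / (z - of_real x) \<partial>A) = (\<integral>x. 1 / (z - of_real x) \<partial>N) * h z"
    and \<phi>: "continuous_on UNIV \<phi>" "\<And>t. 0 \<le> \<phi> t" "\<And>t. \<phi> t \<le> 1"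
    and d: "continuous_on UNIV d"
    and h: "\<And>\<delta>. 0 < \<delta> \<Longrightarrow> \<exists>C\<ge>0. \<exists>\<eta>0>0. \<forall>t \<eta>. \<delta> \<le> d t \<longrightarrow> 0 < \<eta> \<longrightarrow> \<eta> < \<eta>0 \<longrightarrow>
              norm (h (Complex t \<eta>) - of_real (h0 t)) \<le> C * \<eta>"
    and h0: "\<And>t. 0 < d t \<Longrightarrow> \<phi> t \<le> h0 t"
  shows "(\<integral>x. indicator {t. 0 < d t} x * \<phi> x \<partial>N) \<le> measure A {t. 0 < d t}"
proof -
  interpret A: real_distribution A by fact
  interpret N: real_distribution N by fact
  note [measurable] = borel_measurable_continuous_onI[OF d] borel_measurable_continuous_onI[OF \<phi>(1)]
  \<comment> \<open>For positive n the first factor vanishes where d t \<le> 1/n and is 1 where d t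
    \<ge> 2/n; the second one vanishes for |t| \<ge> n and makes the cut-off integrable.\<close>
  define g where "g n t = max 0 (min 1 (real n * d t - 1)) * max 0 (min 1 (real n - \<bar>t\<bar>))" for n t
  have gc: "continuous_on UNIV (g n)" for n unfolding g_def by (intro continuous_intros d)
  have [measurable]: "g n \<in> borel_measurable borel" for n by (rule borel_measurable_continuous_onI[OF gc])
  have g01: "0 \<le> g n t" "g n t \<le> 1" for n t unfolding g_def by (auto intro!: mult_le_one)
  have gnz: "\<bar>t\<bar> < real n" "1 / real n \<le> d t" if "g n t \<noteq> 0" for n t
  proof -
    from that have *: "real n * d t - 1 > 0" "real n - \<bar>t\<bar> > 0" by (auto simp: g_def max_def min_def split: if_splits)
    then show "\<bar>t\<bar> < real n" by simp
    then have "0 < real n" by linarith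
    then show "1 / real n \<le> d t" using * by (simp add: divide_le_eq mult.commute)
  qed
  have gi: "integrable lborel (g n)" for n
  proof (rule Bochner_Integration.integrable_bound)
    show "integrable lborel (indicat_real {-real n..real n})" by (simp add: integrable_indicator_iff emeasure_lborel_Icc_eq)
    show "AE x in lborel. norm (g n x) \<le> norm (indicat_real {- real n..real n} x)"
    proof (rule AE_I2)
      fix x show "norm (g n x) \<le> norm (indicat_real {- real n..real n} x)"
        using g01[of n x] gnz(1)[of n x] by (cases "g n x = 0") (auto simp: indicator_def)
    qed
  qed simp
  have lim: "(\<lambda>n. g n x) \<longlonglongrightarrow> indicator {t. 0 < d t} x" for x
  proof (cases "0 < d x")
    case True
    obtain k where k: "max (2 / d x) (\<bar>x\<bar> + 1) \<le> real k" using real_arch_simple by blast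
    have "g n x = 1" if "k \<le> n" for n
    proof -
      have "2 / d x \<le> real n" "\<bar>x\<bar> + 1 \<le> real n" using k that by (auto intro: order_trans)
      then show ?thesis using True by (simp add: g_def divide_le_eq mult.commute)
    qed
    then show ?thesis using True by (intro tendsto_eventually eventually_sequentiallyI[of k]) auto
  next
    case False
    then have "real n * d x \<le> 0" for n by (simp add: mult_nonneg_nonpos)
    then have "g n x = 0" for n by (simp add: g_def max_def min_def) (smt (verit))
    then show ?thesis using False by simp
  qed
  have "(\<integral>x. g n x * \<phi> x \<partial>N) \<le> (\<integral>x. g n x \<partial>A)" for n
  proof (cases "n = 0")
    case True
    then have "g n x = 0" for x using gnz(1)[of n x] by fastforce
    then show ?thesis by simp
  next
    case False
    then obtain C \<eta>0 where *: "0 \<le> C" "0 < \<eta>0" "\<And>t \<eta>. 1 / real n \<le> d t \<Longrightarrow> 0 < \<eta> \<Longrightarrow> \<eta> < \<eta>0 \<Longrightarrow>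
              norm (h (Complex t \<eta>) - of_real (h0 t)) \<le> C * \<eta>"
      using h[of "1 / real n"] by auto
    show ?thesis
    proof (rule stieltjes_compare[OF A N eq gc g01 gi \<phi> *(2) *(3) _ *(1)])
      fix t assume t: "g n t \<noteq> 0"
      then show "1 / real n \<le> d t" by (rule gnz)
      moreover have "0 < 1 / real n" using False by simp
      ultimately show "\<phi> t \<le> h0 t" using h0 less_le_trans by blast
    qed
  qed
  moreover have "(\<lambda>n. \<integral>x. g n x * \<phi> x \<partial>N) \<longlonglongrightarrow> (\<integral>x. indicator {t. 0 < d t} x * \<phi> x \<partial>N)"
  proof (rule integral_dominated_convergence[where w="\<lambda>_. 1"])
    show "AE x in N. (\<lambda>n. g n x * \<phi> x) \<longlonglongrightarrow> indicator {t. 0 < d t} x * \<phi> x" by (intro AE_I2 tendsto_intros lim)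
    show "AE x in N. norm (g n x * \<phi> x) \<le> 1" for n using g01 \<phi>(2,3) by (intro AE_I2) (simp add: abs_mult mult_le_one)
  qed auto
  moreover have "(\<lambda>n. \<integral>x. g n x \<partial>A) \<longlonglongrightarrow> (\<integral>x. indicator {t. 0 < d t} x \<partial>A)"
  proof (rule integral_dominated_convergence[where w="\<lambda>_. 1"])
    show "AE x in A. (\<lambda>n. g n x) \<longlonglongrightarrow> indicator {t. 0 < d t} x" by (intro AE_I2 lim)
    show "AE x in A. norm (g n x) \<le> 1" for n using g01 by (intro AE_I2) simp
  qed auto
  ultimately have "(\<integral>x. indicator {t. 0 < d t} x * \<phi> x \<partial>N) \<le> (\<integral>x. indicator {t. 0 < d t} x \<partial>A)"
    using LIMSEQ_le by blast
  then show ?thesis by simp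
qed

section \<open>Ratios of slope transforms and their boundary values\<close>

lemma slope_transform_ratio:
  assumes s: "admissible s1" "admissible s2" and z: "0 < Im z"
  shows "slope_transform s1 z = slope_transform s2 z * exp (- cauchy_int (\<lambda>w. (s1 w - s2 w) / 2) z)"
proof -
  have i: "integrable lborel (\<lambda>w. of_real ((s2 w - sgn w) / 2) / (z - of_real w))"
      "integrable lborel (\<lambda>w. of_real ((s1 w - s2 w) / 2) / (z - of_real w))"
    using cauchy_int_integrable_Im[OF bounded_slope_sgn[OF s(2)]] cauchy_int_integrable_Im[OF bounded_slope_half_diff[OF s]] z
    by (simp_all only: zero_less_abs_iff)
  have "(s1 w - sgn w) / 2 = (s2 w - sgn w) / 2 + (s1 w - s2 w) / 2" for w by (simp add: field_simps)
  then have "of_real ((s1 w - sgn w) / 2) / (z - of_real w) =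
      of_real ((s2 w - sgn w) / 2) / (z - of_real w) + of_real ((s1 w - s2 w) / 2) / (z - of_real w)" for w
    by (simp only: of_real_add add_divide_distrib)
  then have "cauchy_int (\<lambda>w. (s1 w - sgn w) / 2) z = cauchy_int (\<lambda>w. (s2 w - sgn w) / 2) z + cauchy_int (\<lambda>w. (s1 w - s2 w) / 2) z"
    unfolding cauchy_int_def by (simp only: Bochner_Integration.integral_add[OF i])
  then show ?thesis unfolding slope_transform_def by (simp only: minus_add_distrib exp_add mult.assoc)
qed

lemma cauchy_int_of_real:
  "cauchy_int r (of_real t) = of_real (\<integral>w. r w / (t - w) \<partial>lborel)"
  unfolding cauchy_int_def integral_complex_of_real[symmetric] by simp

text \<open>Where d is positive it bounds from below the distance to the set on which the slopes
  differ. There the ratio of the transforms extends continuously to the real axis with a positive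
  value, which is the density of \<open>A\<close> relative to \<open>N\<close>. Choosing d = t - p
  or d = p - t selects one side of p.\<close>

lemma slope_measure_compare:
  fixes \<phi> d s1 s2 :: "real \<Rightarrow> real"
  assumes A: "real_distribution A" "\<And>z. 0 < Im z \<Longrightarrow> (\<integral>x. 1 / (z - of_real x) \<partial>A) = slope_transform s1 z"
    and N: "real_distribution N" "\<And>z. 0 < Im z \<Longrightarrow> (\<integral>x. 1 / (z - of_real x) \<partial>N) = slope_transform s2 z"
    and s: "admissible s1" "admissible s2"
    and \<phi>: "continuous_on UNIV \<phi>" "\<And>t. 0 \<le> \<phi> t" "\<And>t. \<phi> t \<le> 1"
    and d: "continuous_on UNIV d" "\<And>t w. 0 < d t \<Longrightarrow> s1 w \<noteq> s2 w \<Longrightarrow> d t \<le> \<bar>t - w\<bar>"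
    and le: "\<And>t. 0 < d t \<Longrightarrow> \<phi> t \<le> exp (- (\<integral>w. (s1 w - s2 w) / 2 / (t - w) \<partial>lborel))"
  shows "(\<integral>x. indicator {t. 0 < d t} x * \<phi> x \<partial>N) \<le> measure A {t. 0 < d t}"
proof -
  define r where "r w = (s1 w - s2 w) / 2" for w
  have r: "bounded_slope r" unfolding r_def by (rule bounded_slope_half_diff[OF s])
  define B where "B = (\<integral>w. \<bar>r w\<bar> \<partial>lborel)"
  have B: "0 \<le> B" by (simp add: B_def)
  define h where "h z = exp (- cauchy_int r z)" for z
  define h0 where "h0 t = exp (- (\<integral>w. r w / (t - w) \<partial>lborel))" for t
  have hh0: "h (of_real t) = of_real (h0 t)" for t
    unfolding h_def h0_def cauchy_int_of_real by (simp add: exp_of_real[symmetric])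
  show ?thesis
  proof (rule stieltjes_compare_open[where h=h and ?h0.0=h0, OF A(1) N(1) _ \<phi> d(1)])
    show "(\<integral>x. 1 / (z - of_real x) \<partial>A) = (\<integral>x. 1 / (z - of_real x) \<partial>N) * h z" if "0 < Im z" for z
      unfolding A(2)[OF that] N(2)[OF that] h_def r_def[abs_def] by (rule slope_transform_ratio[OF s that])
    show "\<phi> t \<le> h0 t" if "0 < d t" for t unfolding h0_def r_def using le[OF that] .
    fix \<delta> :: real assume \<delta>: "0 < \<delta>"
    \<comment> \<open>Below this height the exponent changes by at most 1/2 between the axis and
      \<open>Complex t \<eta>\<close>, so \<open>norm_exp_minus_one_le\<close> applies. The added 1
      keeps the denominator positive when B = 0.\<close>
    define \<eta>0 where "\<eta>0 = 1 / (2 * (B / \<delta>^2 + 1))"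
    have pos: "0 < B / \<delta>^2 + 1" using B by (simp add: add_nonneg_pos)
    have \<eta>0: "0 < \<eta>0" unfolding \<eta>0_def using pos by simp
    define C where "C = exp (B / \<delta>) * (2 * (B / \<delta>^2))"
    have "norm (h (Complex t \<eta>) - of_real (h0 t)) \<le> C * \<eta>" if t: "\<delta> \<le> d t" and \<eta>: "0 < \<eta>" "\<eta> < \<eta>0" for t \<eta>
    proof -
      have away: "\<delta> \<le> norm (complex_of_real t - of_real w)" if "r w \<noteq> 0" for w
      proof -
        have "s1 w \<noteq> s2 w" using that by (auto simp: r_def)
        then have "\<delta> \<le> \<bar>t - w\<bar>" using d(2)[of t w] t \<delta> by linarith
        then show ?thesis by (metis norm_of_real of_real_diff)
      qed
      have away': "\<delta> \<le> norm (Complex t \<eta> - of_real w)" if "r w \<noteq> 0" for w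
        using away[OF that] abs_Re_le_cmod[of "Complex t \<eta> - of_real w"] by (metis norm_of_real of_real_diff Re_complex_of_real minus_complex.sel(1) complex.sel(1) order_trans)
      have zt: "Complex t \<eta> - of_real t = \<i> * of_real \<eta>" by (simp add: complex_eq_iff)
      let ?D = "cauchy_int r (Complex t \<eta>) - cauchy_int r (of_real t)"
      have "norm ?D \<le> norm (Complex t \<eta> - of_real t) * (B / \<delta>^2)"
        unfolding B_def by (rule cauchy_int_lipschitz[OF r \<delta> away' away])
      then have D: "norm ?D \<le> \<eta> * (B / \<delta>^2)" unfolding zt using \<eta> by (simp add: norm_mult)
      also have "\<dots> \<le> \<eta>0 * (B / \<delta>^2 + 1)" using \<eta> B \<eta>0 by (intro mult_mono) auto
      also have "\<dots> = 1 / 2" using pos by (simp add: \<eta>0_def)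
      finally have "norm (exp (- ?D) - 1) \<le> 2 * norm (- ?D)" by (intro norm_exp_minus_one_le) (simp only: norm_minus_cancel)
      then have e1: "norm (exp (- ?D) - 1) \<le> 2 * (\<eta> * (B / \<delta>^2))" using D unfolding norm_minus_cancel by linarith
      have "norm (cauchy_int r (of_real t)) \<le> B / \<delta>" unfolding B_def by (rule cauchy_int_bound[OF r \<delta> away])
      then have e2: "norm (exp (- cauchy_int r (of_real t))) \<le> exp (B / \<delta>)"
        unfolding norm_exp_eq_Re using abs_Re_le_cmod[of "- cauchy_int r (of_real t)"] by simp
      have "h (Complex t \<eta>) = exp (- cauchy_int r (of_real t) + - ?D)" unfolding h_def by simp
      then have "h (Complex t \<eta>) - of_real (h0 t) = exp (- cauchy_int r (of_real t)) * (exp (- ?D) - 1)"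
        unfolding hh0[symmetric] exp_add h_def by (simp add: right_diff_distrib)
      then have "norm (h (Complex t \<eta>) - of_real (h0 t)) = norm (exp (- cauchy_int r (of_real t))) * norm (exp (- ?D) - 1)"
        by (simp only: norm_mult)
      also have "\<dots> \<le> exp (B / \<delta>) * (2 * (\<eta> * (B / \<delta>^2)))" using e1 e2 by (intro mult_mono) auto
      also have "\<dots> = C * \<eta>" by (simp add: C_def)
      finally show ?thesis .
    qed
    moreover have "0 \<le> C" unfolding C_def using B \<delta> by simp
    ultimately show "\<exists>C\<ge>0. \<exists>\<eta>0>0. \<forall>t \<eta>. \<delta> \<le> d t \<longrightarrow> 0 < \<eta> \<longrightarrow> \<eta> < \<eta>0 \<longrightarrow> norm (h (Complex t \<eta>) - of_real (h0 t)) \<le> C * \<eta>"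
      using \<eta>0 by blast
  qed
qed

text \<open>A function with nonnegative primitive and total integral 0 has its positive mass to the
  left of its negative mass, so a nondecreasing weight pairs with it nonpositively. The second mean
  value theorem makes this exact: for some c the integral is k a - k b times the primitive at
  c.\<close>

lemma integral_mono_kernel_nonpos:
  fixes r k :: "real \<Rightarrow> real"
  assumes ab: "a \<le> b" and r: "r integrable_on {a..b}" "\<And>w. w \<notin> {a..b} \<Longrightarrow> r w = 0"
    and k: "\<And>x y. a \<le> x \<Longrightarrow> x \<le> y \<Longrightarrow> y \<le> b \<Longrightarrow> k x \<le> k y"
    and F: "\<And>c. a \<le> c \<Longrightarrow> c \<le> b \<Longrightarrow> 0 \<le> integral {a..c} r" "integral {a..b} r = 0"
    and int: "integrable lborel (\<lambda>w. r w * k w)"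
  shows "(\<integral>w. r w * k w \<partial>lborel) \<le> 0"
proof -
  obtain c where c: "c \<in> {a..b}" and hi: "((\<lambda>x. k x * r x) has_integral (k a * integral {a..c} r + k b * integral {c..b} r)) {a..b}"
    using second_mean_value_theorem_full[where g=k, OF r(1) ab k] by blast
  have "integral {a..c} r + integral {c..b} r = 0"
    using Henstock_Kurzweil_Integration.integral_combine[of a c b r] c r(1) F(2) by auto
  then have "k a * integral {a..c} r + k b * integral {c..b} r = (k a - k b) * integral {a..c} r"
    by (simp add: eq_neg_iff_add_eq_0[symmetric] algebra_simps)
  also have "\<dots> \<le> 0" using F(1)[of c] c k[of a b] ab by (intro mult_nonpos_nonneg) auto
  finally have le: "k a * integral {a..c} r + k b * integral {c..b} r \<le> 0" .
  have "((\<lambda>w. r w * k w) has_integral (\<integral>w. r w * k w \<partial>lborel)) UNIV"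
    by (rule has_integral_integral_lborel[OF int])
  moreover have "((\<lambda>w. r w * k w) has_integral (k a * integral {a..c} r + k b * integral {c..b} r)) UNIV"
    by (rule has_integral_on_superset[where S="{a..b}"]) (use hi r(2) in \<open>auto simp: mult.commute\<close>)
  ultimately show ?thesis using le has_integral_unique by metis
qed

text \<open>The factor i \<eta> / (p + i \<eta> - x) equals 1 at x = p, tends to 0 at every other x
  and has norm at most 1, so dominated convergence singles out the atom. With norms on both sides
  only the modulus of a ratio of transforms matters later.\<close>

lemma cauchy_transform_atom:
  assumes M: "real_distribution M" and \<eta>: "\<And>n. 0 < \<eta> n" "\<eta> \<longlonglongrightarrow> 0"
  shows "(\<lambda>n. \<eta> n * norm (\<integral>x. 1 / (Complex p (\<eta> n) - of_real x) \<partial>M)) \<longlonglongrightarrow> measure M {p}"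
proof -
  interpret real_distribution M by fact
  have "(\<lambda>n. \<integral>x. \<i> * of_real (\<eta> n) * (1 / (Complex p (\<eta> n) - of_real x)) \<partial>M) \<longlonglongrightarrow> (\<integral>x. of_real (indicator {p} x) \<partial>M)"
  proof (rule integral_dominated_convergence[where w="\<lambda>_. 1"])
    show "AE x in M. (\<lambda>n. \<i> * of_real (\<eta> n) * (1 / (Complex p (\<eta> n) - of_real x))) \<longlonglongrightarrow> of_real (indicator {p} x)"
    proof (rule AE_I2)
      fix x
      have C: "Complex p (\<eta> n) - of_real x = of_real (p - x) + \<i> * of_real (\<eta> n)" for n by (simp add: complex_eq_iff)
      show "(\<lambda>n. \<i> * of_real (\<eta> n) * (1 / (Complex p (\<eta> n) - of_real x))) \<longlonglongrightarrow> of_real (indicator {p} x)"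
      proof (cases "x = p")
        case True
        have "\<i> * of_real (\<eta> n) * (1 / (Complex p (\<eta> n) - of_real x)) = 1" for n
          unfolding C using True \<eta>(1)[of n] by simp
        then show ?thesis using True by simp
      next
        case False
        have "(\<lambda>n. \<i> * of_real (\<eta> n) * (1 / (of_real (p - x) + \<i> * of_real (\<eta> n)))) \<longlonglongrightarrow> \<i> * of_real 0 * (1 / (of_real (p - x) + \<i> * of_real 0))"
          using False by (intro tendsto_intros \<eta>) auto
        then show ?thesis using False unfolding C by simp
      qed
    qed
    show "AE x in M. norm (\<i> * of_real (\<eta> n) * (1 / (Complex p (\<eta> n) - of_real x))) \<le> 1" for n
    proof (rule AE_I2)
      fix x :: real
      have "\<eta> n \<le> norm (Complex p (\<eta> n) - of_real x)" using norm_sub_of_real_ge_Im[of "Complex p (\<eta> n)" x] \<eta>(1)[of n] by simp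
      then show "norm (\<i> * of_real (\<eta> n) * (1 / (Complex p (\<eta> n) - of_real x))) \<le> 1"
        using \<eta>(1)[of n] by (simp add: norm_mult norm_divide divide_le_eq)
    qed
  qed auto
  then have "(\<lambda>n. norm (\<integral>x. \<i> * of_real (\<eta> n) * (1 / (Complex p (\<eta> n) - of_real x)) \<partial>M)) \<longlonglongrightarrow> norm (\<integral>x. complex_of_real (indicator {p} x) \<partial>M)"
    by (rule tendsto_norm)
  moreover have "norm (\<integral>x. complex_of_real (indicator {p} x) \<partial>M) = measure M {p}"
    unfolding integral_complex_of_real by simp
  moreover have "norm (\<integral>x. \<i> * of_real (\<eta> n) * (1 / (Complex p (\<eta> n) - of_real x)) \<partial>M) = \<eta> n * norm (\<integral>x. 1 / (Complex p (\<eta> n) - of_real x) \<partial>M)" for n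
    unfolding integral_mult_right_zero norm_mult using \<eta>(1)[of n] by simp
  ultimately show ?thesis by simp
qed

lemma Re_cauchy_int:
  assumes r: "bounded_slope r" and \<eta>: "0 < \<eta>"
  shows "Re (cauchy_int r (Complex p \<eta>)) = (\<integral>w. r w * ((p - w) / ((p - w)^2 + \<eta>^2)) \<partial>lborel)"
proof -
  have i: "integrable lborel (\<lambda>w. of_real (r w) / (Complex p \<eta> - of_real w))"
    using cauchy_int_integrable_Im[OF r, of "Complex p \<eta>"] \<eta> by simp
  have "Re (of_real (r w) / (Complex p \<eta> - of_real w)) = r w * ((p - w) / ((p - w)^2 + \<eta>^2))" for w
    by (simp add: Re_divide)
  then show ?thesis using integral_Re[OF i] unfolding cauchy_int_def by simp
qed

text \<open>Integrating over \<open>\<eta>\<close> turns the kernel \<open>(p - w) / ((p - w)\<^sup>2 + \<eta>\<^sup>2)\<close>, which is not monotone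
in \<open>w\<close>, into an arctangent, which is.\<close>

lemma Re_cauchy_int_small:
  assumes r: "bounded_slope r" and supp: "\<And>w. r w \<noteq> 0 \<Longrightarrow> a \<le> w \<and> w < p"
    and F: "\<And>c. a \<le> c \<Longrightarrow> c \<le> p \<Longrightarrow> 0 \<le> integral {a..c} r" "integral {a..p} r = 0"
    and ap: "a \<le> p" and c: "0 < c" and \<eta>1: "0 < \<eta>1"
  shows "\<exists>\<eta>. 0 < \<eta> \<and> \<eta> < \<eta>1 \<and> Re (cauchy_int r (Complex p \<eta>)) < c"
proof (rule ccontr)
  \<comment> \<open>If the real part were at least c at all heights below \<eta>1, its integral over
    the heights would be at least c \<eta>1; exchanging the integrals shows that it is at most
    0.\<close>
  assume "\<not> ?thesis"
  then have ge: "c \<le> Re (cauchy_int r (Complex p \<eta>))" if "0 < \<eta>" "\<eta> < \<eta>1" for \<eta>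
    using that by (meson not_le)
  have [measurable]: "r \<in> borel_measurable borel" using r by (simp add: bounded_slope_def)
  define q where "q w \<eta> = r w * ((p - w) / ((p - w)^2 + \<eta>^2)) * indicator {0..\<eta>1} \<eta>" for w \<eta>
  \<comment> \<open>For w < p this is arctan(\<eta>1 / (p - w)), the integral of the kernel over the
    heights. In the present form it is continuous and nondecreasing on the whole line, including w =
    p.\<close>
  define k where "k w = pi / 2 - arctan ((p - w) / \<eta>1)" for w
  have kmono: "k x \<le> k y" if "x \<le> y" for x y
    unfolding k_def using that \<eta>1 by (simp add: arctan_le_iff divide_right_mono)
  have k01: "0 \<le> k w" "k w \<le> pi" for w
    unfolding k_def using arctan_bounded[of "(p - w) / \<eta>1"] by auto
  have [measurable]: "k \<in> borel_measurable borel" unfolding k_def[abs_def]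
    by (intro borel_measurable_continuous_onI continuous_intros) (use \<eta>1 in auto)
  have inner: "has_bochner_integral lborel (\<lambda>\<eta>. (p - w) / ((p - w)^2 + \<eta>^2) * indicator {0..\<eta>1} \<eta>) (k w)" if "w < p" for w
  proof -
    define d where "d = p - w"
    have d: "0 < d" using that by (simp add: d_def)
    have "has_bochner_integral lborel (\<lambda>\<eta>. d / (d^2 + \<eta>^2) * indicator {0..\<eta>1} \<eta>) (arctan (\<eta>1 / d) - arctan (0 / d))"
    proof (rule has_bochner_integral_FTC_Icc_real)
      show "0 \<le> \<eta>1" using \<eta>1 by simp
      fix x :: real
      have pos: "0 < d^2 + x^2" using d by (simp add: add_pos_nonneg)
      have "((\<lambda>\<eta>. arctan (\<eta> / d)) has_real_derivative inverse (1 + (x / d)^2) * (1 / d)) (at x)"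
        using d by (auto intro!: derivative_eq_intros)
      moreover have "inverse (1 + (x / d)^2) * (1 / d) = d / (d^2 + x^2)"
      proof -
        have "1 + (x / d)^2 = (d^2 + x^2) / d^2" using d by (simp add: field_simps)
        then show ?thesis using d pos by (simp add: power2_eq_square)
      qed
      ultimately show "((\<lambda>\<eta>. arctan (\<eta> / d)) has_real_derivative d / (d^2 + x^2)) (at x)" by simp
      show "isCont (\<lambda>\<eta>. d / (d^2 + \<eta>^2)) x" using pos by (intro continuous_intros) auto
    qed
    moreover have "arctan (\<eta>1 / d) = k w"
    proof -
      have "arctan (inverse (d / \<eta>1)) = pi / 2 - arctan (d / \<eta>1)"
        using d \<eta>1 by (intro arctan_inverse) auto
      then show ?thesis using d \<eta>1 by (simp add: k_def d_def)
    qed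
    ultimately show ?thesis by (simp add: d_def)
  qed
  have innerq: "has_bochner_integral lborel (q w) (r w * k w)" for w
  proof (cases "r w = 0")
    case False
    then have "w < p" using supp by blast
    from has_bochner_integral_mult_right[OF inner[OF this], of "r w"] show ?thesis
      unfolding q_def[abs_def] by (simp only: mult.assoc)
  qed (simp add: q_def[abs_def] has_bochner_integral_zero)
  have innern: "(\<integral>\<eta>. norm (q w \<eta>) \<partial>lborel) = \<bar>r w\<bar> * k w" for w
  proof (cases "r w = 0")
    case False
    then have w: "w < p" using supp by blast
    have "norm (q w \<eta>) = \<bar>r w\<bar> * ((p - w) / ((p - w)^2 + \<eta>^2) * indicator {0..\<eta>1} \<eta>)" for \<eta>
      unfolding q_def using w by (simp add: abs_mult)
    then show ?thesis
      using has_bochner_integral_integral_eq[OF has_bochner_integral_mult_right[OF inner[OF w], of "\<bar>r w\<bar>"]] by simp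
  qed (simp add: q_def)
  have irk: "integrable lborel (\<lambda>w. \<bar>r w\<bar> * k w)"
  proof (rule Bochner_Integration.integrable_bound)
    show "integrable lborel (\<lambda>w. \<bar>r w\<bar> * pi)" using bounded_slope_integrable[OF r] by simp
    show "AE w in lborel. norm (\<bar>r w\<bar> * k w) \<le> norm (\<bar>r w\<bar> * pi)"
      using k01 by (intro AE_I2) (simp add: abs_mult mult_left_mono)
  qed simp
  have meas: "(\<lambda>(w,\<eta>). q w \<eta>) \<in> borel_measurable (lborel \<Otimes>\<^sub>M lborel)"
    unfolding q_def by measurable
  have iq: "integrable (lborel \<Otimes>\<^sub>M lborel) (\<lambda>(w,\<eta>). q w \<eta>)"
    by (rule lborel_pair.Fubini_integrable[OF meas])
       (use innern irk innerq in \<open>auto simp: has_bochner_integral_iff\<close>)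
  have "(\<integral>\<eta>. (\<integral>w. q w \<eta> \<partial>lborel) \<partial>lborel) = (\<integral>w. (\<integral>\<eta>. q w \<eta> \<partial>lborel) \<partial>lborel)"
    by (rule lborel_pair.Fubini_integral[OF iq])
  also have "\<dots> = (\<integral>w. r w * k w \<partial>lborel)"
    by (simp only: has_bochner_integral_integral_eq[OF innerq])
  also have "\<dots> \<le> 0"
  proof (rule integral_mono_kernel_nonpos[OF ap _ _ kmono F])
    show "r integrable_on {a..p}"
      using has_integral_integral_lborel[OF bounded_slope_integrable[OF r]] integrable_on_subinterval[of r UNIV a p]
      by (auto simp: integrable_on_def)
    show "r w = 0" if "w \<notin> {a..p}" for w using supp[of w] that by force
    show "integrable lborel (\<lambda>w. r w * k w)"
      by (rule Bochner_Integration.integrable_bound[OF irk]) (use k01 in \<open>auto simp: abs_mult\<close>)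
  qed
  finally have le0: "(\<integral>\<eta>. (\<integral>w. q w \<eta> \<partial>lborel) \<partial>lborel) \<le> 0" .
  have "(\<integral>\<eta>. c * indicator {0..\<eta>1} \<eta> \<partial>lborel) \<le> (\<integral>\<eta>. (\<integral>w. q w \<eta> \<partial>lborel) \<partial>lborel)"
  proof (rule integral_mono_AE)
    show "integrable lborel (\<lambda>\<eta>. c * indicator {0..\<eta>1} \<eta>)"
      by (intro integrable_mult_right) (simp add: integrable_indicator_iff emeasure_lborel_Icc_eq)
    show "integrable lborel (\<lambda>\<eta>. \<integral>w. q w \<eta> \<partial>lborel)" by (rule lborel_pair.integrable_snd[OF iq])
    have "AE \<eta> in lborel. \<eta> \<noteq> 0 \<and> \<eta> \<noteq> \<eta>1" using AE_lborel_singleton[of 0] AE_lborel_singleton[of \<eta>1] by auto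
    then show "AE \<eta> in lborel. c * indicator {0..\<eta>1} \<eta> \<le> (\<integral>w. q w \<eta> \<partial>lborel)"
    proof eventually_elim
      case (elim \<eta>)
      show ?case
      proof (cases "\<eta> \<in> {0..\<eta>1}")
        case True
        then have h: "0 < \<eta>" "\<eta> < \<eta>1" using elim by auto
        then show ?thesis using ge[OF h] True unfolding Re_cauchy_int[OF r h(1)] by (simp add: q_def)
      qed (simp add: q_def)
    qed
  qed
  moreover have "(\<integral>\<eta>. c * indicator {0..\<eta>1} \<eta> \<partial>lborel) = c * \<eta>1" using \<eta>1 by simp
  moreover have "0 < c * \<eta>1" using c \<eta>1 by simp
  ultimately show False using le0 by linarith
qed

text \<open>The slopes may differ arbitrarily close to p, so the density argument stops short of
  this point. It is enough that the modulus of the ratio of transforms is at least exp (- c) at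
  arbitrarily small heights above p, for every positive c.\<close>

lemma slope_measure_atom_le:
  assumes A: "real_distribution A" "\<And>z. 0 < Im z \<Longrightarrow> (\<integral>x. 1 / (z - of_real x) \<partial>A) = slope_transform s1 z"
    and N: "real_distribution N" "\<And>z. 0 < Im z \<Longrightarrow> (\<integral>x. 1 / (z - of_real x) \<partial>N) = slope_transform s2 z"
    and s: "admissible s1" "admissible s2"
    and supp: "\<And>w. s1 w \<noteq> s2 w \<Longrightarrow> a \<le> w \<and> w < p" and ap: "a \<le> p"
    and F: "\<And>c. a \<le> c \<Longrightarrow> c \<le> p \<Longrightarrow> 0 \<le> integral {a..c} (\<lambda>w. (s1 w - s2 w) / 2)"
      "integral {a..p} (\<lambda>w. (s1 w - s2 w) / 2) = 0"
  shows "measure N {p} \<le> measure A {p}"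
proof -
  define r where "r w = (s1 w - s2 w) / 2" for w
  have r: "bounded_slope r" unfolding r_def by (rule bounded_slope_half_diff[OF s])
  have key: "exp (- c) * measure N {p} \<le> measure A {p}" if c: "0 < c" for c
  proof -
    \<comment> \<open>One good height below each 1/(n+1) suffices: the limits that yield the atoms
      exist along every sequence of heights tending to 0.\<close>
    have "\<exists>\<eta>. 0 < \<eta> \<and> \<eta> < 1 / real (Suc n) \<and> Re (cauchy_int r (Complex p \<eta>)) < c" for n
    proof (rule Re_cauchy_int_small[OF r _ _ _ ap c])
      show "a \<le> w \<and> w < p" if "r w \<noteq> 0" for w using supp that by (auto simp: r_def)
    qed (use F in \<open>auto simp: r_def[abs_def]\<close>)
    then obtain \<eta> where \<eta>: "\<And>n. 0 < \<eta> n" "\<And>n. \<eta> n < 1 / real (Suc n)" "\<And>n. Re (cauchy_int r (Complex p (\<eta> n))) < c"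
      by metis
    have lim: "\<eta> \<longlonglongrightarrow> 0"
    proof (rule tendsto_sandwich[of "\<lambda>_. 0" _ _ "\<lambda>n. 1 / real (Suc n)"])
      show "\<forall>\<^sub>F n in sequentially. 0 \<le> \<eta> n" using \<eta>(1) by (auto intro!: always_eventually less_imp_le)
      show "\<forall>\<^sub>F n in sequentially. \<eta> n \<le> 1 / real (Suc n)" using \<eta>(2) by (intro always_eventually allI less_imp_le)
      show "(\<lambda>n. 1 / real (Suc n)) \<longlonglongrightarrow> 0" by (rule LIMSEQ_Suc[OF lim_const_over_n])
    qed simp
    have "exp (- c) * (\<eta> n * norm (\<integral>x. 1 / (Complex p (\<eta> n) - of_real x) \<partial>N)) \<le> \<eta> n * norm (\<integral>x. 1 / (Complex p (\<eta> n) - of_real x) \<partial>A)" for n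
    proof -
      have Im: "0 < Im (Complex p (\<eta> n))" using \<eta>(1) by simp
      have "norm (\<integral>x. 1 / (Complex p (\<eta> n) - of_real x) \<partial>A) =
          norm (\<integral>x. 1 / (Complex p (\<eta> n) - of_real x) \<partial>N) * exp (- Re (cauchy_int r (Complex p (\<eta> n))))"
        unfolding A(2)[OF Im] N(2)[OF Im] slope_transform_ratio[OF s Im] r_def[abs_def] norm_mult norm_exp_eq_Re by simp
      also have "\<dots> \<ge> norm (\<integral>x. 1 / (Complex p (\<eta> n) - of_real x) \<partial>N) * exp (- c)"
        using \<eta>(3)[of n] by (intro mult_left_mono) auto
      finally have "\<eta> n * (norm (\<integral>x. 1 / (Complex p (\<eta> n) - of_real x) \<partial>N) * exp (- c)) \<le> \<eta> n * norm (\<integral>x. 1 / (Complex p (\<eta> n) - of_real x) \<partial>A)"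
        using \<eta>(1)[of n] by (intro mult_left_mono) auto
      then show ?thesis by (simp only: mult.commute mult.left_commute)
    qed
    moreover have "(\<lambda>n. exp (- c) * (\<eta> n * norm (\<integral>x. 1 / (Complex p (\<eta> n) - of_real x) \<partial>N))) \<longlonglongrightarrow> exp (- c) * measure N {p}"
      by (intro tendsto_mult_left cauchy_transform_atom[OF N(1) \<eta>(1) lim])
    ultimately show ?thesis
      using cauchy_transform_atom[OF A(1) \<eta>(1) lim] LIMSEQ_le by blast
  qed
  have "((\<lambda>c. exp (- c) * measure N {p}) \<longlongrightarrow> exp (- 0) * measure N {p}) (at_right 0)"
    by (intro tendsto_intros)
  moreover have "\<forall>\<^sub>F c in at_right 0. exp (- c) * measure N {p} \<le> measure A {p}"
    using key eventually_at_right_less[of 0] by (auto elim: eventually_mono)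
  ultimately have "exp (- 0) * measure N {p} \<le> measure A {p}"
    by (intro tendsto_upperbound) auto
  then show ?thesis by simp
qed

section \<open>Continual diagrams\<close>

lemma continual_diagramE:
  assumes "continual_diagram \<omega>"
  obtains R where "0 < R" "\<And>z. R \<le> \<bar>z\<bar> \<Longrightarrow> \<omega> z = \<bar>z\<bar>"
proof -
  obtain R where "\<forall>z. R \<le> \<bar>z\<bar> \<longrightarrow> \<omega> z = \<bar>z\<bar>" using assms by (auto simp: continual_diagram_def)
  then show ?thesis by (intro that[of "max R 1"]) auto
qed

lemma continual_diagram_lipschitz:
  "continual_diagram \<omega> \<Longrightarrow> \<bar>\<omega> x - \<omega> y\<bar> \<le> \<bar>x - y\<bar>"
  by (simp add: continual_diagram_def)

lemma continual_diagram_continuous: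
  assumes "continual_diagram \<omega>"
  shows "continuous_on S \<omega>"
proof (rule lipschitz_on_continuous_on)
  show "1-lipschitz_on S \<omega>"
    using continual_diagram_lipschitz[OF assms] by (intro lipschitz_onI) (auto simp: dist_real_def)
qed

lemma continual_diagram_ge_abs:
  assumes w: "continual_diagram \<omega>"
  shows "\<bar>u\<bar> \<le> \<omega> u"
proof -
  obtain R where R: "0 < R" "\<And>z. R \<le> \<bar>z\<bar> \<Longrightarrow> \<omega> z = \<bar>z\<bar>" using continual_diagramE[OF w] by blast
  define Z where "Z = max R \<bar>u\<bar>"
  have "\<omega> Z = Z" "\<omega> (- Z) = Z" using R by (auto simp: Z_def)
  moreover have "\<bar>u\<bar> \<le> Z" by (simp add: Z_def)
  ultimately show ?thesis
    using continual_diagram_lipschitz[OF w, of Z u] continual_diagram_lipschitz[OF w, of "-Z" u] by linarith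
qed

text \<open>Since \<open>infdist\<close> to the empty set is 0 by convention, a bound on
  \<open>hausd\<close> yields a nearby point only for nonempty closed sections. The coordinate x =
  (\<omega>(v) + v)/2 takes every nonnegative value by the intermediate value theorem.\<close>

lemma PiY_nonempty:
  assumes w: "continual_diagram \<omega>" and x: "0 \<le> x"
  shows "PiY \<omega> x \<noteq> {}"
proof -
  obtain R where R: "0 < R" "\<And>z. R \<le> \<bar>z\<bar> \<Longrightarrow> \<omega> z = \<bar>z\<bar>" using continual_diagramE[OF w] by blast
  define Z where "Z = max R x"
  have Z: "\<omega> Z = Z" "\<omega> (- Z) = Z" "0 < Z" "x \<le> Z" using R x by (auto simp: Z_def)
  have "\<exists>v. - Z \<le> v \<and> v \<le> Z \<and> \<omega> v + v = 2 * x"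
    by (rule IVT') (use Z x in \<open>auto intro!: continuous_intros continual_diagram_continuous[OF w]\<close>)
  then obtain v where v: "\<omega> v + v = 2 * x" by blast
  have "x - v \<in> PiY \<omega> x"
    using v continual_diagram_ge_abs[OF w, of v] by (auto simp: PiY_def)
  then show ?thesis by blast
qed

lemma PiX_nonempty:
  assumes w: "continual_diagram \<omega>" and y: "0 \<le> y"
  shows "PiX \<omega> y \<noteq> {}"
proof -
  obtain R where R: "0 < R" "\<And>z. R \<le> \<bar>z\<bar> \<Longrightarrow> \<omega> z = \<bar>z\<bar>" using continual_diagramE[OF w] by blast
  define Z where "Z = max R y"
  have Z: "\<omega> Z = Z" "\<omega> (- Z) = Z" "0 < Z" "y \<le> Z" using R y by (auto simp: Z_def)
  have "\<exists>v. - Z \<le> v \<and> v \<le> Z \<and> \<omega> v - v = 2 * y"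
    by (rule IVT2') (use Z y in \<open>auto intro!: continuous_intros continual_diagram_continuous[OF w]\<close>)
  then obtain v where v: "\<omega> v - v = 2 * y" by blast
  have "v + y \<in> PiX \<omega> y"
    using v continual_diagram_ge_abs[OF w, of v] by (auto simp: PiX_def)
  then show ?thesis by blast
qed

lemma closed_PiY: "continual_diagram \<omega> \<Longrightarrow> closed (PiY \<omega> x)"
  unfolding PiY_def
  by (intro closed_Collect_conj closed_Collect_le closed_Collect_eq continuous_intros
      continuous_on_compose2[OF continual_diagram_continuous[of \<omega> UNIV]]) auto

lemma closed_PiX: "continual_diagram \<omega> \<Longrightarrow> closed (PiX \<omega> y)"
  unfolding PiX_def
  by (intro closed_Collect_conj closed_Collect_le closed_Collect_eq continuous_intros
      continuous_on_compose2[OF continual_diagram_continuous[of \<omega> UNIV]]) auto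

lemma hausd_infdist_le:
  assumes "hausd A B \<le> ereal e" "b \<in> B"
  shows "infdist b A \<le> e"
proof -
  have "ereal (infdist b A) \<le> (SUP b\<in>B. ereal (infdist b A))" using assms(2) by (rule SUP_upper)
  also have "\<dots> \<le> hausd A B" by (simp add: hausd_def)
  finally show ?thesis using assms(1) by (meson ereal_less_eq(3) order_trans)
qed

text \<open>The point (x, y) of \<open>\<omega>\<close> above u has a point of
  \<open>\<Omega>\<close> within \<epsilon> on the same vertical line and another on the same
  horizontal line. A vertical displacement by \<delta> gives \<Omega>(u - \<delta>) = \<omega>(u) +
  \<delta>, and the Lipschitz bound from u - \<delta> to u - \<epsilon> costs \<epsilon> - \<delta>,
  so \<delta> cancels and the lower bound results. Horizontal displacements give the upper bound in
  the same way.\<close>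

lemma ddist_bounds:
  assumes W: "continual_diagram \<Omega>" and w: "continual_diagram \<omega>" and d: "ddist \<Omega> \<omega> \<le> ereal \<epsilon>"
  shows "\<Omega> (u - \<epsilon>) - \<epsilon> \<le> \<omega> u" "\<omega> u \<le> \<Omega> (u - \<epsilon>) + \<epsilon>"
proof -
  define x y where "x = (\<omega> u + u) / 2" and "y = (\<omega> u - u) / 2"
  have xy: "0 \<le> x" "0 \<le> y" "x - y = u" "x + y = \<omega> u"
    using continual_diagram_ge_abs[OF w, of u] by (auto simp: x_def y_def field_simps)
  have "hausd (PiY \<Omega> x) (PiY \<omega> x) \<le> dY \<Omega> \<omega>" unfolding dY_def using xy by (intro SUP_upper) auto
  then have hY: "hausd (PiY \<Omega> x) (PiY \<omega> x) \<le> ereal \<epsilon>" using d unfolding ddist_def by (meson max.bounded_iff order_trans)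
  have "y \<in> PiY \<omega> x" using xy by (auto simp: PiY_def)
  then have i1: "infdist y (PiY \<Omega> x) \<le> \<epsilon>" by (rule hausd_infdist_le[OF hY])
  obtain y' where y': "y' \<in> PiY \<Omega> x" "infdist y (PiY \<Omega> x) = dist y y'"
    using infdist_attains_inf[OF closed_PiY[OF W] PiY_nonempty[OF W xy(1)]] by blast
  then have "\<bar>y - y'\<bar> \<le> \<epsilon>" "\<Omega> (x - y') = x + y'" using i1 by (auto simp: dist_real_def PiY_def)
  then show "\<Omega> (u - \<epsilon>) - \<epsilon> \<le> \<omega> u"
    using continual_diagram_lipschitz[OF W, of "u - \<epsilon>" "x - y'"] xy by linarith
  have "hausd (PiX \<Omega> y) (PiX \<omega> y) \<le> dX \<Omega> \<omega>" unfolding dX_def using xy by (intro SUP_upper) auto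
  then have hX: "hausd (PiX \<Omega> y) (PiX \<omega> y) \<le> ereal \<epsilon>" using d unfolding ddist_def by (meson max.bounded_iff order_trans)
  have "x \<in> PiX \<omega> y" using xy by (auto simp: PiX_def)
  then have i2: "infdist x (PiX \<Omega> y) \<le> \<epsilon>" by (rule hausd_infdist_le[OF hX])
  obtain x' where x': "x' \<in> PiX \<Omega> y" "infdist x (PiX \<Omega> y) = dist x x'"
    using infdist_attains_inf[OF closed_PiX[OF W] PiX_nonempty[OF W xy(2)]] by blast
  then have "\<bar>x - x'\<bar> \<le> \<epsilon>" "\<Omega> (x' - y) = x' + y" using i2 by (auto simp: dist_real_def PiX_def)
  then show "\<omega> u \<le> \<Omega> (u - \<epsilon>) + \<epsilon>"
    using continual_diagram_lipschitz[OF W, of "u - \<epsilon>" "x' - y"] xy by linarith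
qed

section \<open>The slope of a continual diagram\<close>

lemma has_real_derivative_abs:
  fixes x :: real
  assumes "x \<noteq> 0"
  shows "((\<lambda>x. \<bar>x\<bar>) has_real_derivative sgn x) (at x)"
proof (cases "0 < x")
  case True
  have "((\<lambda>x. x) has_real_derivative 1) (at x)" by simp
  then have "((\<lambda>x. \<bar>x\<bar>) has_real_derivative 1) (at x)"
    by (rule has_field_derivative_transform_within_open[where S="{0<..}"]) (use True in auto)
  then show ?thesis using True by simp
next
  case False
  have "((\<lambda>x. - x) has_real_derivative - 1) (at x)" by (auto intro!: derivative_eq_intros)
  then have "((\<lambda>x. \<bar>x\<bar>) has_real_derivative - 1) (at x)"
    by (rule has_field_derivative_transform_within_open[where S="{..<0}"]) (use False assms in auto)
  then show ?thesis using False assms by simp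
qed

lemma lipschitz_derivative_le:
  fixes f :: "real \<Rightarrow> real"
  assumes "\<And>x y. \<bar>f x - f y\<bar> \<le> \<bar>x - y\<bar>" "(f has_real_derivative D) (at x)"
  shows "\<bar>D\<bar> \<le> 1"
proof (rule tendsto_upperbound)
  show "((\<lambda>y. \<bar>(f y - f x) / (y - x)\<bar>) \<longlongrightarrow> \<bar>D\<bar>) (at x)"
    using assms(2) unfolding has_field_derivative_iff by (rule tendsto_rabs)
  show "\<forall>\<^sub>F y in at x. \<bar>(f y - f x) / (y - x)\<bar> \<le> 1"
    unfolding eventually_at_filter
    by (intro always_eventually allI impI) (use assms(1) in \<open>auto simp: divide_le_eq\<close>)
qed simp

text \<open>The definition of a transition measure uses \<open>deriv\<close>, which is meaningful
  only where the derivative exists. The slope is a Borel version that obeys the bounds of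
  \<open>admissible\<close> at every point and still has the diagram as its indefinite
  integral.\<close>

lemma continual_diagram_slope:
  assumes w: "continual_diagram \<omega>"
  obtains s where "admissible s" "\<And>a b. a \<le> b \<Longrightarrow> (s has_integral (\<omega> b - \<omega> a)) {a..b}"
    "AE w in lebesgue. deriv (\<lambda>v. (\<omega> v - \<bar>v\<bar>) / 2) w = (s w - sgn w) / 2"
proof -
  obtain R where R: "0 < R" "\<And>z. R \<le> \<bar>z\<bar> \<Longrightarrow> \<omega> z = \<bar>z\<bar>" using continual_diagramE[OF w] by blast
  have lip: "\<bar>\<omega> x - \<omega> y\<bar> \<le> \<bar>x - y\<bar>" for x y by (rule continual_diagram_lipschitz[OF w])
  \<comment> \<open>Adding the identity makes the diagram nondecreasing with increments at most
    twice those of the argument; the extra slope 1 is removed in \<open>s1\<close>.\<close>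
  have "\<exists>s. s \<in> borel_measurable borel \<and> (\<forall>a b. a \<le> b \<longrightarrow> (s has_integral ((\<omega> b + b) - (\<omega> a + a))) {a..b})"
  proof (rule mono_lipschitz_has_integral_density[where C=2])
    fix x y :: real assume "x \<le> y"
    then show "\<omega> x + x \<le> \<omega> y + y" "\<omega> y + y - (\<omega> x + x) \<le> 2 * (y - x)"
      using lip[of x y] by auto
  qed
  then obtain s0 where s0 [measurable]: "s0 \<in> borel_measurable borel"
    and s0i: "\<And>a b. a \<le> b \<Longrightarrow> (s0 has_integral ((\<omega> b + b) - (\<omega> a + a))) {a..b}" by blast
  define s1 where "s1 w = s0 w - 1" for w
  have s1i: "(s1 has_integral (\<omega> b - \<omega> a)) {a..b}" if ab: "a \<le> b" for a b
  proof -
    have "((\<lambda>w. 1::real) has_integral (b - a)) {a..b}" using has_integral_const_real[of "1::real" a b] ab by simp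
    from has_integral_diff[OF s0i[OF ab] this] show ?thesis by (simp add: s1_def[abs_def])
  qed
  define N where "N = insert 0 {x. \<not> (\<omega> has_real_derivative s1 x) (at x)}"
  have N: "negligible N"
    unfolding N_def negligible_insert by (rule negligible_not_has_derivative_indefinite_integral[OF s1i])
  \<comment> \<open>Clipping and prescribing the sign far out change \<open>s1\<close> only on the
    null set \<open>N\<close>. The margin R + 1 puts these points inside the open set R < |x|, where
    the diagram is |x|.\<close>
  define s where "s w = (if R + 1 \<le> \<bar>w\<bar> then sgn w else if \<bar>s1 w\<bar> \<le> 1 then s1 w else 0)" for w
  have [measurable]: "s1 \<in> borel_measurable borel" unfolding s1_def[abs_def] by measurable
  have smeas: "s \<in> borel_measurable borel" unfolding s_def[abs_def] by measurable
  have adm: "admissible s" unfolding admissible_def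
    using smeas by (auto simp: s_def sgn_real_def intro!: exI[of _ "R + 1"])
  have ss1: "s w = s1 w" if "w \<notin> N" for w
  proof -
    have d: "(\<omega> has_real_derivative s1 w) (at w)" "w \<noteq> 0" using that by (auto simp: N_def)
    have "s1 w = sgn w" if wR: "R + 1 \<le> \<bar>w\<bar>"
    proof -
      have "((\<lambda>x. \<bar>x\<bar>) has_real_derivative s1 w) (at w)"
        using d(1)
      proof (rule has_field_derivative_transform_within_open[where S="{x. R < \<bar>x\<bar>}"])
        show "open {x. R < \<bar>x\<bar>}" by (intro open_Collect_less continuous_intros)
      qed (use wR R in auto)
      then show ?thesis using has_real_derivative_abs[OF d(2)] DERIV_unique by blast
    qed
    moreover have "\<bar>s1 w\<bar> \<le> 1" by (rule lipschitz_derivative_le[OF lip d(1)])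
    ultimately show ?thesis by (simp add: s_def)
  qed
  have "(s has_integral (\<omega> b - \<omega> a)) {a..b}" if "a \<le> b" for a b
    by (rule has_integral_spike[OF N _ s1i[OF that]]) (simp add: ss1)
  moreover have "AE w in lebesgue. deriv (\<lambda>v. (\<omega> v - \<bar>v\<bar>) / 2) w = (s w - sgn w) / 2"
  proof -
    have "AE w in lebesgue. w \<notin> N" using N by (simp add: negligible_iff_null_sets AE_not_in)
    then show ?thesis
    proof eventually_elim
      case (elim w)
      then have d: "(\<omega> has_real_derivative s1 w) (at w)" "w \<noteq> 0" by (auto simp: N_def)
      have "((\<lambda>v. (\<omega> v - \<bar>v\<bar>) / 2) has_real_derivative (s1 w - sgn w) / 2) (at w)"
        by (intro DERIV_cdivide DERIV_diff d has_real_derivative_abs)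
      then show ?case using ss1[OF elim] by (simp add: DERIV_imp_deriv)
    qed
  qed
  ultimately show ?thesis using that adm by blast
qed

text \<open>Replaces \<open>deriv\<close> by the Borel slope, which agrees with it almost
  everywhere, and the completed measure by \<open>lborel\<close>, so that everything proved for
  admissible slopes applies.\<close>

lemma transition_measure_slope_transform:
  assumes t: "is_transition_measure \<omega> \<mu>" and s: "admissible s"
    and ae: "AE w in lebesgue. deriv (\<lambda>v. (\<omega> v - \<bar>v\<bar>) / 2) w = (s w - sgn w) / 2"
  shows "real_distribution \<mu>" "\<And>z. 0 < Im z \<Longrightarrow> (\<integral>x. 1 / (z - of_real x) \<partial>\<mu>) = slope_transform s z"
proof -
  show "real_distribution \<mu>"
    using t by (simp add: is_transition_measure_def real_distribution_def real_distribution_axioms_def)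
  fix z :: complex assume z: "0 < Im z"
  have [measurable]: "s \<in> borel_measurable borel" using s by (simp add: admissible_def)
  let ?f = "\<lambda>w. (1 / (z - of_real w)) * of_real (deriv (\<lambda>v. (\<omega> v - \<bar>v\<bar>) / 2) w)"
  let ?g = "\<lambda>w. of_real ((s w - sgn w) / 2) / (z - of_real w)"
  have gm: "?g \<in> borel_measurable lborel" by measurable
  have gm': "?g \<in> borel_measurable lebesgue" by (rule measurable_completion[OF gm])
  have aeq: "AE w in lebesgue. ?g w = ?f w" using ae
  proof eventually_elim
    case (elim w)
    show ?case unfolding elim by (simp only: times_divide_eq_left mult_1)
  qed
  have fm: "?f \<in> borel_measurable lebesgue" by (rule borel_measurable_AE[OF gm' aeq])
  have "(\<integral>w. ?f w \<partial>lebesgue) = (\<integral>w. ?g w \<partial>lebesgue)"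
    using aeq by (intro integral_cong_AE[OF fm gm']) (erule eventually_mono, erule sym)
  also have "\<dots> = cauchy_int (\<lambda>w. (s w - sgn w) / 2) z"
    unfolding cauchy_int_def by (rule integral_completion[OF gm])
  finally have ci: "(\<integral>w. ?f w \<partial>lebesgue) = cauchy_int (\<lambda>w. (s w - sgn w) / 2) z" .
  have "Im z \<noteq> 0 \<longrightarrow> z * (\<integral>x. 1 / (z - of_real x) \<partial>\<mu>) = exp (- (\<integral>w. ?f w \<partial>lebesgue))"
    using t unfolding is_transition_measure_def by blast
  then have zG: "z * (\<integral>x. 1 / (z - of_real x) \<partial>\<mu>) = exp (- cauchy_int (\<lambda>w. (s w - sgn w) / 2) z)"
    using z unfolding ci by simp
  have "z \<noteq> 0" using z by auto
  then have "(\<integral>x. 1 / (z - of_real x) \<partial>\<mu>) = 1 / z * (z * (\<integral>x. 1 / (z - of_real x) \<partial>\<mu>))" by simp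
  then show "(\<integral>x. 1 / (z - of_real x) \<partial>\<mu>) = slope_transform s z"
    unfolding slope_transform_def zG .
qed

section \<open>The extremal diagram\<close>

lemma integrable_real_cauchy_kernel:
  fixes t :: real
  assumes r: "bounded_slope r" and d: "0 < \<delta>" "\<And>w. r w \<noteq> 0 \<Longrightarrow> \<delta> \<le> \<bar>t - w\<bar>"
  shows "integrable lborel (\<lambda>w. r w / (t - w))"
proof -
  have "\<delta> \<le> norm (complex_of_real t - of_real w)" if "r w \<noteq> 0" for w
    using d(2)[OF that] by (metis norm_of_real of_real_diff)
  from cauchy_int_integrable[OF r d(1) this]
  have "integrable lborel (\<lambda>w. Re (of_real (r w) / (complex_of_real t - of_real w)))" by (rule integrable_Re)
  moreover have "Re (of_real (r w) / (complex_of_real t - of_real w)) = r w / (t - w)" for w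
    by (metis Re_complex_of_real of_real_diff of_real_divide)
  ultimately show ?thesis by simp
qed

text \<open>On an interval that misses t the kernel 1/(t - w) is nondecreasing in w whichever side t
  lies on, so one condition on the primitive serves both sides. In the comparisons at the crossing
  point this primitive is, up to sign, half the difference of two diagrams.\<close>

lemma cauchy_kernel_integral_nonpos:
  fixes t :: real
  assumes r: "bounded_slope r" and ab: "a \<le> b" and supp: "\<And>w. w \<notin> {a..b} \<Longrightarrow> r w = 0"
    and F: "\<And>c. a \<le> c \<Longrightarrow> c \<le> b \<Longrightarrow> 0 \<le> integral {a..c} r" "integral {a..b} r = 0"
    and t: "t \<notin> {a..b}"
  shows "(\<integral>w. r w / (t - w) \<partial>lborel) \<le> 0"
proof -
  define \<delta> where "\<delta> = (if t < a then a - t else t - b)"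
  have \<delta>: "0 < \<delta>" "\<And>w. w \<in> {a..b} \<Longrightarrow> \<delta> \<le> \<bar>t - w\<bar>" using t by (auto simp: \<delta>_def)
  have "(\<integral>w. r w * (1 / (t - w)) \<partial>lborel) \<le> 0"
  proof (rule integral_mono_kernel_nonpos[OF ab _ supp _ F])
    show "r integrable_on {a..b}"
      using has_integral_integral_lborel[OF bounded_slope_integrable[OF r]] integrable_on_subinterval[of r UNIV a b]
      by (auto simp: integrable_on_def)
    show "1 / (t - x) \<le> 1 / (t - y)" if "a \<le> x" "x \<le> y" "y \<le> b" for x y
    proof (cases "t < a")
      case True
      then have "0 < (t - x) * (t - y)" using that by (intro mult_neg_neg) auto
      then show ?thesis using that by (intro divide_left_mono) auto
    next
      case False
      then have "0 < (t - x) * (t - y)" using that t by (intro mult_pos_pos) auto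
      then show ?thesis using that by (intro divide_left_mono) auto
    qed
    have "\<delta> \<le> \<bar>t - w\<bar>" if "r w \<noteq> 0" for w using \<delta>(2) supp that by blast
    from integrable_real_cauchy_kernel[OF r \<delta>(1) this]
    show "integrable lborel (\<lambda>w. r w * (1 / (t - w)))" by simp
  qed
  then show ?thesis by simp
qed

text \<open>Among densities \<open>0 \<le> r \<le> 1\<close> of total mass \<open>\<epsilon>\<close>, the potential at \<open>t\<close>
is largest when the mass is packed against \<open>b\<close>.\<close>

lemma integral_inverse_le_log:
  fixes t :: real
  assumes r: "bounded_slope r" "\<And>w. 0 \<le> r w" and ab: "a \<le> b - \<epsilon>" and supp: "\<And>w. w \<notin> {a..b} \<Longrightarrow> r w = 0"
    and mass: "integral {a..b} r = \<epsilon>" and \<epsilon>: "0 < \<epsilon>" and t: "b < t"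
  shows "(\<integral>w. r w / (t - w) \<partial>lborel) \<le> ln (t - b + \<epsilon>) - ln (t - b)"
proof -
  \<comment> \<open>\<open>v\<close> compares \<open>r\<close> with the same mass packed on
    [b - \<epsilon>, b]. Since r \<le> 1, at most b - c of the mass lies right of c, so the
    primitive of \<open>v\<close> is nonnegative.\<close>
  define v where "v w = r w - indicator {b - \<epsilon>..b} w" for w
  have r1: "r w \<le> 1" for w using r(1) by (auto simp: bounded_slope_def abs_le_iff)
  have rm [measurable]: "r \<in> borel_measurable borel" using r(1) by (simp add: bounded_slope_def)
  obtain m where m: "\<And>w. m \<le> \<bar>w\<bar> \<Longrightarrow> r w = 0" using r(1) by (auto simp: bounded_slope_def)
  have v: "bounded_slope v"
    unfolding bounded_slope_def
  proof (intro conjI allI exI impI)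
    show "v \<in> borel_measurable borel" unfolding v_def[abs_def] by measurable
    show "\<bar>v w\<bar> \<le> 1" for w using r(2)[of w] r1[of w] by (auto simp: v_def indicator_def)
    show "v w = 0" if "max m (max \<bar>b - \<epsilon>\<bar> \<bar>b\<bar> + 1) \<le> \<bar>w\<bar>" for w
      using m[of w] that by (auto simp: v_def indicator_def)
  qed
  have ri: "r integrable_on {x..y}" for x y
    using has_integral_integral_lborel[OF bounded_slope_integrable[OF r(1)]] integrable_on_subinterval[of r UNIV x y]
    by (auto simp: integrable_on_def)
  have rnn: "0 \<le> integral {x..y} r" for x y using r(2) ri by (intro Henstock_Kurzweil_Integration.integral_nonneg) auto
  have iv: "integral {a..c} v = integral {a..c} r - max 0 (c - (b - \<epsilon>))" if "a \<le> c" "c \<le> b" for c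
  proof -
    have "(indicat_real {b - \<epsilon>..b} has_integral max 0 (c - (b - \<epsilon>))) {a..c}"
    proof (cases "c \<le> b - \<epsilon>")
      case True
      have "((\<lambda>_. 0::real) has_integral 0) {a..c}" by simp
      then have "(indicat_real {b - \<epsilon>..b} has_integral 0) {a..c}"
        by (rule has_integral_spike_finite[where S="{b - \<epsilon>}", rotated 2]) (use True in \<open>auto simp: indicator_def\<close>)
      then show ?thesis using True by simp
    next
      case False
      have "((\<lambda>_. 1::real) has_integral (c - (b - \<epsilon>))) {b - \<epsilon>..c}"
        using has_integral_const_real[of "1::real" "b - \<epsilon>" c] False by simp
      then have 1: "(indicat_real {b - \<epsilon>..b} has_integral (c - (b - \<epsilon>))) {b - \<epsilon>..c}"
        by (rule has_integral_eq[rotated]) (use that in \<open>auto simp: indicator_def\<close>)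
      have "((\<lambda>_. 0::real) has_integral 0) {a..b - \<epsilon>}" by simp
      then have 2: "(indicat_real {b - \<epsilon>..b} has_integral 0) {a..b - \<epsilon>}"
        by (rule has_integral_spike_finite[where S="{b - \<epsilon>}", rotated 2]) (auto simp: indicator_def)
      from has_integral_combine[OF _ _ 2 1] ab False show ?thesis by simp
    qed
    from has_integral_diff[OF integrable_integral[OF ri] this] show ?thesis
      unfolding v_def[abs_def] by (rule integral_unique)
  qed
  have le: "(\<integral>w. v w / (t - w) \<partial>lborel) \<le> 0"
  proof (rule cauchy_kernel_integral_nonpos[OF v])
    show "a \<le> b" using ab \<epsilon> by simp
    show "v w = 0" if "w \<notin> {a..b}" for w using supp[OF that] that ab by (auto simp: v_def indicator_def)
    show "integral {a..b} v = 0" using iv[of b] ab \<epsilon> mass by simp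
    show "t \<notin> {a..b}" using t by simp
    fix c assume c: "a \<le> c" "c \<le> b"
    have "integral {a..c} r + integral {c..b} r = \<epsilon>"
      using Henstock_Kurzweil_Integration.integral_combine[OF c ri] mass by simp
    moreover have "integral {c..b} r \<le> b - c"
      using integral_le[OF ri[of c b], of "\<lambda>_. 1"] r1 c by (auto simp: integrable_const_ivl)
    ultimately show "0 \<le> integral {a..c} v" unfolding iv[OF c] using rnn[of a c] by (auto simp: max_def)
  qed
  have aw: "t - b \<le> \<bar>t - w\<bar>" if "w \<in> {a..b}" for w using that t by auto
  have tb: "0 < t - b" using t by simp
  have i1: "integrable lborel (\<lambda>w. r w / (t - w))"
    by (rule integrable_real_cauchy_kernel[OF r(1) tb]) (use aw supp in blast)
  have hb: "has_bochner_integral lborel (\<lambda>w. 1 / (t - w) * indicator {b - \<epsilon>..b} w) (- ln (t - b) - (- ln (t - (b - \<epsilon>))))"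
  proof (rule has_bochner_integral_FTC_Icc_real)
    fix x assume "b - \<epsilon> \<le> x" "x \<le> b"
    then have x: "0 < t - x" using t by simp
    show "((\<lambda>w. - ln (t - w)) has_real_derivative 1 / (t - x)) (at x)"
      using x by (auto intro!: derivative_eq_intros simp: field_simps)
    show "isCont (\<lambda>w. 1 / (t - w)) x" using x by (intro continuous_intros) auto
  qed (use \<epsilon> in simp)
  have eqi: "1 / (t - w) * indicator {b - \<epsilon>..b} w = indicator {b - \<epsilon>..b} w / (t - w)" for w :: real by simp
  have i2: "integrable lborel (\<lambda>w. indicator {b - \<epsilon>..b} w / (t - w))"
    and e2: "(\<integral>w. indicator {b - \<epsilon>..b} w / (t - w) \<partial>lborel) = ln (t - b + \<epsilon>) - ln (t - b)"
    using hb unfolding eqi has_bochner_integral_iff by (auto simp: algebra_simps)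
  have "(\<integral>w. v w / (t - w) \<partial>lborel) = (\<integral>w. r w / (t - w) \<partial>lborel) - (\<integral>w. indicator {b - \<epsilon>..b} w / (t - w) \<partial>lborel)"
    unfolding v_def diff_divide_distrib by (rule Bochner_Integration.integral_diff[OF i1 i2])
  then show ?thesis using le e2 by linarith
qed

lemma has_integral_piecewise:
  fixes f s :: "real \<Rightarrow> real"
  assumes ab: "a \<le> b" and cd: "c \<le> d"
    and 1: "\<And>a b. a \<le> b \<Longrightarrow> b \<le> c \<Longrightarrow> (s has_integral (f b - f a)) {a..b}"
    and 2: "\<And>a b. c \<le> a \<Longrightarrow> a \<le> b \<Longrightarrow> b \<le> d \<Longrightarrow> (s has_integral (f b - f a)) {a..b}"
    and 3: "\<And>a b. d \<le> a \<Longrightarrow> a \<le> b \<Longrightarrow> (s has_integral (f b - f a)) {a..b}"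
  shows "(s has_integral (f b - f a)) {a..b}"
proof -
  \<comment> \<open>The break points c and d are clamped to [a, b]; pieces that fall outside become
    degenerate intervals.\<close>
  define x y where "x = max a (min c b)" and "y = max a (min d b)"
  have o: "a \<le> x" "x \<le> y" "y \<le> b" using ab cd by (auto simp: x_def y_def)
  have refl: "(s has_integral (f u - f u)) {u..u}" for u using has_integral_refl(1)[of s u] by simp
  have "(s has_integral (f x - f a)) {a..x}"
  proof (cases "a \<le> c")
    case True then show ?thesis using o ab by (intro 1) (auto simp: x_def)
  next
    case False then have "x = a" using ab by (auto simp: x_def)
    then show ?thesis using refl by simp
  qed
  moreover have "(s has_integral (f y - f x)) {x..y}"
  proof (cases "x = y")
    case True then show ?thesis using refl by simp
  next
    case False then show ?thesis using o ab cd by (intro 2) (auto simp: x_def y_def max_def min_def split: if_splits)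
  qed
  moreover have "(s has_integral (f b - f y)) {y..b}"
  proof (cases "d \<le> b")
    case True then show ?thesis using o ab by (intro 3) (auto simp: y_def)
  next
    case False then have "y = b" using ab by (auto simp: y_def)
    then show ?thesis using refl by simp
  qed
  ultimately have "(s has_integral ((f x - f a) + ((f y - f x) + (f b - f y)))) {a..b}"
    using o by (intro has_integral_combine[of a x b] has_integral_combine[of x y b]) auto
  then show ?thesis by simp
qed

theorem theorem6p1:
  fixes \<Omega> \<omega> :: "real \<Rightarrow> real" and \<epsilon> z0 zmax :: real
    and \<mu>\<Omega> \<mu>\<omega> :: "real measure"
  assumes "continual_diagram \<Omega>" and "\<epsilon> > 0"
    and "\<Omega> (zmax - \<epsilon>) - \<Omega> (z0 - \<epsilon>) = zmax - z0 - 2 * \<epsilon>"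
    and "\<forall>z. \<Omega> (z - \<epsilon>) - \<Omega> (z0 - \<epsilon>) = z - z0 - 2 * \<epsilon> \<longrightarrow> z \<le> zmax"
    and "is_transition_measure \<Omega> \<mu>\<Omega>"
    and "continual_diagram \<omega>" and "ddist \<Omega> \<omega> \<le> ereal \<epsilon>"
    and "is_transition_measure \<omega> \<mu>\<omega>"
  shows "Lim (at_right 0) (\<lambda>\<tau>. Kfun \<mu>\<omega> (z0 - \<tau>))
           \<le> 1 - set_lebesgue_integral \<mu>\<Omega> {zmax - \<epsilon>..}
                   (\<lambda>z. 1 - \<epsilon> / (z + 2 * \<epsilon> - zmax))
       \<and> 1 - set_lebesgue_integral \<mu>\<Omega> {zmax - \<epsilon>..}
                   (\<lambda>z. 1 - \<epsilon> / (z + 2 * \<epsilon> - zmax))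
         = (\<integral>z. indicator {..<zmax - \<epsilon>} z
                 + indicator {zmax - \<epsilon>..} z * (\<epsilon> / (z + 2 * \<epsilon> - zmax)) \<partial>\<mu>\<Omega>)"
proof -
  note W = assms(1) and \<epsilon> = assms(2) and zm = assms(3) and w = assms(6)
  obtain s\<Omega> where s\<Omega>: "admissible s\<Omega>" "\<And>a b. a \<le> b \<Longrightarrow> (s\<Omega> has_integral (\<Omega> b - \<Omega> a)) {a..b}"
    "AE w in lebesgue. deriv (\<lambda>v. (\<Omega> v - \<bar>v\<bar>) / 2) w = (s\<Omega> w - sgn w) / 2"
    using continual_diagram_slope[OF W] by blast
  obtain s\<omega> where s\<omega>: "admissible s\<omega>" "\<And>a b. a \<le> b \<Longrightarrow> (s\<omega> has_integral (\<omega> b - \<omega> a)) {a..b}"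
    "AE w in lebesgue. deriv (\<lambda>v. (\<omega> v - \<bar>v\<bar>) / 2) w = (s\<omega> w - sgn w) / 2"
    using continual_diagram_slope[OF w] by blast
  note P = transition_measure_slope_transform[OF assms(5) s\<Omega>(1,3)]
  note A = transition_measure_slope_transform[OF assms(8) s\<omega>(1,3)]
  interpret P: real_distribution \<mu>\<Omega> by (rule P(1))
  interpret A: real_distribution \<mu>\<omega> by (rule A(1))

  \<comment> \<open>The reference diagram is \<open>\<Omega>\<close> moved right by \<epsilon>; its
    measure \<open>B\<close> is the translate of the given one.\<close>
  define s' where "s' x = s\<Omega> (x - \<epsilon>)" for x
  have s': "admissible s'" unfolding s'_def by (rule admissible_shift[OF s\<Omega>(1)])
  have s'i: "(s' has_integral (\<Omega> (b - \<epsilon>) - \<Omega> (a - \<epsilon>))) {a..b}" if "a \<le> b" for a b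
    using has_integral_shift_Icc_real[of s\<Omega> "-\<epsilon>" "\<Omega> (b - \<epsilon>) - \<Omega> (a - \<epsilon>)" a b] s\<Omega>(2)[of "a - \<epsilon>" "b - \<epsilon>"] that
    by (simp add: s'_def[abs_def] o_def)
  define B where "B = distr \<mu>\<Omega> borel (\<lambda>x. x + \<epsilon>)"
  have B: "real_distribution B" "\<And>z. 0 < Im z \<Longrightarrow> (\<integral>x. 1 / (z - of_real x) \<partial>B) = slope_transform s' z"
  proof -
    show "real_distribution B" unfolding B_def by (rule P.real_distribution_distr) simp
    fix z :: complex assume z: "0 < Im z"
    have "(\<integral>x. 1 / (z - of_real x) \<partial>B) = (\<integral>x. 1 / (z - of_real (x + \<epsilon>)) \<partial>\<mu>\<Omega>)"
      unfolding B_def by (rule integral_distr) auto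
    also have "\<dots> = (\<integral>x. 1 / ((z - of_real \<epsilon>) - of_real x) \<partial>\<mu>\<Omega>)" by (simp add: algebra_simps)
    also have "\<dots> = slope_transform s\<Omega> (z - of_real \<epsilon>)" using z by (intro P(2)) simp
    also have "\<dots> = slope_transform s' z"
      unfolding s'_def[abs_def] using slope_transform_shift[OF s\<Omega>(1) z] \<epsilon> by simp
    finally show "(\<integral>x. 1 / (z - of_real x) \<partial>B) = slope_transform s' z" .
  qed

  \<comment> \<open>This length makes room for packing mass \<epsilon> against \<open>zmax\<close>
    inside [z0, zmax].\<close>
  have zz: "z0 \<le> zmax - \<epsilon>"
    using continual_diagram_lipschitz[OF W, of "zmax - \<epsilon>" "z0 - \<epsilon>"] zm \<epsilon> by linarith

  define e where "e u = (if u \<le> z0 then \<Omega> (u - \<epsilon>) - \<epsilon> else if u \<le> zmax then \<Omega> (z0 - \<epsilon>) - \<epsilon> + (u - z0) else \<Omega> (u - \<epsilon>) + \<epsilon>)" for u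
  define se where "se x = (if z0 < x \<and> x < zmax then 1 else s' x)" for x
  have e1: "e u = \<Omega> (u - \<epsilon>) - \<epsilon>" if "u \<le> z0" for u using that by (simp add: e_def)
  have e2: "e u = \<Omega> (z0 - \<epsilon>) - \<epsilon> + (u - z0)" if "z0 \<le> u" "u \<le> zmax" for u using that by (simp add: e_def)
  \<comment> \<open>At \<open>zmax\<close> the line of slope 1 and the upper bound agree: this is
    exactly the equation satisfied by \<open>zmax\<close>.\<close>
  have e3: "e u = \<Omega> (u - \<epsilon>) + \<epsilon>" if "zmax \<le> u" for u
    using that zm zz \<epsilon> by (cases "u = zmax") (auto simp: e_def)
  have sei: "(se has_integral (e b - e a)) {a..b}" if "a \<le> b" for a b
  proof (rule has_integral_piecewise[OF that])
    show "z0 \<le> zmax" using zz \<epsilon> by simp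
    show "(se has_integral (e b - e a)) {a..b}" if "a \<le> b" "b \<le> z0" for a b
      by (rule has_integral_eq[rotated], use s'i[of a b] that in \<open>simp add: e1\<close>) (use that in \<open>auto simp: se_def\<close>)
    show "(se has_integral (e b - e a)) {a..b}" if "zmax \<le> a" "a \<le> b" for a b
      by (rule has_integral_eq[rotated], use s'i[of a b] that in \<open>simp add: e3\<close>) (use that in \<open>auto simp: se_def\<close>)
    fix a b assume ab: "z0 \<le> a" "a \<le> b" "b \<le> zmax"
    have "((\<lambda>_. 1::real) has_integral (b - a)) {a..b}"
      using has_integral_const_real[of "1::real" a b] ab by simp
    then have "(se has_integral (b - a)) {a..b}"
      by (rule has_integral_spike_finite[where S="{a, b}", rotated 2]) (use ab in \<open>auto simp: se_def\<close>)
    then show "(se has_integral (e b - e a)) {a..b}" using ab by (simp add: e2)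
  qed
  have se: "admissible se"
  proof -
    obtain m where m: "0 < m" "\<And>x. m \<le> \<bar>x\<bar> \<Longrightarrow> s' x = sgn x" using admissible_obtain[OF s'] by blast
    have [measurable]: "s' \<in> borel_measurable borel" using s' by (simp add: admissible_def)
    have "se x = sgn x" if "max m (max \<bar>z0\<bar> \<bar>zmax\<bar>) \<le> \<bar>x\<bar>" for x
      using m(2)[of x] that by (auto simp: se_def)
    moreover have "se \<in> borel_measurable borel" unfolding se_def[abs_def] by measurable
    moreover have "\<bar>se x\<bar> \<le> 1" for x using s' by (auto simp: se_def admissible_def)
    ultimately show ?thesis unfolding admissible_def by blast
  qed
  obtain X where X: "real_distribution X" "\<And>z. 0 < Im z \<Longrightarrow> (\<integral>x. 1 / (z - of_real x) \<partial>X) = slope_transform se z"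
    using slope_measure_exists[OF se] by blast
  interpret X: real_distribution X by (rule X(1))

  obtain R\<Omega> where R\<Omega>: "0 < R\<Omega>" "\<And>z. R\<Omega> \<le> \<bar>z\<bar> \<Longrightarrow> \<Omega> z = \<bar>z\<bar>" using continual_diagramE[OF W] by blast
  obtain R\<omega> where R\<omega>: "0 < R\<omega>" "\<And>z. R\<omega> \<le> \<bar>z\<bar> \<Longrightarrow> \<omega> z = \<bar>z\<bar>" using continual_diagramE[OF w] by blast
  obtain m1 where m1: "0 < m1" "\<And>x. m1 \<le> \<bar>x\<bar> \<Longrightarrow> s\<omega> x = sgn x" using admissible_obtain[OF s\<omega>(1)] by blast
  obtain m2 where m2: "0 < m2" "\<And>x. m2 \<le> \<bar>x\<bar> \<Longrightarrow> se x = sgn x" using admissible_obtain[OF se] by blast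
  define m where "m = R\<Omega> + R\<omega> + m1 + m2 + \<bar>z0\<bar> + \<bar>zmax\<bar> + \<epsilon>"
  have m: "0 < m" "- m < z0" "zmax < m" using R\<Omega> R\<omega> m1 m2 \<epsilon> by (auto simp: m_def)
  define D where "D u = \<omega> u - e u" for u
  \<comment> \<open>Far out the shift of \<open>\<Omega>\<close> by \<epsilon> is compensated by
    lowering on the left and raising on the right, so the extremal diagram coincides with |u| there,
    as \<open>\<omega>\<close> does.\<close>
  have Dm: "D (- m) = 0" "D m = 0"
  proof -
    have mb: "R\<Omega> \<le> m - \<epsilon>" "R\<omega> \<le> m" using \<epsilon> R\<Omega>(1) R\<omega>(1) m1(1) m2(1) by (auto simp: m_def)
    have "\<Omega> (- m - \<epsilon>) = m + \<epsilon>" using R\<Omega>(2)[of "- m - \<epsilon>"] mb m(1) \<epsilon> by simp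
    moreover have "\<Omega> (m - \<epsilon>) = m - \<epsilon>" using R\<Omega>(2)[of "m - \<epsilon>"] mb R\<Omega>(1) by simp
    moreover have "\<omega> m = m" "\<omega> (- m) = m" using R\<omega>(2)[of m] R\<omega>(2)[of "- m"] mb m(1) by auto
    ultimately show "D (- m) = 0" "D m = 0" using m by (auto simp: D_def e1 e3)
  qed
  have eqm: "s\<omega> x = se x" if "m \<le> \<bar>x\<bar>" for x
  proof -
    have "m1 \<le> m" "m2 \<le> m" using R\<Omega>(1) R\<omega>(1) m1(1) m2(1) \<epsilon> by (auto simp: m_def)
    then show ?thesis using m1(2)[of x] m2(2)[of x] that by simp
  qed
  have Di: "((\<lambda>x. (s\<omega> x - se x) / 2) has_integral ((D b - D a) / 2)) {a..b}" if "a \<le> b" for a b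
    using has_integral_divide[OF has_integral_diff[OF s\<omega>(2)[OF that] sei[OF that]], of 2] by (simp add: D_def algebra_simps)
  note bd = ddist_bounds[OF W w assms(7)]
  have Dl: "0 \<le> D u" if "u \<le> z0" for u using bd(1)[of u] that by (simp add: D_def e1)
  have Dr: "D u \<le> 0" if "zmax \<le> u" for u using bd(2)[of u] that by (simp add: D_def e3)
  \<comment> \<open>On this stretch the extremal slope is 1, the largest possible, so
    \<open>\<omega>\<close> can only lose height against it. Hence the sign of D changes once, at
    the crossing point.\<close>
  have Dmono: "D v \<le> D u" if "z0 \<le> u" "u \<le> v" "v \<le> zmax" for u v
    using continual_diagram_lipschitz[OF w, of v u] that by (simp add: D_def e2)
  obtain p where p: "z0 \<le> p" "p \<le> zmax" "D p = 0"
  proof -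
    have "continuous_on {z0..zmax} (\<lambda>u. \<omega> u - (\<Omega> (z0 - \<epsilon>) - \<epsilon> + (u - z0)))"
      by (intro continuous_intros continual_diagram_continuous[OF w])
    then have "continuous_on {z0..zmax} D"
      by (rule continuous_on_eq) (auto simp: D_def e2)
    then have "\<exists>x. z0 \<le> x \<and> x \<le> zmax \<and> D x = 0"
      by (intro IVT2') (use Dl[of z0] Dr[of zmax] zz \<epsilon> in auto)
    then show ?thesis using that by blast
  qed
  have Dp1: "0 \<le> D u" if "u \<le> p" for u
    using Dl[of u] Dmono[of u p] p that by (cases "u \<le> z0") auto
  have Dp2: "D u \<le> 0" if "p \<le> u" for u
    using Dr[of u] Dmono[of p u] p that by (cases "zmax \<le> u") auto
  have mp: "- m \<le> p" "p \<le> m" using m p by auto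

  \<comment> \<open>The hybrid slope differs from that of \<open>\<omega>\<close> only left of p and
    from the extremal one only from p on, so each of the two comparisons leaves an open half-line
    untouched.\<close>
  define sn where "sn x = (if x < p then se x else s\<omega> x)" for x
  have sn: "admissible sn"
  proof -
    have [measurable]: "se \<in> borel_measurable borel" "s\<omega> \<in> borel_measurable borel"
      using se s\<omega>(1) by (auto simp: admissible_def)
    have "sn x = sgn x" if "max m1 m2 \<le> \<bar>x\<bar>" for x
      using m1(2)[of x] m2(2)[of x] that by (auto simp: sn_def)
    moreover have "sn \<in> borel_measurable borel" unfolding sn_def[abs_def] by measurable
    moreover have "\<bar>sn x\<bar> \<le> 1" for x using se s\<omega>(1) by (auto simp: sn_def admissible_def)
    ultimately show ?thesis unfolding admissible_def by blast
  qed
  obtain N where N: "real_distribution N" "\<And>z. 0 < Im z \<Longrightarrow> (\<integral>x. 1 / (z - of_real x) \<partial>N) = slope_transform sn z"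
    using slope_measure_exists[OF sn] by blast
  interpret N: real_distribution N by (rule N(1))

  have one: "continuous_on UNIV (\<lambda>_::real. 1::real)" by simp

  let ?r1 = "\<lambda>x. (s\<omega> x - sn x) / 2"
  have r1: "bounded_slope ?r1" by (rule bounded_slope_half_diff[OF s\<omega>(1) sn])
  have supp1: "- m \<le> x \<and> x < p" if "s\<omega> x \<noteq> sn x" for x
  proof -
    have "x < p" "s\<omega> x \<noteq> se x" using that by (auto simp: sn_def split: if_splits)
    then show ?thesis using eqm[of x] by linarith
  qed
  have F1: "integral {- m..c} ?r1 = D c / 2" if "- m \<le> c" "c \<le> p" for c
  proof (rule integral_unique)
    have "((\<lambda>x. (s\<omega> x - se x) / 2) has_integral (D c / 2)) {- m..c}" using Di[OF that(1)] Dm by simp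
    then show "(?r1 has_integral (D c / 2)) {- m..c}"
      by (rule has_integral_spike_finite[where S="{p}", rotated 2]) (use that in \<open>auto simp: sn_def\<close>)
  qed
  have c1: "(\<integral>x. indicator {t. 0 < t - p} x * 1 \<partial>N) \<le> measure \<mu>\<omega> {t. 0 < t - p}"
  proof (rule slope_measure_compare[OF A N s\<omega>(1) sn one])
    show "t - p \<le> \<bar>t - x\<bar>" if "s\<omega> x \<noteq> sn x" for t x using supp1[OF that] by linarith
    fix t assume t: "0 < t - p"
    have "(\<integral>x. ?r1 x / (t - x) \<partial>lborel) \<le> 0"
    proof (rule cauchy_kernel_integral_nonpos[OF r1 mp(1)])
      show "?r1 x = 0" if "x \<notin> {- m..p}" for x using supp1[of x] that by force
    qed (use F1 Dp1 p mp t in auto)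
    then show "1 \<le> exp (- (\<integral>x. ?r1 x / (t - x) \<partial>lborel))" by simp
  qed (auto intro!: continuous_intros)
  \<comment> \<open>The point p belongs to neither of the two open half-lines, so its mass needs the
    separate comparison.\<close>
  have atom: "measure N {p} \<le> measure \<mu>\<omega> {p}"
    by (rule slope_measure_atom_le[OF A N s\<omega>(1) sn supp1 mp(1)]) (use F1 Dp1 p mp in auto)

  let ?r2 = "\<lambda>x. (se x - sn x) / 2"
  have r2: "bounded_slope ?r2" by (rule bounded_slope_half_diff[OF se sn])
  have supp2: "p \<le> x \<and> x \<le> m" if "se x \<noteq> sn x" for x
  proof -
    have "p \<le> x" "s\<omega> x \<noteq> se x" using that by (auto simp: sn_def split: if_splits)
    then show ?thesis using eqm[of x] by linarith
  qed
  have F2: "integral {p..c} ?r2 = - D c / 2" if "p \<le> c" for c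
  proof (rule integral_unique)
    have "((\<lambda>x. - ((s\<omega> x - se x) / 2)) has_integral (- D c / 2)) {p..c}"
      using has_integral_neg[OF Di[OF that]] p by simp
    then show "(?r2 has_integral (- D c / 2)) {p..c}"
      by (rule has_integral_eq[rotated]) (auto simp: sn_def field_simps)
  qed
  have c2: "(\<integral>x. indicator {t. 0 < p - t} x * 1 \<partial>N) \<le> measure X {t. 0 < p - t}"
  proof (rule slope_measure_compare[OF X N se sn one])
    show "p - t \<le> \<bar>t - x\<bar>" if "se x \<noteq> sn x" for t x using supp2[OF that] by linarith
    fix t assume t: "0 < p - t"
    have "(\<integral>x. ?r2 x / (t - x) \<partial>lborel) \<le> 0"
    proof (rule cauchy_kernel_integral_nonpos[OF r2 mp(2)])
      show "?r2 x = 0" if "x \<notin> {p..m}" for x using supp2[of x] that by force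
    qed (use F2 Dp2 Dm mp t in auto)
    then show "1 \<le> exp (- (\<integral>x. ?r2 x / (t - x) \<partial>lborel))" by simp
  qed (auto intro!: continuous_intros)

  \<comment> \<open>For t > zmax this is exp of minus ln (t - zmax + \<epsilon>) - ln (t - zmax),
    the bound for mass packed against \<open>zmax\<close>. The maxima extend it continuously by 0 to
    the left.\<close>
  define \<phi> where "\<phi> t = max 0 (t - zmax) / (max 0 (t - zmax) + \<epsilon>)" for t
  let ?r3 = "\<lambda>x. (se x - s' x) / 2"
  have r3: "bounded_slope ?r3" by (rule bounded_slope_half_diff[OF se s'])
  have s'1: "\<bar>s' x\<bar> \<le> 1" for x using s' by (simp add: admissible_def)
  \<comment> \<open>Relative to the shifted diagram the extremal one climbs from -\<epsilon> to
    +\<epsilon>, a gain of 2 \<epsilon>; the factor 1/2 in the exponent leaves mass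
    \<epsilon>.\<close>
  have F3: "integral {z0..zmax} ?r3 = \<epsilon>"
  proof (rule integral_unique)
    have z0m: "z0 \<le> zmax" using zz \<epsilon> by simp
    show "(?r3 has_integral \<epsilon>) {z0..zmax}"
      using has_integral_divide[OF has_integral_diff[OF sei[OF z0m] s'i[OF z0m]], of 2] zm
      by (simp add: e1[of z0] e3[of zmax])
  qed
  have c3: "(\<integral>x. indicator {t. 0 < t - zmax} x * \<phi> x \<partial>B) \<le> measure X {t. 0 < t - zmax}"
  proof (rule slope_measure_compare[OF X B se s'])
    show "continuous_on UNIV \<phi>" unfolding \<phi>_def using \<epsilon>
      by (intro continuous_intros) (auto simp: add_nonneg_eq_0_iff)
    show "0 \<le> \<phi> t" "\<phi> t \<le> 1" for t unfolding \<phi>_def using \<epsilon> by (auto simp: divide_le_eq max_def)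
    show "t - zmax \<le> \<bar>t - x\<bar>" if "se x \<noteq> s' x" for t x using that by (auto simp: se_def split: if_splits)
    fix t assume t: "0 < t - zmax"
    have "(\<integral>x. ?r3 x / (t - x) \<partial>lborel) \<le> ln (t - zmax + \<epsilon>) - ln (t - zmax)"
    proof (rule integral_inverse_le_log[OF r3 _ zz _ F3 \<epsilon>])
      show "0 \<le> ?r3 x" for x using s'1[of x] by (auto simp: se_def abs_le_iff)
      show "?r3 x = 0" if "x \<notin> {z0..zmax}" for x using that by (auto simp: se_def)
    qed (use t in simp)
    also have "\<dots> = - ln (\<phi> t)" using t \<epsilon> by (simp add: \<phi>_def ln_div)
    finally have "ln (\<phi> t) \<le> - (\<integral>x. ?r3 x / (t - x) \<partial>lborel)" by simp
    moreover have "0 < \<phi> t" using t \<epsilon> by (simp add: \<phi>_def)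
    ultimately show "\<phi> t \<le> exp (- (\<integral>x. ?r3 x / (t - x) \<partial>lborel))"
      by (metis exp_le_cancel_iff exp_ln)
  qed (auto intro!: continuous_intros)

  let ?I = "set_lebesgue_integral \<mu>\<Omega> {zmax - \<epsilon>..} (\<lambda>z. 1 - \<epsilon> / (z + 2 * \<epsilon> - zmax))"
  \<comment> \<open>Translation by \<epsilon> turns \<phi> into 1 - \<epsilon>/(x + 2 \<epsilon> -
    zmax). This vanishes at x = zmax - \<epsilon>, so the open half-line of the comparison and the
    closed one of the claim give the same integral.\<close>
  have I: "?I = (\<integral>x. indicator {t. 0 < t - zmax} x * \<phi> x \<partial>B)"
  proof -
    have [measurable]: "\<phi> \<in> borel_measurable borel" unfolding \<phi>_def[abs_def] by measurable
    have "(\<integral>x. indicator {t. 0 < t - zmax} x * \<phi> x \<partial>B) = (\<integral>x. indicator {t. 0 < t - zmax} (x + \<epsilon>) * \<phi> (x + \<epsilon>) \<partial>\<mu>\<Omega>)"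
      unfolding B_def by (rule integral_distr) auto
    also have "\<dots> = ?I"
      unfolding set_lebesgue_integral_def
    proof (rule Bochner_Integration.integral_cong[OF refl])
      fix x
      have "x < zmax - \<epsilon> \<or> x = zmax - \<epsilon> \<or> zmax - \<epsilon> < x" by auto
      then show "indicator {t. 0 < t - zmax} (x + \<epsilon>) * \<phi> (x + \<epsilon>) = indicator {zmax - \<epsilon>..} x *\<^sub>R (1 - \<epsilon> / (x + 2 * \<epsilon> - zmax))"
        using \<epsilon> by (auto simp: \<phi>_def indicator_def field_simps)
    qed
    finally show ?thesis by simp
  qed
  have sets_eq: "{t. 0 < t - p} = {p<..}" "{t. 0 < p - t} = {..<p}" "{t. 0 < t - zmax} = {zmax<..}" by auto
  have N1: "measure N {p<..} \<le> measure \<mu>\<omega> {p<..}" using c1 unfolding sets_eq by simp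
  have N2: "measure N {..<p} \<le> measure X {..<p}" using c2 unfolding sets_eq by simp
  have split: "measure M {..<p} + (measure M {p} + measure M {p<..}) = 1" if "real_distribution M" for M
  proof -
    interpret M: real_distribution M by fact
    have "measure M ({..<p} \<union> ({p} \<union> {p<..})) = measure M {..<p} + (measure M {p} + measure M {p<..})"
      by (subst M.finite_measure_Union; (subst M.finite_measure_Union)?) auto
    moreover have "{..<p} \<union> ({p} \<union> {p<..}) = space M" by auto
    ultimately show ?thesis using M.prob_space by simp
  qed
  have "measure X {zmax<..} \<le> measure X {p<..}" using p by (intro X.finite_measure_mono) auto
  \<comment> \<open>Bounding the atom and the right half-line from below by the masses of
    \<open>N\<close> bounds the left mass from above: the mass of \<open>\<mu>\<omega>\<close> left
    of p is at most that of \<open>N\<close>, hence at most that of \<open>X\<close>, which is at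
    most 1 minus the mass of \<open>X\<close> right of \<open>zmax\<close>.\<close>
  then have le_p: "measure \<mu>\<omega> {..<p} \<le> 1 - ?I"
    using split[OF A(1)] split[OF N(1)] split[OF X(1)] N1 N2 atom c3 unfolding I sets_eq
    by (smt (verit) measure_nonneg)
  have "measure \<mu>\<omega> {..<z0} \<le> measure \<mu>\<omega> {..<p}" using p by (intro A.finite_measure_mono) auto
  with le_p have le: "measure \<mu>\<omega> {..<z0} \<le> 1 - ?I" by linarith
  have "((\<lambda>\<tau>. Kfun \<mu>\<omega> (z0 - \<tau>)) \<longlongrightarrow> measure \<mu>\<omega> {..<z0}) (at_right 0)"
  proof -
    have "filterlim (\<lambda>\<tau>. z0 - \<tau>) (at_left z0) (at_right 0)"
      unfolding filterlim_at
    proof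
      show "\<forall>\<^sub>F \<tau> in at_right 0. z0 - \<tau> \<in> {..<z0} \<and> z0 - \<tau> \<noteq> z0"
        using eventually_at_right_less[of 0] by (auto elim: eventually_mono)
      have "((\<lambda>\<tau>. z0 - \<tau>) \<longlongrightarrow> z0 - 0) (at_right 0)" by (intro tendsto_intros)
      then show "((\<lambda>\<tau>. z0 - \<tau>) \<longlongrightarrow> z0) (at_right 0)" by simp
    qed
    from filterlim_compose[OF A.cdf_at_left this] show ?thesis by (simp add: Kfun_def cdf_def)
  qed
  then have "Lim (at_right 0) (\<lambda>\<tau>. Kfun \<mu>\<omega> (z0 - \<tau>)) = measure \<mu>\<omega> {..<z0}"
    by (intro tendsto_Lim) (auto simp: trivial_limit_at_right_real)
  moreover have "1 - ?I = (\<integral>z. indicator {..<zmax - \<epsilon>} z + indicator {zmax - \<epsilon>..} z * (\<epsilon> / (z + 2 * \<epsilon> - zmax)) \<partial>\<mu>\<Omega>)"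
  proof -
    let ?f = "\<lambda>z. indicator {zmax - \<epsilon>..} z *\<^sub>R (1 - \<epsilon> / (z + 2 * \<epsilon> - zmax))"
    have "integrable \<mu>\<Omega> ?f"
    proof (rule P.integrable_const_bound[where B=1])
      show "AE z in \<mu>\<Omega>. norm (?f z) \<le> 1"
      proof (rule AE_I2)
        fix z show "norm (?f z) \<le> 1"
        proof (cases "zmax - \<epsilon> \<le> z")
          case True
          then have "0 \<le> \<epsilon> / (z + 2 * \<epsilon> - zmax)" "\<epsilon> / (z + 2 * \<epsilon> - zmax) \<le> 1" using \<epsilon> by (auto simp: divide_le_eq)
          then show ?thesis using True by simp
        qed simp
      qed
    qed simp
    then have "(\<integral>z. 1 - ?f z \<partial>\<mu>\<Omega>) = 1 - ?I"
      using P.prob_space[unfolded P.space_eq_univ]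
      by (subst Bochner_Integration.integral_diff) (auto simp: set_lebesgue_integral_def)
    moreover have "1 - ?f z = indicator {..<zmax - \<epsilon>} z + indicator {zmax - \<epsilon>..} z * (\<epsilon> / (z + 2 * \<epsilon> - zmax))" for z
      by (auto simp: indicator_def)
    ultimately show ?thesis by simp
  qed
  ultimately show ?thesis using le by simp
qed

end
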